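(* Inside $\mathbb{P}\mathcal{V}_{L_2(7)}\cong\mathbb{P}^1$ there are exactly $6$ points corresponding to singular cubic fourfolds (with $L_2(7)$-action). Two of them have $7$ nodes, another two have $14$ nodes, and the remaining two cubic fourfolds have as singular locus a smooth surface which is a quadratic Veronese embedding of $\mathbb{P}^2$ in $\mathbb{P}^5$; the latter two are determinantal cubic fourfolds. Each of these three pairs contributes one point in $\overline{\mathcal{F}}_{L_2(7)}$. The equations of the six singular cubic fourfolds are: - determinantal cubic fourfolds: $f_1+3\frac{1+\sqrt{-7}}4f_2$ and $f_1+3\frac{1-\sqrt{-7}}4f_2$; - $7$ nodes: $f_1-\frac3{10}f_2$ and $f_1-15f_2$; - $14$ nodes: $f_1-\frac32f_2$ and $f_1-3f_2$.
   Context: Everything is over $\mathbb{C}$. $L_2(7)=\mathrm{PSL}(2,\mathbb{F}_7)$. Let $L_2(7)=\langle(12)(36),(1234567)\rangle\subset S_7$ permute the coordinates of $\mathbb{C}^7$; the resulting irreducible $6$-dimensional representation on $\{x_1+\dots+x_7=0\}$, in coordinates $x_1,\dots,x_6$, embeds $L_2(7)$ in $\mathrm{GL}(6,\mathbb{C})$ and $\mathrm{PGL}(6,\mathbb{C})$. $\mathcal{V}_{L_2(7)}$ is the space of $L_2(7)$-invariant cubic forms, spanned by $f_1,f_2$, obtained by substituting $x_7=-(x_1+\cdots+x_6)$ in $x_1^3+\cdots+x_7^3$ and $x_1x_2x_4+x_2x_3x_5+x_3x_4x_6+x_1x_5x_6+x_1x_3x_7+x_4x_5x_7+x_2x_6x_7$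 respectively. $\overline{\mathcal{F}}_{L_2(7)}$ is the GIT quotient of $\mathbb{P}\mathcal{V}_{L_2(7)}$ by $N_{\mathrm{PGL}(6,\mathbb{C})}(L_2(7))$ (more precisely by its preimage in $\mathrm{SL}(6,\mathbb{C})$). A node is an isolated $A_1$ singularity. A determinantal cubic fourfold is one projectively equivalent to the zero locus of the determinant of the generic symmetric $3\times3$ matrix. *)

theory Defs
  imports
    "HOL-Analysis.Analysis"
    "HOL-Algebra.Bij"
    "HOL-Algebra.Generated_Groups"
    "HOL-Algebra.Group_Action"
begin

section \<open>Projective spaces, forms and hypersurfaces\<close>

text \<open>Points of a projective space are complex lines through the origin. The indices of
  \<^typ>\<open>complex^6\<close> are \<open>1, \<dots>, 6\<close>, with \<open>6 = 0\<close> in the index type; similarly for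
  the other dimensions.\<close>

definition proj_pt :: "complex^'n \<Rightarrow> (complex^'n) set" where
  "proj_pt v = vec.span {v}"

definition proj_space :: "(complex^'n) set set" where
  "proj_space = proj_pt ` {v. v \<noteq> 0}"

definition proj_equivalent :: "(complex^'n) set set \<Rightarrow> (complex^'n) set set \<Rightarrow> bool" where
  "proj_equivalent S T \<longleftrightarrow> (\<exists>A::complex^'n^'n. invertible A \<and> T = (\<lambda>L. (*v) A ` L) ` S)"

text \<open>Since the ground field is infinite, a homogeneous polynomial is identified with the
  function that it defines; \<open>m\<close> is the exponent vector of a monomial.\<close>

definition forms :: "nat \<Rightarrow> (complex^'n \<Rightarrow> complex) set" where
  "forms d = {F. \<exists>c::('n \<Rightarrow> nat) \<Rightarrow> complex.
     \<forall>x. F x = (\<Sum>m | (\<Sum>i\<in>UNIV. m i) = d. c m * (\<Prod>i\<in>UNIV. x $ i ^ m i))}"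

definition form_pt :: "(complex^'n \<Rightarrow> complex) \<Rightarrow> (complex^'n \<Rightarrow> complex) set" where
  "form_pt F = {(\<lambda>x. c * F x) |c. True}"

definition proj_zeros :: "(complex^'n \<Rightarrow> complex) \<Rightarrow> (complex^'n) set set" where
  "proj_zeros F = proj_pt ` {v. v \<noteq> 0 \<and> F v = 0}"

definition grad :: "(complex^'n \<Rightarrow> complex) \<Rightarrow> complex^'n \<Rightarrow> complex^'n" where
  "grad F v = (\<chi> i. deriv (\<lambda>t. F (v + axis i t)) 0)"

definition sing_locus :: "(complex^'n \<Rightarrow> complex) \<Rightarrow> (complex^'n) set set" where
  "sing_locus F = proj_pt ` {v. v \<noteq> 0 \<and> F v = 0 \<and> grad F v = 0}"

section \<open>Nodes\<close>

definition holo_fun_on :: "(complex^'n) set \<Rightarrow> (complex^'n \<Rightarrow> complex) \<Rightarrow> bool" where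
  "holo_fun_on U g \<longleftrightarrow>
     (\<forall>z\<in>U. \<exists>a::complex^'n. (g has_derivative (\<lambda>h. \<Sum>i\<in>UNIV. a $ i * h $ i)) (at z))"

definition holo_map_on :: "(complex^'n) set \<Rightarrow> (complex^'n \<Rightarrow> complex^'m) \<Rightarrow> bool" where
  "holo_map_on U f \<longleftrightarrow> (\<forall>j. holo_fun_on U (\<lambda>z. f z $ j))"

text \<open>The germ of analytic hypersurface \<open>g = 0\<close> at the origin is isomorphic to that of
  \<open>z\<^sub>1\<^sup>2 + \<dots> + z\<^sub>n\<^sup>2 = 0\<close>: some biholomorphic change of coordinates \<open>\<phi>\<close> takes the one
  local equation to the other up to a unit \<open>u\<close>.\<close>

definition A1_germ :: "(complex^'n \<Rightarrow> complex) \<Rightarrow> bool" where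
  "A1_germ g \<longleftrightarrow> (\<exists>U W u. \<exists>\<phi> \<psi> :: complex^'n \<Rightarrow> complex^'n. open U \<and> open W \<and> 0 \<in> U \<and> \<phi> 0 = 0 \<and>
     homeomorphism U W \<phi> \<psi> \<and> holo_map_on U \<phi> \<and> holo_map_on W \<psi> \<and>
     holo_fun_on U u \<and> (\<forall>z\<in>U. u z \<noteq> 0) \<and>
     (\<forall>z\<in>U. g (\<phi> z) = u z * (\<Sum>i\<in>UNIV. (z $ i)\<^sup>2)))"

text \<open>\<open>z \<mapsto> [v + B z]\<close> is an affine chart of \<open>\<P>\<^sup>5\<close> centred at \<open>L = [v]\<close>, and
  \<open>F (v + B z) = 0\<close> is the equation of the hypersurface in this chart.\<close>

definition A1_singularity :: "(complex^6 \<Rightarrow> complex) \<Rightarrow> (complex^6) set \<Rightarrow> bool" where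
  "A1_singularity F L \<longleftrightarrow> (\<exists>v. \<exists>B::complex^5^6. L = proj_pt v \<and>
     (\<forall>z c. B *v z + c *s v = 0 \<longrightarrow> z = 0 \<and> c = 0) \<and>
     A1_germ (\<lambda>z. F (v + B *v z)))"

definition isolated_singularity :: "(complex^6 \<Rightarrow> complex) \<Rightarrow> (complex^6) set \<Rightarrow> bool" where
  "isolated_singularity F L \<longleftrightarrow> L \<in> sing_locus F \<and>
     (\<exists>U. open U \<and> 0 \<notin> U \<and> L \<inter> U \<noteq> {} \<and> (\<forall>M\<in>sing_locus F. M \<inter> U \<noteq> {} \<longrightarrow> M = L))"

definition node :: "(complex^6 \<Rightarrow> complex) \<Rightarrow> (complex^6) set \<Rightarrow> bool" where
  "node F L \<longleftrightarrow> isolated_singularity F L \<and> A1_singularity F L"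

definition singular_exactly_in_nodes :: "nat \<Rightarrow> (complex^6 \<Rightarrow> complex) \<Rightarrow> bool" where
  "singular_exactly_in_nodes k F \<longleftrightarrow>
     finite (sing_locus F) \<and> card (sing_locus F) = k \<and> (\<forall>L\<in>sing_locus F. node F L)"

section \<open>Determinantal cubics and Veronese surfaces\<close>

definition generic_sym_det :: "complex^6 \<Rightarrow> complex" where
  "generic_sym_det x = det (vector [vector [x$1, x$2, x$3],
                                    vector [x$2, x$4, x$5],
                                    vector [x$3, x$5, x$6]] :: complex^3^3)"

definition determinantal :: "(complex^6 \<Rightarrow> complex) \<Rightarrow> bool" where
  "determinantal F \<longleftrightarrow> proj_equivalent (proj_zeros generic_sym_det) (proj_zeros F)"

definition veronese :: "complex^3 \<Rightarrow> complex^6" where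
  "veronese y = vector [(y$1)\<^sup>2, y$1 * y$2, y$1 * y$3, (y$2)\<^sup>2, y$2 * y$3, (y$3)\<^sup>2]"

definition veronese_surface :: "(complex^6) set set \<Rightarrow> bool" where
  "veronese_surface S \<longleftrightarrow> proj_equivalent ((\<lambda>y. proj_pt (veronese y)) ` {y. y \<noteq> 0}) S"

text \<open>A nonempty Zariski closed subset of \<open>\<P>\<^sup>5\<close> that, on a Zariski neighbourhood \<open>h \<noteq> 0\<close> of each
  of its points, is cut out by three forms with linearly independent differentials there.\<close>

definition smooth_surface :: "(complex^6) set set \<Rightarrow> bool" where
  "smooth_surface S \<longleftrightarrow> S \<noteq> {} \<and>
     (\<exists>G. G \<subseteq> (\<Union>d. forms d) \<and> S = proj_pt ` {v. v \<noteq> 0 \<and> (\<forall>g\<in>G. g v = 0)}) \<and>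
     (\<forall>v. v \<noteq> 0 \<and> proj_pt v \<in> S \<longrightarrow>
        (\<exists>h e. \<exists>g::3 \<Rightarrow> complex^6 \<Rightarrow> complex. \<exists>d.
           h \<in> forms e \<and> h v \<noteq> 0 \<and> (\<forall>i. g i \<in> forms (d i)) \<and>
           rank (\<chi> i. grad (g i) v) = 3 \<and>
           (\<forall>w. w \<noteq> 0 \<and> h w \<noteq> 0 \<longrightarrow> (proj_pt w \<in> S \<longleftrightarrow> (\<forall>i. g i w = 0)))))"

section \<open>The group and its representation\<close>

text \<open>The successor map of the index type \<open>7\<close> is the cycle \<open>(1234567)\<close>, as \<open>7 + 1 = 1\<close>.\<close>

definition L2_7 :: "(7 \<Rightarrow> 7) set" where
  "L2_7 = generate (BijGroup UNIV)
     {Transposition.transpose 1 2 \<circ> Transposition.transpose 3 6, \<lambda>i. i + 1}"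

definition to_hyperplane :: "complex^6 \<Rightarrow> complex^7" where
  "to_hyperplane x = vector [x$1, x$2, x$3, x$4, x$5, x$6, - (x$1 + x$2 + x$3 + x$4 + x$5 + x$6)]"

definition first_coords :: "complex^7 \<Rightarrow> complex^6" where
  "first_coords y = vector [y$1, y$2, y$3, y$4, y$5, y$6]"

definition perm_rep :: "(7 \<Rightarrow> 7) \<Rightarrow> complex^6 \<Rightarrow> complex^6" where
  "perm_rep \<sigma> x = first_coords (\<chi> i. to_hyperplane x $ inv_into UNIV \<sigma> i)"

definition invariant_cubics :: "(complex^6 \<Rightarrow> complex) set" where
  "invariant_cubics = {F \<in> forms 3. \<forall>\<sigma>\<in>L2_7. \<forall>x. F (perm_rep \<sigma> x) = F x}"

definition f1 :: "complex^6 \<Rightarrow> complex" where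
  "f1 x = (\<Sum>i\<in>UNIV. (to_hyperplane x $ i) ^ 3)"

definition f2 :: "complex^6 \<Rightarrow> complex" where
  "f2 x = (let y = to_hyperplane x in
     y$1 * y$2 * y$4 + y$2 * y$3 * y$5 + y$3 * y$4 * y$6 + y$1 * y$5 * y$6
     + y$1 * y$3 * y$7 + y$4 * y$5 * y$7 + y$2 * y$6 * y$7)"

definition pencil :: "complex^2 \<Rightarrow> complex^6 \<Rightarrow> complex" where
  "pencil a = (\<lambda>x. a$1 * f1 x + a$2 * f2 x)"

abbreviation cubic :: "complex \<Rightarrow> complex^6 \<Rightarrow> complex" where
  "cubic t \<equiv> (\<lambda>x. f1 x + t * f2 x)"

definition proj_invariant_cubics :: "(complex^6 \<Rightarrow> complex) set set" where
  "proj_invariant_cubics = form_pt ` {F \<in> invariant_cubics. F \<noteq> (\<lambda>x. 0)}"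

definition singular_points :: "(complex^6 \<Rightarrow> complex) set set" where
  "singular_points =
     form_pt ` {F \<in> invariant_cubics. F \<noteq> (\<lambda>x. 0) \<and> sing_locus F \<noteq> {}}"

section \<open>The GIT quotient\<close>

definition GL6 :: "(complex^6^6) monoid" where
  "GL6 = \<lparr>carrier = {A. invertible A}, monoid.mult = (**), one = mat 1\<rparr>"

definition scalars :: "(complex^6^6) set" where
  "scalars = {mat c |c. c \<noteq> 0}"

definition PGL6 :: "(complex^6^6) set monoid" where
  "PGL6 = GL6 Mod scalars"

definition to_PGL6 :: "complex^6^6 \<Rightarrow> (complex^6^6) set" where
  "to_PGL6 A = scalars #>\<^bsub>GL6\<^esub> A"

text \<open>The preimage in \<open>SL(6)\<close> of the normalizer in \<open>PGL(6)\<close>.\<close>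

definition SL_normalizer :: "(complex^6^6) set" where
  "SL_normalizer = {A. det A = 1 \<and>
     to_PGL6 A \<in> normalizer PGL6 ((\<lambda>\<sigma>. to_PGL6 (matrix (perm_rep \<sigma>))) ` L2_7)}"

text \<open>Homogeneous polynomial functions on the space of invariant cubics, expressed in the
  coordinates given by \<open>f1, f2\<close>, that are invariant under \<open>SL_normalizer\<close>. Invariance under
  \<open>F \<mapsto> F \<circ> A\<close> for all \<open>A\<close> is the same as under the contragredient action \<open>F \<mapsto> F \<circ> A\<^sup>-\<^sup>1\<close>.\<close>

definition git_invariants :: "nat \<Rightarrow> ((complex^6 \<Rightarrow> complex) \<Rightarrow> complex) set" where
  "git_invariants d = {P \<in> extensional invariant_cubics.
     (\<exists>p\<in>forms d. \<forall>a::complex^2. P (pencil a) = p a) \<and>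
     (\<forall>A\<in>SL_normalizer. \<forall>F\<in>invariant_cubics. P (\<lambda>x. F (A *v x)) = P F)}"

definition semistable :: "(complex^6 \<Rightarrow> complex) \<Rightarrow> bool" where
  "semistable F \<longleftrightarrow> F \<in> invariant_cubics \<and> (\<exists>d>0. \<exists>P\<in>git_invariants d. P F \<noteq> 0)"

text \<open>The GIT quotient is \<open>Proj\<close> of the graded ring of invariants. Its closed points are the images
  of the semistable points; the image of \<open>F\<close> is the homogeneous prime ideal of the invariants
  that vanish at \<open>F\<close>, here given by its homogeneous elements of positive degree.\<close>

definition git_point :: "(complex^6 \<Rightarrow> complex) \<Rightarrow> ((complex^6 \<Rightarrow> complex) \<Rightarrow> complex) set" where
  "git_point F = {P. \<exists>d>0. P \<in> git_invariants d \<and> P F = 0}"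

definition git_quotient :: "((complex^6 \<Rightarrow> complex) \<Rightarrow> complex) set set" where
  "git_quotient = git_point ` {F. semistable F}"

end

theory Submission
  imports Defs "HOL-Algebra.Multiplicative_Group"
begin

text \<open>The space of invariant cubics is computed from the polar trilinear form: the group is 2-transitive on the
  coordinates, so such a form is constant on few orbits of index triples. The coordinates \<open>u\<^sub>k\<close> of the discrete Fourier
  transform diagonalize the 7-cycle. In them the cubics of the pencil are combinations of the eight monomials of
  \<open>u\<^sub>1u\<^sub>2u\<^sub>4\<close>, \<open>u\<^sub>3u\<^sub>5u\<^sub>6\<close> and the cyclic sums of \<open>u\<^sub>1\<^sup>2u\<^sub>5\<close> and \<open>u\<^sub>3\<^sup>2u\<^sub>1\<close>. If the coefficient of one of the two cyclic
  sums vanishes, the cubic is a symmetric determinant; otherwise the equations of the critical points can be solved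
  explicitly, which leaves four parameters and at most 7 or 14 singular points. Conversely, the projections of the
  seven basis vectors are singular for \<open>t = -15\<close>, and the vectors \<open>(1, \<omega>, \<omega>\<^sup>2)\<close> supported on the lines of the Fano
  plane are singular for \<open>t = -3\<close>. The incidence matrix of the Fano plane realizes the outer automorphism of the group
  and exchanges \<open>t\<close> with \<open>9 / (2 t)\<close>, which gives the other two parameters and identifies the points of each pair in
  the quotient.

  For the quotient, an element of the normalizer acts on the pencil, so it permutes the two lines spanned by the cubics with
  7 nodes; after composition with the incidence matrix it fixes the cubic with \<open>t = -15\<close>, hence permutes its seven nodes
  and is a multiple of a permutation. Thus the binary quadratic forms
  \<open>2 a\<^sub>2\<^sup>2 + 9 a\<^sub>1\<^sup>2 + k a\<^sub>1 a\<^sub>2\<close> have invariant powers, and these separate the three pairs.\<close>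

text \<open>The eight Fourier monomials are exactly those cubic ones whose indices add up to 0
  modulo 7, and doubling the indices groups them into four orbits. The number \<open>eta\<close>,
  the sum of \<open>zeta ^ k\<close> over the squares k modulo 7, brings in the square root of -7.
  Two obstacles shape the rest. A node is defined by a biholomorphic change of coordinates. Hence a
  holomorphic Morse lemma is proved for a sum of squares plus a cubic form, and the Hessian is
  diagonalized by an explicit basis at one singular point of each orbit of the 7-cycle. Secondly,
  the normalizer lives in the projective group, so its matrices conjugate the group into itself only
  up to scalars, and it is never computed. Integrality of traces removes these scalars for the two
  generators. A normalizing matrix that preserves the seven nodes is then a multiple of a coordinate
  permutation, a priori any of the 7! ones, and the full symmetry of \<open>f1\<close> controls the
  multiple. An unknown root of unity remains, which is why the invariants are high powers of
  quadratic forms.\<close>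

lemma exhaust_5: "x = 1 \<or> x = 2 \<or> x = 3 \<or> x = 4 \<or> x = 5" for x :: 5
proof (induct x)
  case (of_int z)
  then have "z = 0 \<or> z = 1 \<or> z = 2 \<or> z = 3 \<or> z = 4" by fastforce
  then show ?case by auto
qed

lemma exhaust_6: "x = 1 \<or> x = 2 \<or> x = 3 \<or> x = 4 \<or> x = 5 \<or> x = 6" for x :: 6
proof (induct x)
  case (of_int z)
  then have "z = 0 \<or> z = 1 \<or> z = 2 \<or> z = 3 \<or> z = 4 \<or> z = 5" by fastforce
  then show ?case by auto
qed

lemma exhaust_7: "x = 1 \<or> x = 2 \<or> x = 3 \<or> x = 4 \<or> x = 5 \<or> x = 6 \<or> x = 7" for x :: 7
proof (induct x)
  case (of_int z)
  then have "z = 0 \<or> z = 1 \<or> z = 2 \<or> z = 3 \<or> z = 4 \<or> z = 5 \<or> z = 6" by fastforce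
  then show ?case by auto
qed

lemma UNIV_5: "UNIV = {1, 2, 3, 4, 5 :: 5}" using exhaust_5 by auto
lemma UNIV_6: "UNIV = {1, 2, 3, 4, 5, 6 :: 6}" using exhaust_6 by auto
lemma UNIV_7: "UNIV = {1, 2, 3, 4, 5, 6, 7 :: 7}" using exhaust_7 by auto

lemma sum_5: "sum f (UNIV :: 5 set) = f 1 + f 2 + f 3 + f 4 + f 5"
  unfolding UNIV_5 by (simp add: ac_simps)
lemma sum_6: "sum f (UNIV :: 6 set) = f 1 + f 2 + f 3 + f 4 + f 5 + f 6"
  unfolding UNIV_6 by (simp add: ac_simps)
lemma sum_7: "sum f (UNIV :: 7 set) = f 1 + f 2 + f 3 + f 4 + f 5 + f 6 + f 7"
  unfolding UNIV_7 by (simp add: ac_simps)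

lemma forall_5: "(\<forall>i::5. P i) \<longleftrightarrow> P 1 \<and> P 2 \<and> P 3 \<and> P 4 \<and> P 5"
  by (metis exhaust_5)
lemma forall_6: "(\<forall>i::6. P i) \<longleftrightarrow> P 1 \<and> P 2 \<and> P 3 \<and> P 4 \<and> P 5 \<and> P 6"
  by (metis exhaust_6)
lemma forall_7: "(\<forall>i::7. P i) \<longleftrightarrow> P 1 \<and> P 2 \<and> P 3 \<and> P 4 \<and> P 5 \<and> P 6 \<and> P 7"
  by (metis exhaust_7)

lemma vector_5 [simp]:
  "(vector [a, b, c, d, e] :: 'a::zero^5) $ 1 = a" "(vector [a, b, c, d, e] :: 'a^5) $ 2 = b"
  "(vector [a, b, c, d, e] :: 'a^5) $ 3 = c" "(vector [a, b, c, d, e] :: 'a^5) $ 4 = d"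
  "(vector [a, b, c, d, e] :: 'a^5) $ 5 = e"
  by (simp_all add: vector_def)

lemma vector_6 [simp]:
  "(vector [a, b, c, d, e, f] :: 'a::zero^6) $ 1 = a" "(vector [a, b, c, d, e, f] :: 'a^6) $ 2 = b"
  "(vector [a, b, c, d, e, f] :: 'a^6) $ 3 = c" "(vector [a, b, c, d, e, f] :: 'a^6) $ 4 = d"
  "(vector [a, b, c, d, e, f] :: 'a^6) $ 5 = e" "(vector [a, b, c, d, e, f] :: 'a^6) $ 6 = f"
  by (simp_all add: vector_def)

lemma vector_7 [simp]:
  "(vector [a, b, c, d, e, f, g] :: 'a::zero^7) $ 1 = a" "(vector [a, b, c, d, e, f, g] :: 'a^7) $ 2 = b"
  "(vector [a, b, c, d, e, f, g] :: 'a^7) $ 3 = c" "(vector [a, b, c, d, e, f, g] :: 'a^7) $ 4 = d"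
  "(vector [a, b, c, d, e, f, g] :: 'a^7) $ 5 = e" "(vector [a, b, c, d, e, f, g] :: 'a^7) $ 6 = f"
  "(vector [a, b, c, d, e, f, g] :: 'a^7) $ 7 = g"
  by (simp_all add: vector_def)

section \<open>Projective points and linear maps\<close>

lemma proj_pt_alt: "proj_pt v = range (\<lambda>c. c *s v)"
  by (simp add: proj_pt_def vec.span_singleton)

lemma proj_pt_self [simp]: "v \<in> proj_pt v"
  by (simp add: proj_pt_def vec.span_base)

lemma proj_pt_eq_iff:
  assumes "w \<noteq> 0"
  shows "proj_pt v = proj_pt w \<longleftrightarrow> (\<exists>c. c \<noteq> 0 \<and> v = c *s w)"
proof
  assume "proj_pt v = proj_pt w"
  then obtain c where c: "v = c *s w" using proj_pt_self[of v] by (auto simp: proj_pt_alt)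
  moreover have "c \<noteq> 0"
  proof
    assume "c = 0"
    with c have "proj_pt v = {0}" by (auto simp: proj_pt_alt)
    with \<open>proj_pt v = proj_pt w\<close> have "w \<in> {0}" using proj_pt_self[of w] by metis
    with assms show False by simp
  qed
  ultimately show "\<exists>c. c \<noteq> 0 \<and> v = c *s w" by auto
next
  assume "\<exists>c. c \<noteq> 0 \<and> v = c *s w"
  then obtain c where c: "c \<noteq> 0" "v = c *s w" by auto
  have "k *s w = (k / c) *s v" for k using c by simp
  moreover have "k *s v = (k * c) *s w" for k using c by simp
  ultimately show "proj_pt v = proj_pt w" unfolding proj_pt_alt by (metis (no_types, lifting) image_cong image_subsetI rangeI subset_antisym)
qed

lemma image_proj_pt: "(*v) A ` proj_pt v = proj_pt (A *v v)"
  by (auto simp: proj_pt_alt vector_scalar_commute image_iff)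

lemma invertible_kernel:
  fixes A :: "'a::field^'n^'n"
  assumes "invertible A" shows "A *v x = 0 \<longleftrightarrow> x = 0"
  using assms by (metis invertible_left_inverse matrix_left_invertible_ker matrix_vector_mult_0_right)

lemma invertible_transpose:
  fixes A :: "'a::field^'n^'n"
  assumes "invertible A" shows "invertible (transpose A)"
  using assms unfolding invertible_def by (metis matrix_transpose_mul transpose_mat)

lemma invertible_obtain_inverse:
  fixes A :: "'a::field^'n^'n"
  assumes "invertible A"
  obtains B where "invertible B" "A ** B = mat 1" "B ** A = mat 1"
    "\<And>x. A *v (B *v x) = x" "\<And>x. B *v (A *v x) = x"
proof -
  from assms obtain B where B: "A ** B = mat 1" "B ** A = mat 1" by (auto simp: invertible_def)
  then have "invertible B" by (auto simp: invertible_def)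
  then show thesis using B that[of B] by (simp add: matrix_vector_mul_assoc)
qed

section \<open>Polynomial and holomorphic functions\<close>

lemma holo_fun_const: "holo_fun_on U (\<lambda>z. c)"
  unfolding holo_fun_on_def by (auto intro!: exI[of _ 0] derivative_eq_intros)

lemma has_derivative_vec_nth: "((\<lambda>z. z $ i) has_derivative (\<lambda>h. h $ i)) F" for i :: "'n::finite"
  by (rule bounded_linear_imp_has_derivative) (rule bounded_linear_vec_nth)

lemma holo_fun_nth: "holo_fun_on U (\<lambda>z. z $ i)" for i :: "'n::finite"
  unfolding holo_fun_on_def
proof
  fix z :: "complex^'n"
  have "(\<lambda>h. \<Sum>j\<in>UNIV. axis i 1 $ j * h $ j) = (\<lambda>h::complex^'n. h $ i)"
    by (simp add: axis_def if_distrib[of "\<lambda>c. c * _"] sum.delta cong: if_cong)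
  then show "\<exists>a::complex^'n. ((\<lambda>z. z $ i) has_derivative (\<lambda>h. \<Sum>i\<in>UNIV. a $ i * h $ i)) (at z)"
    using has_derivative_vec_nth by metis
qed

lemma holo_fun_add:
  assumes "holo_fun_on U f" "holo_fun_on U g" shows "holo_fun_on U (\<lambda>z. f z + g z)"
  unfolding holo_fun_on_def
proof
  fix z assume "z \<in> U"
  with assms obtain a b where "(f has_derivative (\<lambda>h. \<Sum>i\<in>UNIV. a $ i * h $ i)) (at z)"
     "(g has_derivative (\<lambda>h. \<Sum>i\<in>UNIV. b $ i * h $ i)) (at z)" unfolding holo_fun_on_def by blast
  from has_derivative_add[OF this]
  have "((\<lambda>z. f z + g z) has_derivative (\<lambda>h. \<Sum>i\<in>UNIV. (a + b) $ i * h $ i)) (at z)"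
    by (simp add: sum.distrib ring_distribs)
  then show "\<exists>a. ((\<lambda>z. f z + g z) has_derivative (\<lambda>h. \<Sum>i\<in>UNIV. a $ i * h $ i)) (at z)" by blast
qed

lemma holo_fun_mult:
  assumes "holo_fun_on U f" "holo_fun_on U g" shows "holo_fun_on U (\<lambda>z. f z * g z)"
  unfolding holo_fun_on_def
proof
  fix z assume "z \<in> U"
  with assms obtain a b where "(f has_derivative (\<lambda>h. \<Sum>i\<in>UNIV. a $ i * h $ i)) (at z)"
     "(g has_derivative (\<lambda>h. \<Sum>i\<in>UNIV. b $ i * h $ i)) (at z)" unfolding holo_fun_on_def by blast
  from has_derivative_mult[OF this]
  have "((\<lambda>z. f z * g z) has_derivative (\<lambda>h. \<Sum>i\<in>UNIV. (f z *s b + g z *s a) $ i * h $ i)) (at z)"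
    by (simp add: sum.distrib ring_distribs sum_distrib_left sum_distrib_right mult_ac)
  then show "\<exists>a. ((\<lambda>z. f z * g z) has_derivative (\<lambda>h. \<Sum>i\<in>UNIV. a $ i * h $ i)) (at z)" by blast
qed

lemma holo_fun_sum:
  "(\<And>i. i \<in> I \<Longrightarrow> holo_fun_on U (f i)) \<Longrightarrow> holo_fun_on U (\<lambda>z. \<Sum>i\<in>I. f i z)"
  by (induction I rule: infinite_finite_induct) (auto intro: holo_fun_const holo_fun_add)

lemma holo_fun_prod:
  "(\<And>i. i \<in> I \<Longrightarrow> holo_fun_on U (f i)) \<Longrightarrow> holo_fun_on U (\<lambda>z. \<Prod>i\<in>I. f i z)"
  by (induction I rule: infinite_finite_induct) (auto intro: holo_fun_const holo_fun_mult)

lemma holo_fun_power: "holo_fun_on U f \<Longrightarrow> holo_fun_on U (\<lambda>z. f z ^ k)"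
  by (induction k) (auto intro: holo_fun_const holo_fun_mult)

lemma holo_forms: "F \<in> forms d \<Longrightarrow> holo_fun_on U F"
proof -
  assume "F \<in> forms d"
  then obtain c where "F = (\<lambda>x. \<Sum>m | (\<Sum>i\<in>UNIV. m i) = d. c m * (\<Prod>i\<in>UNIV. x $ i ^ m i))"
    unfolding forms_def by blast
  then show ?thesis
    by (auto intro!: holo_fun_sum holo_fun_mult holo_fun_const holo_fun_prod holo_fun_power holo_fun_nth)
qed

text \<open>\<open>grad\<close> is assembled from one-variable derivatives along the axes. The chain
  rule reads them off a total derivative that is complex linear.\<close>

lemma grad_eqI:
  fixes F :: "complex^'n \<Rightarrow> complex"
  assumes "(F has_derivative (\<lambda>h. \<Sum>i\<in>UNIV. a $ i * h $ i)) (at v)"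
  shows "grad F v = a"
proof -
  have "deriv (\<lambda>t. F (v + axis i t)) 0 = a $ i" for i
  proof (rule DERIV_imp_deriv)
    have "((\<lambda>t. v + axis i t) has_derivative axis i) (at 0)"
      by (auto intro!: derivative_eq_intros bounded_linear_imp_has_derivative
          simp: linear_conv_bounded_linear[symmetric] linear_iff axis_def vec_eq_iff)
    moreover have *: "v + axis i 0 = v" by (simp add: axis_def vec_eq_iff)
    ultimately have "((\<lambda>t. F (v + axis i t)) has_derivative (\<lambda>t. \<Sum>j\<in>UNIV. a $ j * axis i t $ j)) (at 0)"
      using has_derivative_compose[of "\<lambda>t. v + axis i t" "axis i" 0 UNIV F "\<lambda>h. \<Sum>i\<in>UNIV. a $ i * h $ i"] assms
      unfolding * by blast
    also have "(\<lambda>t. \<Sum>j\<in>UNIV. a $ j * axis i t $ j) = (*) (a $ i)"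
      by (simp add: axis_def if_distrib[of "\<lambda>c. _ * c"] sum.delta cong: if_cong)
    finally show "((\<lambda>t. F (v + axis i t)) has_field_derivative a $ i) (at 0)"
      by (simp add: has_field_derivative_def)
  qed
  then show ?thesis by (simp add: grad_def vec_eq_iff)
qed

lemma holo_has_grad:
  assumes "holo_fun_on U F" "v \<in> U"
  shows "(F has_derivative (\<lambda>h. \<Sum>i\<in>UNIV. grad F v $ i * h $ i)) (at v)"
proof -
  from assms obtain a where *: "(F has_derivative (\<lambda>h. \<Sum>i\<in>UNIV. a $ i * h $ i)) (at v)"
    unfolding holo_fun_on_def by blast
  show ?thesis unfolding grad_eqI[OF *] by (rule *)
qed

lemma has_derivative_matrix:
  "((\<lambda>x. A *v x) has_derivative (\<lambda>h. A *v h)) F" for A :: "complex^'n^'m"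
proof (rule bounded_linear_imp_has_derivative)
  show "bounded_linear ((*v) A)" unfolding linear_conv_bounded_linear[symmetric]
    by (rule linearI) (simp_all add: matrix_vector_mult_def vec_eq_iff scaleR_sum_right ring_distribs sum.distrib)
qed

lemma has_derivative_compose_matrix:
  fixes A :: "complex^'n^'m"
  assumes "(F has_derivative (\<lambda>h. \<Sum>i\<in>UNIV. a $ i * h $ i)) (at (A *v v))"
  shows "((\<lambda>x. F (A *v x)) has_derivative (\<lambda>h. \<Sum>i\<in>UNIV. (transpose A *v a) $ i * h $ i)) (at v)"
proof -
  from has_derivative_compose[OF has_derivative_matrix assms]
  have "((\<lambda>x. F (A *v x)) has_derivative (\<lambda>h. \<Sum>i\<in>UNIV. a $ i * (A *v h) $ i)) (at v)" .
  also have "(\<lambda>h. \<Sum>i\<in>UNIV. a $ i * (A *v h) $ i) = (\<lambda>h. \<Sum>i\<in>UNIV. (transpose A *v a) $ i * h $ i)"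
  proof
    fix h :: "complex^'n"
    have "(\<Sum>i\<in>UNIV. a $ i * (A *v h) $ i) = (\<Sum>i\<in>UNIV. \<Sum>j\<in>UNIV. a $ i * (A $ i $ j * h $ j))"
      by (simp add: matrix_vector_mult_def sum_distrib_left)
    also have "\<dots> = (\<Sum>j\<in>UNIV. \<Sum>i\<in>UNIV. a $ i * (A $ i $ j * h $ j))" by (rule sum.swap)
    also have "\<dots> = (\<Sum>i\<in>UNIV. (transpose A *v a) $ i * h $ i)"
      unfolding matrix_vector_mult_def transpose_def vec_lambda_beta sum_distrib_right
      by (simp add: mult_ac)
    finally show "(\<Sum>i\<in>UNIV. a $ i * (A *v h) $ i) = (\<Sum>i\<in>UNIV. (transpose A *v a) $ i * h $ i)" .
  qed
  finally show ?thesis .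
qed

lemma grad_compose_matrix:
  fixes A :: "complex^'n^'m"
  assumes "holo_fun_on UNIV F" shows "grad (\<lambda>x. F (A *v x)) v = transpose A *v grad F (A *v v)"
  by (rule grad_eqI, rule has_derivative_compose_matrix, rule holo_has_grad[OF assms UNIV_I])

lemma proj_zeros_compose:
  fixes A :: "complex^'n^'n"
  assumes "invertible A"
  shows "proj_zeros F = (\<lambda>L. (*v) A ` L) ` proj_zeros (\<lambda>x. F (A *v x))"
proof -
  obtain B where B: "invertible B" "\<And>x. A *v (B *v x) = x"
    by (rule invertible_obtain_inverse[OF assms]) metis
  have "{v. v \<noteq> 0 \<and> F v = 0} = (*v) A ` {v. v \<noteq> 0 \<and> F (A *v v) = 0}"
    using B invertible_kernel[OF assms] invertible_kernel[OF B(1)] by (auto simp: image_iff) metis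
  then show ?thesis by (simp add: proj_zeros_def image_image image_proj_pt)
qed

text \<open>By the chain rule the gradient of the pulled back form is \<open>transpose A\<close>
  applied to the gradient at \<open>A *v v\<close>, and this transpose has trivial kernel.\<close>

lemma sing_locus_compose:
  fixes A :: "complex^'n^'n"
  assumes "invertible A" "holo_fun_on UNIV F"
  shows "sing_locus F = (\<lambda>L. (*v) A ` L) ` sing_locus (\<lambda>x. F (A *v x))"
proof -
  obtain B where B: "invertible B" "\<And>x. A *v (B *v x) = x"
    by (rule invertible_obtain_inverse[OF assms(1)]) metis
  have "{v. v \<noteq> 0 \<and> F v = 0 \<and> grad F v = 0}
      = (*v) A ` {v. v \<noteq> 0 \<and> F (A *v v) = 0 \<and> grad (\<lambda>x. F (A *v x)) v = 0}"
    unfolding grad_compose_matrix[OF assms(2)]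
    using B invertible_kernel[OF assms(1)] invertible_kernel[OF B(1)]
      invertible_kernel[OF invertible_transpose[OF assms(1)]] by (auto simp: image_iff) metis
  then show ?thesis by (simp add: sing_locus_def image_image image_proj_pt)
qed

lemma sing_locus_scale:
  assumes "holo_fun_on UNIV F" "c \<noteq> 0"
  shows "sing_locus (\<lambda>x. c * F x) = sing_locus F"
proof -
  have "grad (\<lambda>x. c * F x) v = c *s grad F v" for v
    by (rule grad_eqI) (use has_derivative_mult_right[OF holo_has_grad[OF assms(1) UNIV_I[of v]], of c]
      in \<open>simp add: sum_distrib_left mult_ac\<close>)
  then show ?thesis using assms(2) by (simp add: sing_locus_def)
qed

lemma proj_zeros_scale: "c \<noteq> 0 \<Longrightarrow> proj_zeros (\<lambda>x. c * F x) = proj_zeros F"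
  by (simp add: proj_zeros_def)

section \<open>The algebra of forms\<close>

text \<open>A sum over an infinite set is 0 by convention, so the sums in \<open>forms\<close> have
  their intended meaning only because of this.\<close>

lemma finite_exponents: "finite {m :: 'n::finite \<Rightarrow> nat. (\<Sum>i\<in>UNIV. m i) = d}"
proof (rule finite_subset)
  show "{m :: 'n \<Rightarrow> nat. (\<Sum>i\<in>UNIV. m i) = d} \<subseteq> (UNIV \<rightarrow>\<^sub>E {..d})"
    by (auto simp: member_le_sum)
  show "finite ((UNIV :: 'n set) \<rightarrow>\<^sub>E {..d})" by (intro finite_PiE) auto
qed

lemma monomial_in_forms:
  assumes "(\<Sum>i\<in>UNIV. m i) = d" shows "(\<lambda>x. c * (\<Prod>i\<in>UNIV. x $ i ^ m i)) \<in> forms d"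
  unfolding forms_def using assms
  by (auto intro!: exI[of _ "\<lambda>k. if k = m then c else 0"]
      simp: if_distrib[of "\<lambda>c. c * _"] sum.delta[OF finite_exponents] cong: if_cong)

lemma forms_zero: "(\<lambda>x. 0) \<in> forms d"
  unfolding forms_def by (auto intro!: exI[of _ "\<lambda>_. 0"])

lemma forms_add: assumes "F \<in> forms d" "G \<in> forms d" shows "(\<lambda>x. F x + G x) \<in> forms d"
proof -
  from assms obtain a b where "\<forall>x. F x = (\<Sum>m | (\<Sum>i\<in>UNIV. m i) = d. a m * (\<Prod>i\<in>UNIV. x $ i ^ m i))"
    "\<forall>x. G x = (\<Sum>m | (\<Sum>i\<in>UNIV. m i) = d. b m * (\<Prod>i\<in>UNIV. x $ i ^ m i))"
    unfolding forms_def by blast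
  then show ?thesis unfolding forms_def
    by (auto intro!: exI[of _ "\<lambda>m. a m + b m"] simp: sum.distrib ring_distribs)
qed

lemma forms_scale: assumes "F \<in> forms d" shows "(\<lambda>x. c * F x) \<in> forms d"
proof -
  from assms obtain a where "\<forall>x. F x = (\<Sum>m | (\<Sum>i\<in>UNIV. m i) = d. a m * (\<Prod>i\<in>UNIV. x $ i ^ m i))"
    unfolding forms_def by blast
  then show ?thesis unfolding forms_def
    by (auto intro!: exI[of _ "\<lambda>m. c * a m"] simp: sum_distrib_left mult_ac)
qed

lemma forms_sum: "(\<And>i. i \<in> I \<Longrightarrow> F i \<in> forms d) \<Longrightarrow> (\<lambda>x. \<Sum>i\<in>I. F i x) \<in> forms d"
  by (induction I rule: infinite_finite_induct) (auto intro: forms_zero forms_add)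

lemma forms_uminus: "F \<in> forms d \<Longrightarrow> (\<lambda>x. - F x) \<in> forms d"
  using forms_scale[of F d "-1"] by simp

lemma forms_diff: "F \<in> forms d \<Longrightarrow> G \<in> forms d \<Longrightarrow> (\<lambda>x. F x - G x) \<in> forms d"
  using forms_add[OF _ forms_uminus] by fastforce

lemma forms_mult:
  assumes "F \<in> forms d" "G \<in> forms e" shows "(\<lambda>x. F x * G x) \<in> forms (d + e)"
proof -
  from assms obtain a b where *: "\<And>x. F x = (\<Sum>m | (\<Sum>i\<in>UNIV. m i) = d. a m * (\<Prod>i\<in>UNIV. x $ i ^ m i))"
    "\<And>x. G x = (\<Sum>m | (\<Sum>i\<in>UNIV. m i) = e. b m * (\<Prod>i\<in>UNIV. x $ i ^ m i))"
    unfolding forms_def by blast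
  have "F x * G x = (\<Sum>m | (\<Sum>i\<in>UNIV. m i) = d. \<Sum>k | (\<Sum>i\<in>UNIV. k i) = e.
          (a m * b k) * (\<Prod>i\<in>UNIV. x $ i ^ (m i + k i)))" for x
    by (simp add: * sum_product power_add prod.distrib mult_ac)
  moreover have "(\<lambda>x. \<Sum>m | (\<Sum>i\<in>UNIV. m i) = d. \<Sum>k | (\<Sum>i\<in>UNIV. k i) = e.
          (a m * b k) * (\<Prod>i\<in>UNIV. x $ i ^ (m i + k i))) \<in> forms (d + e)"
    by (intro forms_sum monomial_in_forms) (auto simp: sum.distrib)
  ultimately show ?thesis by presburger
qed

lemma forms_const: "(\<lambda>x. c) \<in> forms 0"
  using monomial_in_forms[of "\<lambda>_. 0" 0 c] by simp

lemma forms_power: "F \<in> forms d \<Longrightarrow> (\<lambda>x. F x ^ k) \<in> forms (k * d)"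
  by (induction k) (auto intro: forms_const forms_mult)

lemma forms_prod: "(\<And>i. i \<in> I \<Longrightarrow> F i \<in> forms (d i)) \<Longrightarrow> (\<lambda>x. \<Prod>i\<in>I. F i x) \<in> forms (\<Sum>i\<in>I. d i)"
  by (induction I rule: infinite_finite_induct) (auto intro: forms_const forms_mult)

lemma forms_nth: "(\<lambda>x. x $ i) \<in> forms 1" for i :: "'n::finite"
proof -
  have "(\<lambda>x. 1 * (\<Prod>j\<in>UNIV. x $ j ^ (if j = i then 1 else 0))) \<in> forms 1"
    by (rule monomial_in_forms) (simp add: sum.delta)
  moreover have "(\<Prod>j\<in>UNIV. x $ j ^ (if j = i then 1 else 0)) = x $ i" for x :: "complex^'n"
    by (simp add: if_distrib[of "\<lambda>k. _ ^ k"] prod.delta cong: if_cong)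
  ultimately show ?thesis by simp
qed

lemma forms_compose_matrix:
  fixes A :: "complex^'n^'m"
  assumes "F \<in> forms d" shows "(\<lambda>x. F (A *v x)) \<in> forms d"
proof -
  from assms obtain a where *: "\<And>x. F x = (\<Sum>m | (\<Sum>i\<in>UNIV. m i) = d. a m * (\<Prod>i\<in>UNIV. x $ i ^ m i))"
    unfolding forms_def by blast
  have lin: "(\<lambda>x. (A *v x) $ i) \<in> forms 1" for i
    unfolding matrix_vector_mult_def vec_lambda_beta by (intro forms_sum forms_scale forms_nth)
  have "(\<lambda>x. a m * (\<Prod>i\<in>UNIV. (A *v x) $ i ^ m i)) \<in> forms d" if "(\<Sum>i\<in>UNIV. m i) = d" for m
  proof -
    have "(\<lambda>x. \<Prod>i\<in>UNIV. (A *v x) $ i ^ m i) \<in> forms (\<Sum>i\<in>UNIV. m i * 1)"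
      by (intro forms_prod forms_power lin)
    with that show ?thesis by (intro forms_scale) simp
  qed
  then show ?thesis unfolding * by (intro forms_sum) auto
qed

lemma forms_homogeneous:
  assumes "F \<in> forms d" shows "F (c *s x) = c ^ d * F x"
proof -
  from assms obtain a where *: "\<And>x. F x = (\<Sum>m | (\<Sum>i\<in>UNIV. m i) = d. a m * (\<Prod>i\<in>UNIV. x $ i ^ m i))"
    unfolding forms_def by blast
  show ?thesis unfolding * sum_distrib_left
    by (intro sum.cong) (auto simp: power_mult_distrib prod.distrib power_sum mult_ac)
qed

section \<open>The holomorphic Morse lemma for cubic polynomials\<close>

text \<open>Continuity of the derivative gives local injectivity, and invariance of domain makes
  images open. The inverse then has the inverse Jacobian matrix as its derivative; being a complex
  matrix, it makes the inverse holomorphic. Openness is stated for all open subsets of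
  \<open>U\<close> so that neighbourhoods can be shrunk later.\<close>

lemma holo_inverse_function:
  fixes f :: "complex^'m \<Rightarrow> complex^'m"
  assumes der: "\<And>x. (f has_derivative f' x) (at x)"
    and lin: "\<And>x. Vector_Spaces.linear (*s) (*s) (f' x)"
    and cont: "\<And>h. continuous_on UNIV (\<lambda>x. f' x h)"
    and ker: "\<And>h. f' a h = 0 \<Longrightarrow> h = 0"
  obtains U g where "open U" "a \<in> U" "\<And>V. open V \<Longrightarrow> V \<subseteq> U \<Longrightarrow> open (f ` V)"
    "\<And>x. x \<in> U \<Longrightarrow> g (f x) = x" "holo_map_on (f ` U) g"
proof -
  define J where "J x = matrix (f' x)" for x
  have J: "f' x h = J x *v h" for x h by (simp add: J_def matrix_works[OF lin])
  have contJ: "continuous_on UNIV (\<lambda>x. J x $ i $ j)" for i j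
  proof -
    have "continuous_on UNIV (\<lambda>x. f' x (axis j 1) $ i)"
      using cont by (intro continuous_intros)
    then show ?thesis by (simp add: J_def matrix_def)
  qed
  have inva: "invertible (J a)"
    using ker unfolding invertible_left_inverse matrix_left_invertible_ker J by blast
  have contf: "continuous_on S f" for S
    using der by (meson has_derivative_continuous continuous_at_imp_continuous_on)
  have contdet: "continuous_on UNIV (\<lambda>x. det (J x))"
    unfolding det_def by (intro continuous_intros contJ)
  have bl: "bounded_linear ((*v) M)" for M :: "complex^'m^'m"
    using has_derivative_bounded_linear[OF has_derivative_matrix] .
  from inva obtain Ja where Ja: "Ja ** J a = mat 1" by (auto simp: invertible_def)
  have on: "\<exists>d>0. \<forall>x. dist a x < d \<longrightarrow> onorm (\<lambda>v. f' x v - f' a v) < e" if "e > 0" for e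
  proof -
    \<comment> \<open>The sum of the absolute values of the entries of the difference bounds its
      operator norm and is visibly continuous.\<close>
    define N where "N x = (\<Sum>i\<in>UNIV. \<Sum>j\<in>UNIV. norm (J x $ i $ j - J a $ i $ j))" for x
    have "continuous_on UNIV N" unfolding N_def by (intro continuous_intros contJ)
    then have "isCont N a" by (simp add: continuous_on_eq_continuous_at)
    moreover have "N a = 0" by (simp add: N_def)
    ultimately obtain d where d: "d > 0" "\<And>x. dist x a < d \<Longrightarrow> dist (N x) 0 < e"
      using \<open>e > 0\<close> unfolding continuous_at_eps_delta by metis
    have "onorm (\<lambda>v. f' x v - f' a v) \<le> N x" for x
    proof (rule onorm_le)
      fix v
      have "norm (f' x v - f' a v) \<le> (\<Sum>i\<in>UNIV. norm ((f' x v - f' a v) $ i))"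
        by (simp add: norm_vec_def L2_set_le_sum)
      also have "\<dots> = (\<Sum>i\<in>UNIV. norm (\<Sum>j\<in>UNIV. (J x $ i $ j - J a $ i $ j) * v $ j))"
        by (simp add: J matrix_vector_mult_def sum_subtractf ring_distribs)
      also have "\<dots> \<le> (\<Sum>i\<in>UNIV. \<Sum>j\<in>UNIV. norm (J x $ i $ j - J a $ i $ j) * norm v)"
      proof (rule sum_mono)
        fix i
        have "norm (\<Sum>j\<in>UNIV. (J x $ i $ j - J a $ i $ j) * v $ j)
          \<le> (\<Sum>j\<in>UNIV. norm ((J x $ i $ j - J a $ i $ j) * v $ j))" by (rule norm_sum)
        also have "\<dots> \<le> (\<Sum>j\<in>UNIV. norm (J x $ i $ j - J a $ i $ j) * norm v)"
          by (intro sum_mono) (auto simp: norm_mult intro!: mult_left_mono Finite_Cartesian_Product.norm_nth_le)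
        finally show "norm (\<Sum>j\<in>UNIV. (J x $ i $ j - J a $ i $ j) * v $ j)
          \<le> (\<Sum>j\<in>UNIV. norm (J x $ i $ j - J a $ i $ j) * norm v)" .
      qed
      finally show "norm (f' x v - f' a v) \<le> N x * norm v"
        by (simp add: N_def sum_distrib_right)
    qed
    moreover have "N x < e" if "dist a x < d" for x
      using d(2)[of x] that by (simp add: dist_commute)
    ultimately show ?thesis using \<open>d > 0\<close> by (meson le_less_trans)
  qed
  obtain r where r: "r > 0" "inj_on f (ball a r)"
  proof (rule has_derivative_locally_injective[of a UNIV "(*v) Ja" f' f])
    show "(*v) Ja \<circ> f' a = id" by (auto simp: J matrix_vector_mul_assoc Ja)
  qed (auto simp: bl der on)
  \<comment> \<open>Off the zeros of the Jacobian determinant the inverse is differentiable at every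
    point of the image, not only at the image of \<open>a\<close>.\<close>
  define U where "U = ball a r \<inter> {x. det (J x) \<noteq> 0}"
  have "open {x. det (J x) \<noteq> 0}"
    using contdet by (intro open_Collect_neq) (auto intro: continuous_intros)
  then have U: "open U" by (auto simp: U_def)
  have aU: "a \<in> U" using r(1) inva by (simp add: U_def invertible_det_nz)
  have inj: "inj_on f U" using r(2) by (auto simp: U_def inj_on_def)
  have opn: "open (f ` V)" if "open V" "V \<subseteq> U" for V
    by (rule invariance_of_domain[OF contf that(1) inj_on_subset[OF inj that(2)]])
  define g where "g = inv_into U f"
  have gf: "g (f x) = x" if "x \<in> U" for x using inj that by (simp add: g_def)
  have contg: "continuous_on (f ` U) g"
    by (rule continuous_on_inverse_open[OF U contf]) (auto simp: gf)
  have "holo_map_on (f ` U) g" unfolding holo_map_on_def holo_fun_on_def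
  proof (intro allI ballI)
    fix j y assume "y \<in> f ` U"
    then obtain x where x: "x \<in> U" "y = f x" by auto
    from x have "invertible (J x)" by (simp add: U_def invertible_det_nz)
    then obtain M where M: "M ** J x = mat 1" by (auto simp: invertible_def)
    have "(g has_derivative (*v) M) (at y)"
    proof (rule has_derivative_inverse_basic[of f "f' x"])
      show "(f has_derivative f' x) (at (g y))" using der x gf by simp
      show "(*v) M \<circ> f' x = id" by (auto simp: J matrix_vector_mul_assoc M)
      show "continuous (at y) g"
        using contg opn[OF U order_refl] \<open>y \<in> f ` U\<close> by (metis continuous_on_eq_continuous_at)
    qed (use opn[OF U order_refl] \<open>y \<in> f ` U\<close> gf in \<open>auto simp: bl\<close>)
    then have "((\<lambda>z. g z $ j) has_derivative (\<lambda>h. (M *v h) $ j)) (at y)"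
      by (rule bounded_linear.has_derivative[OF bounded_linear_vec_nth])
    then show "\<exists>b. ((\<lambda>z. g z $ j) has_derivative (\<lambda>h. \<Sum>i\<in>UNIV. b $ i * h $ i)) (at y)"
      unfolding matrix_vector_mult_def vec_lambda_beta by blast
  qed
  then show thesis using that U aU opn gf by blast
qed

lemma has_derivative_vec_lambda:
  fixes F :: "'a::real_normed_vector \<Rightarrow> complex^'m"
  assumes "\<And>j. ((\<lambda>x. F x $ j) has_derivative (\<lambda>h. F' h $ j)) (at x)"
  shows "(F has_derivative F') (at x)"
proof -
  have "((\<lambda>x. F x \<bullet> axis j u) has_derivative (\<lambda>h. F' h \<bullet> axis j u)) (at x)" for j u
    using has_derivative_inner_left[OF assms[of j], of u] by (simp add: inner_axis)
  then show ?thesis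
    by (subst has_derivative_componentwise_within) (auto simp: Basis_vec_def)
qed

lemma holo_fun_compose:
  fixes F :: "complex^'n \<Rightarrow> complex^'m"
  assumes "holo_fun_on V G" "holo_map_on U F" "F ` U \<subseteq> V"
  shows "holo_fun_on U (\<lambda>x. G (F x))"
  unfolding holo_fun_on_def
proof
  fix x assume "x \<in> U"
  then have "\<forall>j. \<exists>b. ((\<lambda>x. F x $ j) has_derivative (\<lambda>h. \<Sum>i\<in>UNIV. b $ i * h $ i)) (at x)"
    using assms(2) unfolding holo_map_on_def holo_fun_on_def by blast
  then obtain b where b: "\<And>j. ((\<lambda>x. F x $ j) has_derivative (\<lambda>h. \<Sum>i\<in>UNIV. b j $ i * h $ i)) (at x)"
    by metis
  define M where "M = (\<chi> j. b j)"
  from \<open>x \<in> U\<close> assms obtain a where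
    a: "(G has_derivative (\<lambda>h. \<Sum>i\<in>UNIV. a $ i * h $ i)) (at (F x))"
    unfolding holo_fun_on_def by blast
  have "(F has_derivative (*v) M) (at x)"
    by (rule has_derivative_vec_lambda) (use b in \<open>simp add: M_def matrix_vector_mult_def\<close>)
  from has_derivative_compose[OF this a]
  have "((\<lambda>x. G (F x)) has_derivative (\<lambda>h. \<Sum>i\<in>UNIV. a $ i * (M *v h) $ i)) (at x)" .
  also have "(\<lambda>h. \<Sum>i\<in>UNIV. a $ i * (M *v h) $ i) = (\<lambda>h. \<Sum>i\<in>UNIV. (a v* M) $ i * h $ i)"
    by (simp add: matrix_vector_mult_def vector_matrix_mult_def sum_distrib_left sum_distrib_right mult_ac)
       (rule ext, rule sum.swap)
  finally show "\<exists>a. ((\<lambda>x. G (F x)) has_derivative (\<lambda>h. \<Sum>i\<in>UNIV. a $ i * h $ i)) (at x)" by blast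
qed

lemma holo_fun_continuous: "holo_fun_on U g \<Longrightarrow> continuous_on U g"
  unfolding holo_fun_on_def
  by (meson has_derivative_continuous continuous_at_imp_continuous_on)

lemma holo_map_continuous: "holo_map_on U g \<Longrightarrow> continuous_on U g" for g :: "complex^'n \<Rightarrow> complex^'m"
  proof -
  assume "holo_map_on U g"
  then have "continuous_on U (\<lambda>x. \<chi> j. g x $ j)"
    unfolding holo_map_on_def by (intro continuous_on_vec_lambda holo_fun_continuous) auto
  then show ?thesis by simp
qed

text \<open>Writing the function as \<open>z\<^sup>T (1 + L z) z\<close> with \<open>L z\<close> symmetric, the new coordinates are \<open>R z\<close> for
  a symmetric square root \<open>R\<close> of \<open>1 + L z\<close>. The pair \<open>(z, R)\<close> is found from the inverse function theorem:
  \<open>R\<^sup>T R + R - R\<^sup>T = 1 + L z\<close> is equivalent to \<open>R = R\<^sup>T\<close> and \<open>R\<^sup>2 = 1 + L z\<close>, and its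
  derivative with respect to \<open>R\<close> at the identity is multiplication by 2.\<close>

lemma A1_germ_cubic:
  fixes C :: "'n::finite \<Rightarrow> 'n \<Rightarrow> 'n \<Rightarrow> complex"
  assumes sym: "\<And>i j k. C i j k = C j i k"
  shows "A1_germ (\<lambda>z. (\<Sum>i\<in>UNIV. (z $ i)\<^sup>2) +
    (\<Sum>i\<in>UNIV. \<Sum>j\<in>UNIV. (\<Sum>k\<in>UNIV. C i j k * z $ k) * z $ i * z $ j))"
proof -
  define \<delta> :: "'n \<Rightarrow> 'n \<Rightarrow> complex" where "\<delta> i j = (if i = j then 1 else 0)" for i j
  define K :: "complex^('n + 'n \<times> 'n) \<Rightarrow> 'n \<Rightarrow> 'n \<Rightarrow> complex" where
    "K x i j = (\<Sum>k\<in>UNIV. x $ Inr (k, i) * x $ Inr (k, j)) + x $ Inr (i, j) - x $ Inr (j, i)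
       - (\<Sum>k\<in>UNIV. C i j k * x $ Inl k)" for x i j
  define K' :: "complex^('n + 'n \<times> 'n) \<Rightarrow> complex^('n + 'n \<times> 'n) \<Rightarrow> 'n \<Rightarrow> 'n \<Rightarrow> complex" where
    "K' x h i j = (\<Sum>k\<in>UNIV. x $ Inr (k, i) * h $ Inr (k, j) + h $ Inr (k, i) * x $ Inr (k, j))
       + h $ Inr (i, j) - h $ Inr (j, i) - (\<Sum>k\<in>UNIV. C i j k * h $ Inl k)" for x h i j
  \<comment> \<open>With z in the \<open>Inl\<close> and R in the \<open>Inr\<close> coordinates,
    \<open>\<Phi>1\<close> sends (z, R) to (z, K) and \<open>\<Phi>2\<close> sends it to (R z, K).
    On the slice where K is the identity matrix, both are local coordinates on the same manifold;
    passing from one to the other is the wanted change of coordinates z to R z.\<close>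
  define \<Phi>1 where "\<Phi>1 x = (\<chi> s. case s of Inl i \<Rightarrow> x $ Inl i | Inr (i, j) \<Rightarrow> K x i j)" for x
  define \<Phi>1' where "\<Phi>1' x h = (\<chi> s. case s of Inl i \<Rightarrow> h $ Inl i | Inr (i, j) \<Rightarrow> K' x h i j)" for x h
  define \<Phi>2 where "\<Phi>2 x = (\<chi> s. case s of Inl i \<Rightarrow> \<Sum>k\<in>UNIV. x $ Inr (i, k) * x $ Inl k
     | Inr (i, j) \<Rightarrow> K x i j)" for x
  define \<Phi>2' where "\<Phi>2' x h = (\<chi> s. case s of
       Inl i \<Rightarrow> \<Sum>k\<in>UNIV. x $ Inr (i, k) * h $ Inl k + h $ Inr (i, k) * x $ Inl k
     | Inr (i, j) \<Rightarrow> K' x h i j)" for x h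
  define \<iota> :: "complex^'n \<Rightarrow> complex^('n + 'n \<times> 'n)" where
    "\<iota> w = (\<chi> s. case s of Inl i \<Rightarrow> w $ i | Inr (i, j) \<Rightarrow> \<delta> i j)" for w
  define \<pi> :: "complex^('n + 'n \<times> 'n) \<Rightarrow> complex^'n" where "\<pi> x = (\<chi> i. x $ Inl i)" for x
  define e where "e = \<iota> 0"
  have nth: "\<iota> w $ Inl i = w $ i" "\<iota> w $ Inr (i, j) = \<delta> i j" "\<pi> x $ i = x $ Inl i"
    "e $ Inl i = 0" "e $ Inr (i, j) = \<delta> i j" for w x i j
    by (simp_all add: \<iota>_def \<pi>_def e_def)
  have dK: "((\<lambda>x. K x i j) has_derivative (\<lambda>h. K' x h i j)) (at x)" for x i j
    unfolding K_def K'_def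
    by (auto intro!: derivative_eq_intros has_derivative_vec_nth sum.cong)
  have d1: "(\<Phi>1 has_derivative \<Phi>1' x) (at x)" for x
    apply (rule has_derivative_vec_lambda)
    subgoal for j by (cases j) (auto simp: \<Phi>1_def \<Phi>1'_def dK has_derivative_vec_nth)
    done
  have d2: "(\<Phi>2 has_derivative \<Phi>2' x) (at x)" for x
    apply (rule has_derivative_vec_lambda)
    subgoal for j by (cases j) (auto simp: \<Phi>2_def \<Phi>2'_def dK
         intro!: derivative_eq_intros has_derivative_vec_nth)
    done
  have linK: "K' x (h + h') i j = K' x h i j + K' x h' i j" "K' x (c *s h) i j = c * K' x h i j" for x h h' i j c
    by (simp_all add: K'_def sum.distrib sum_distrib_left algebra_simps)
  have l1: "Vector_Spaces.linear (*s) (*s) (\<Phi>1' x)" for x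
    by unfold_locales (auto simp: \<Phi>1'_def vec_eq_iff linK split: sum.splits)
  have l2: "Vector_Spaces.linear (*s) (*s) (\<Phi>2' x)" for x
    by unfold_locales (auto simp: \<Phi>2'_def vec_eq_iff linK sum.distrib sum_distrib_left algebra_simps split: sum.splits)
  have cK: "continuous_on UNIV (\<lambda>x. K' x h i j)" for h i j
    unfolding K'_def by (intro continuous_intros)
  have c1: "continuous_on UNIV (\<lambda>x. \<Phi>1' x h)" for h
    unfolding \<Phi>1'_def
    apply (rule continuous_on_vec_lambda)
    subgoal for j by (cases j) (auto intro!: continuous_on_sum continuous_on_add continuous_on_mult
          continuous_on_component continuous_on_id continuous_on_const cK)
    done
  have c2: "continuous_on UNIV (\<lambda>x. \<Phi>2' x h)" for h
    unfolding \<Phi>2'_def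
    apply (rule continuous_on_vec_lambda)
    subgoal for j by (cases j) (auto intro!: continuous_on_sum continuous_on_add continuous_on_mult
          continuous_on_component continuous_on_id continuous_on_const cK)
    done
  have K'e: "K' e h i j = 2 * h $ Inr (i, j)" if "\<And>k. h $ Inl k = 0" for h i j
    using that by (simp add: K'_def nth \<delta>_def if_distrib[of "\<lambda>c. c * _"] if_distrib[of "\<lambda>c. _ * c"]
        sum.distrib sum.delta sum.delta' cong: if_cong)
  have k1: "h = 0" if "\<Phi>1' e h = 0" for h
  proof -
    have "h $ Inl k = 0" for k using arg_cong[OF that, of "\<lambda>v. v $ Inl k"] by (simp add: \<Phi>1'_def)
    moreover from this have "h $ Inr (i, j) = 0" for i j
      using arg_cong[OF that, of "\<lambda>v. v $ Inr (i, j)"] by (simp add: \<Phi>1'_def K'e)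
    ultimately show ?thesis by (simp add: vec_eq_iff split_sum_all)
  qed
  have k2: "h = 0" if "\<Phi>2' e h = 0" for h
  proof -
    have "h $ Inl k = 0" for k using arg_cong[OF that, of "\<lambda>v. v $ Inl k"]
      by (simp add: \<Phi>2'_def nth \<delta>_def if_distrib[of "\<lambda>c. c * _"] sum.delta' cong: if_cong)
    moreover from this have "h $ Inr (i, j) = 0" for i j
      using arg_cong[OF that, of "\<lambda>v. v $ Inr (i, j)"] by (simp add: \<Phi>2'_def K'e)
    ultimately show ?thesis by (simp add: vec_eq_iff split_sum_all)
  qed
  have Ke: "K e i j = \<delta> i j" for i j
    by (simp add: K_def nth \<delta>_def if_distrib[of "\<lambda>c. c * _"] sum.delta cong: if_cong)
  have \<Phi>e: "\<Phi>1 e = e" "\<Phi>2 e = e"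
    by (auto simp: \<Phi>1_def \<Phi>2_def vec_eq_iff Ke nth split: sum.splits)
  obtain U1 g1 where U1: "open U1" "e \<in> U1" "\<And>V. open V \<Longrightarrow> V \<subseteq> U1 \<Longrightarrow> open (\<Phi>1 ` V)"
    "\<And>x. x \<in> U1 \<Longrightarrow> g1 (\<Phi>1 x) = x" "holo_map_on (\<Phi>1 ` U1) g1"
    using holo_inverse_function[of \<Phi>1 \<Phi>1' e, OF d1 l1 c1 k1] by blast
  obtain U2 g2 where U2: "open U2" "e \<in> U2" "\<And>V. open V \<Longrightarrow> V \<subseteq> U2 \<Longrightarrow> open (\<Phi>2 ` V)"
    "\<And>x. x \<in> U2 \<Longrightarrow> g2 (\<Phi>2 x) = x" "holo_map_on (\<Phi>2 ` U2) g2"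
    using holo_inverse_function[of \<Phi>2 \<Phi>2' e, OF d2 l2 c2 k2] by blast
  \<comment> \<open>One neighbourhood for both maps: \<open>\<phi>\<close> and \<open>\<psi>\<close>
    are mutually inverse because they pass through the same point x of it.\<close>
  define \<Omega> where "\<Omega> = U1 \<inter> U2"
  have \<Omega>: "open \<Omega>" "e \<in> \<Omega>" using U1 U2 by (auto simp: \<Omega>_def)
  define B where "B = \<iota> -` \<Phi>2 ` \<Omega>"
  define A where "A = \<iota> -` \<Phi>1 ` \<Omega>"
  define \<phi> where "\<phi> w = \<pi> (g2 (\<iota> w))" for w
  define \<psi> where "\<psi> z = \<pi> (\<Phi>2 (g1 (\<iota> z)))" for z
  have holo\<iota>: "holo_map_on V \<iota>" for V
    unfolding holo_map_on_def
    apply (rule allI)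
    subgoal for j by (cases j) (auto simp: \<iota>_def intro: holo_fun_nth holo_fun_const)
    done
  have cont\<iota>: "continuous_on UNIV \<iota>" by (rule holo_map_continuous[OF holo\<iota>])
  have opn: "open B" "open A"
    unfolding A_def B_def using U1(3)[of \<Omega>] U2(3)[of \<Omega>] \<Omega>(1) cont\<iota>
    by (auto simp: \<Omega>_def intro: open_vimage)
  have 1: "\<pi> x = \<phi> w \<and> g1 (\<iota> (\<pi> x)) = x \<and> \<phi> w \<in> A \<and> \<psi> (\<phi> w) = w"
    if "x \<in> \<Omega>" "\<Phi>2 x = \<iota> w" for x w
  proof -
    have "g2 (\<iota> w) = x" using U2(4)[of x] that by (simp add: \<Omega>_def)
    moreover have *: "\<Phi>1 x = \<iota> (\<pi> x)"
      using that(2) by (auto simp: vec_eq_iff \<Phi>1_def \<Phi>2_def \<iota>_def \<pi>_def split: sum.splits)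
    moreover have "g1 (\<iota> (\<pi> x)) = x" using U1(4)[of x] that * by (simp add: \<Omega>_def)
    moreover have "\<pi> (\<iota> w) = w" by (simp add: vec_eq_iff nth)
    ultimately show ?thesis using that by (auto simp: \<phi>_def \<psi>_def A_def image_iff intro!: bexI[of _ x])
  qed
  have 2: "\<psi> z \<in> B \<and> \<phi> (\<psi> z) = z" if "x \<in> \<Omega>" "\<Phi>1 x = \<iota> z" for x z
  proof -
    have "g1 (\<iota> z) = x" using U1(4)[of x] that by (simp add: \<Omega>_def)
    moreover have "\<Phi>2 x = \<iota> (\<pi> (\<Phi>2 x))"
      using that(2) by (auto simp: vec_eq_iff \<Phi>1_def \<Phi>2_def \<iota>_def \<pi>_def split: sum.splits)
    moreover have "g2 (\<Phi>2 x) = x" using U2(4)[of x] that by (simp add: \<Omega>_def)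
    moreover have "\<pi> x = z" using that(2) by (auto simp: vec_eq_iff \<Phi>1_def \<iota>_def \<pi>_def dest: spec[of _ "Inl _"])
    ultimately show ?thesis using that by (auto simp: \<phi>_def \<psi>_def B_def image_iff intro!: bexI[of _ x])
  qed
  have holo: "holo_map_on B \<phi>" "holo_map_on A \<psi>"
  proof -
    have g2: "holo_fun_on B (\<lambda>w. g2 (\<iota> w) $ s)" for s
      using U2(5) by (intro holo_fun_compose[where G="\<lambda>y. g2 y $ s", OF _ holo\<iota>])
        (auto simp: holo_map_on_def B_def \<Omega>_def)
    have g1: "holo_fun_on A (\<lambda>w. g1 (\<iota> w) $ s)" for s
      using U1(5) by (intro holo_fun_compose[where G="\<lambda>y. g1 y $ s", OF _ holo\<iota>])
        (auto simp: holo_map_on_def A_def \<Omega>_def)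
    show "holo_map_on B \<phi>" using g2 by (simp add: holo_map_on_def \<phi>_def nth)
    show "holo_map_on A \<psi>" using g1
      by (auto simp: holo_map_on_def \<psi>_def nth \<Phi>2_def intro!: holo_fun_sum holo_fun_mult)
  qed
  have mB: "\<phi> w \<in> A" "\<psi> (\<phi> w) = w" if "w \<in> B" for w
    using that 1[of _ w] unfolding B_def by auto
  have mA: "\<psi> z \<in> B" "\<phi> (\<psi> z) = z" if "z \<in> A" for z
    using that 2[of _ z] unfolding A_def by auto
  have hom: "homeomorphism B A \<phi> \<psi>"
    by (rule homeomorphismI) (use mA mB holo holo_map_continuous in auto)
  have eq: "(\<Sum>i\<in>UNIV. (\<phi> w $ i)\<^sup>2) +
      (\<Sum>i\<in>UNIV. \<Sum>j\<in>UNIV. (\<Sum>k\<in>UNIV. C i j k * \<phi> w $ k) * \<phi> w $ i * \<phi> w $ j) = (\<Sum>i\<in>UNIV. (w $ i)\<^sup>2)"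
    if w: "w \<in> B" for w
  proof -
    from w obtain x where x: "x \<in> \<Omega>" "\<Phi>2 x = \<iota> w" by (auto simp: B_def)
    define z where "z = \<phi> w"
    from 1[OF x] have z: "x $ Inl i = z $ i" for i by (metis nth(3) z_def)
    have w: "w $ i = (\<Sum>k\<in>UNIV. x $ Inr (i, k) * z $ k)" for i
      using arg_cong[OF x(2), of "\<lambda>v. v $ Inl i"] by (simp add: \<Phi>2_def nth z)
    have K: "K x i j = \<delta> i j" for i j
      using arg_cong[OF x(2), of "\<lambda>v. v $ Inr (i, j)"] by (simp add: \<Phi>2_def nth)
    \<comment> \<open>Adding the equations for (i, j) and (j, i) cancels the skew part R - R^T, and
      the rest is symmetric.\<close>
    have RR: "(\<Sum>k\<in>UNIV. x $ Inr (k, i) * x $ Inr (k, j)) = \<delta> i j + (\<Sum>k\<in>UNIV. C i j k * z $ k)" for i j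
    proof -
      let ?S = "\<lambda>i j. \<Sum>k\<in>UNIV. x $ Inr (k, i) * x $ Inr (k, j)"
      let ?c = "\<lambda>i j. \<Sum>k\<in>UNIV. C i j k * z $ k"
      have "?S j i = ?S i j" by (simp add: mult.commute)
      moreover have "?c j i = ?c i j" by (simp only: sym[of j i])
      moreover have "\<delta> j i = \<delta> i j" by (auto simp: \<delta>_def)
      moreover have "?S i j + x $ Inr (i, j) - x $ Inr (j, i) - ?c i j = \<delta> i j"
        "?S j i + x $ Inr (j, i) - x $ Inr (i, j) - ?c j i = \<delta> j i"
        using K[of i j] K[of j i] unfolding K_def z by blast+
      moreover have "s = d + c" if "s' = s" "c' = c" "d' = d" "s + a - b - c = d" "s' + b - a - c' = d'"
        for s s' c c' d d' a b :: complex
      proof -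
        have "(s + a - b - c) + (s + b - a - c) = d + d" using that by simp
        then have "2 * s = 2 * (d + c)" by (simp add: algebra_simps)
        then show ?thesis by (simp only: mult_cancel_left) simp
      qed
      ultimately show ?thesis by blast
    qed
    have "(\<Sum>i\<in>UNIV. (w $ i)\<^sup>2) = (\<Sum>k\<in>UNIV. \<Sum>i\<in>UNIV. \<Sum>j\<in>UNIV. x $ Inr (k, i) * x $ Inr (k, j) * (z $ i * z $ j))"
      by (simp add: w power2_eq_square sum_product mult_ac)
    also have "\<dots> = (\<Sum>i\<in>UNIV. \<Sum>j\<in>UNIV. \<Sum>k\<in>UNIV. x $ Inr (k, i) * x $ Inr (k, j) * (z $ i * z $ j))"
      by (subst sum.swap) (intro sum.cong refl sum.swap)
    also have "\<dots> = (\<Sum>i\<in>UNIV. \<Sum>j\<in>UNIV. \<delta> i j * (z $ i * z $ j) + (\<Sum>k\<in>UNIV. C i j k * z $ k) * z $ i * z $ j)"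
      by (simp only: sum_distrib_right[symmetric] RR) (simp only: ring_distribs mult.assoc)
    also have "\<dots> = (\<Sum>i\<in>UNIV. (z $ i)\<^sup>2) + (\<Sum>i\<in>UNIV. \<Sum>j\<in>UNIV. (\<Sum>k\<in>UNIV. C i j k * z $ k) * z $ i * z $ j)"
      by (simp add: sum.distrib \<delta>_def if_distrib[of "\<lambda>c. c * _"] sum.delta power2_eq_square cong: if_cong)
    finally show ?thesis by (simp add: z_def)
  qed
  have "0 \<in> B" unfolding B_def using \<Omega>(2) \<Phi>e by (auto simp: e_def[symmetric] image_iff intro!: bexI[of _ e])
  moreover have "\<phi> 0 = 0" using 1[OF \<Omega>(2), of 0] \<Phi>e by (simp add: e_def[symmetric] vec_eq_iff nth)
  ultimately show ?thesis unfolding A1_germ_def using opn hom holo eq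
    by (intro exI[of _ B] exI[of _ A] exI[of _ "\<lambda>_. 1"] exI[of _ \<phi>] exI[of _ \<psi>]) (auto simp: holo_fun_const)
qed

section \<open>Fourier coordinates on the hyperplane\<close>

definition zeta :: complex where "zeta = cis (2 * pi / 7)"

text \<open>The seventh cyclotomic equation is the relation handed to all Groebner basis
  computations with \<open>zeta\<close>.\<close>

lemma zeta_sum: "1 + zeta + zeta^2 + zeta^3 + zeta^4 + zeta^5 + zeta^6 = 0"
proof -
  have "zeta ^ 7 = cis (real 7 * (2 * pi / 7))" unfolding zeta_def by (rule Complex.DeMoivre)
  also have "real 7 * (2 * pi / 7) = 2 * pi" by simp
  finally have "zeta ^ 7 = 1" by simp
  then have "(zeta - 1) * (1 + zeta + zeta^2 + zeta^3 + zeta^4 + zeta^5 + zeta^6) = 0" by Groebner_Basis.algebra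
  moreover have "zeta \<noteq> 1"
  proof
    assume "zeta = 1"
    then have "sin (2 * pi / 7) = 0" by (simp add: zeta_def complex_eq_iff)
    moreover have "sin (2 * pi / 7) > 0" by (rule sin_gt_zero) (simp_all add: field_simps)
    ultimately show False by simp
  qed
  ultimately show ?thesis by simp
qed

text \<open>The quadratic Gauss period: 1, 2, 4 are the nonzero squares modulo 7, and
  \<open>2 * eta + 1\<close> is a square root of -7.\<close>

definition eta :: complex where "eta = zeta + zeta^2 + zeta^4"

lemma eta_eq: "eta^2 + eta + 2 = 0"
  using zeta_sum unfolding eta_def by Groebner_Basis.algebra

lemma eta_nz: "eta \<noteq> 0" "eta + 1 \<noteq> 0" "eta \<noteq> 1" "eta + 2 \<noteq> 0"
proof -
  have "eta * (eta + 1) + 2 = 0" "(eta - 1) * (eta + 2) + 4 = 0"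
    using eta_eq by (simp_all add: power2_eq_square algebra_simps)
  then show "eta \<noteq> 0" "eta + 1 \<noteq> 0" "eta \<noteq> 1" "eta + 2 \<noteq> 0" by auto
qed

text \<open>The entry in row i and column k is \<open>zeta ^ (i * k)\<close>, with exponents reduced
  modulo 7. The frequency k = 0 is absent because it measures the coordinate sum, which vanishes on
  the hyperplane.\<close>

definition fourier :: "complex^6^6" where
  "fourier = vector [vector [zeta, zeta^2, zeta^3, zeta^4, zeta^5, zeta^6],
     vector [zeta^2, zeta^4, zeta^6, zeta, zeta^3, zeta^5],
     vector [zeta^3, zeta^6, zeta^2, zeta^5, zeta, zeta^4],
     vector [zeta^4, zeta, zeta^5, zeta^2, zeta^6, zeta^3],
     vector [zeta^5, zeta^3, zeta, zeta^6, zeta^4, zeta^2],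
     vector [zeta^6, zeta^5, zeta^4, zeta^3, zeta^2, zeta]]"

lemma vec6_eq_iff: "x = y \<longleftrightarrow> x $ 1 = y $ 1 \<and> x $ 2 = y $ 2 \<and> x $ 3 = y $ 3 \<and> x $ 4 = y $ 4
    \<and> x $ 5 = y $ 5 \<and> x $ 6 = y $ 6" for x y :: "'a^6"
  by (simp add: vec_eq_iff forall_6)

lemma invertible_fourier: "invertible fourier"
  unfolding invertible_left_inverse matrix_left_invertible_ker
proof (intro allI impI)
  fix u assume "fourier *v u = 0"
  then have u: "zeta * u$1 + zeta^2 * u$2 + zeta^3 * u$3 + zeta^4 * u$4 + zeta^5 * u$5 + zeta^6 * u$6 = 0"
    "zeta^2 * u$1 + zeta^4 * u$2 + zeta^6 * u$3 + zeta * u$4 + zeta^3 * u$5 + zeta^5 * u$6 = 0"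
    "zeta^3 * u$1 + zeta^6 * u$2 + zeta^2 * u$3 + zeta^5 * u$4 + zeta * u$5 + zeta^4 * u$6 = 0"
    "zeta^4 * u$1 + zeta * u$2 + zeta^5 * u$3 + zeta^2 * u$4 + zeta^6 * u$5 + zeta^3 * u$6 = 0"
    "zeta^5 * u$1 + zeta^3 * u$2 + zeta * u$3 + zeta^6 * u$4 + zeta^4 * u$5 + zeta^2 * u$6 = 0"
    "zeta^6 * u$1 + zeta^5 * u$2 + zeta^4 * u$3 + zeta^3 * u$4 + zeta^2 * u$5 + zeta * u$6 = 0"
    by (simp_all add: vec6_eq_iff matrix_vector_mult_def sum_6 fourier_def)
  define v1 v2 v3 v4 v5 v6 where v: "v1 = u$1" "v2 = u$2" "v3 = u$3" "v4 = u$4" "v5 = u$5" "v6 = u$6"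
  define y1 where "y1 = zeta * v1 + zeta^2 * v2 + zeta^3 * v3 + zeta^4 * v4 + zeta^5 * v5 + zeta^6 * v6"
  define y2 where "y2 = zeta^2 * v1 + zeta^4 * v2 + zeta^6 * v3 + zeta * v4 + zeta^3 * v5 + zeta^5 * v6"
  define y3 where "y3 = zeta^3 * v1 + zeta^6 * v2 + zeta^2 * v3 + zeta^5 * v4 + zeta * v5 + zeta^4 * v6"
  define y4 where "y4 = zeta^4 * v1 + zeta * v2 + zeta^5 * v3 + zeta^2 * v4 + zeta^6 * v5 + zeta^3 * v6"
  define y5 where "y5 = zeta^5 * v1 + zeta^3 * v2 + zeta * v3 + zeta^6 * v4 + zeta^4 * v5 + zeta^2 * v6"
  define y6 where "y6 = zeta^6 * v1 + zeta^5 * v2 + zeta^4 * v3 + zeta^3 * v4 + zeta^2 * v5 + zeta * v6"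
  note y = y1_def y2_def y3_def y4_def y5_def y6_def
  have y0: "y1 = 0" "y2 = 0" "y3 = 0" "y4 = 0" "y5 = 0" "y6 = 0"
    using u unfolding y v by simp_all
  have "7 * v1 = 0"
  proof -
    \<comment> \<open>Fourier inversion: row i has weight \<open>zeta ^ (- i * k)\<close>, here with
      k = 1, and the subtracted 1 comes from the seventh coordinate, which is minus the sum of the
      other six. The following five identities are the cases k = 2, ..., 6.\<close>
    have "7 * v1 = (zeta^6 - 1) * y1 + (zeta^5 - 1) * y2 + (zeta^4 - 1) * y3 + (zeta^3 - 1) * y4 + (zeta^2 - 1) * y5 + (zeta^1 - 1) * y6"
      unfolding y using zeta_sum by Groebner_Basis.algebra
    then show ?thesis by (simp add: y0)
  qed
  moreover have "7 * v2 = 0"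
  proof -
    have "7 * v2 = (zeta^5 - 1) * y1 + (zeta^3 - 1) * y2 + (zeta^1 - 1) * y3 + (zeta^6 - 1) * y4 + (zeta^4 - 1) * y5 + (zeta^2 - 1) * y6"
      unfolding y using zeta_sum by Groebner_Basis.algebra
    then show ?thesis by (simp add: y0)
  qed
  moreover have "7 * v3 = 0"
  proof -
    have "7 * v3 = (zeta^4 - 1) * y1 + (zeta^1 - 1) * y2 + (zeta^5 - 1) * y3 + (zeta^2 - 1) * y4 + (zeta^6 - 1) * y5 + (zeta^3 - 1) * y6"
      unfolding y using zeta_sum by Groebner_Basis.algebra
    then show ?thesis by (simp add: y0)
  qed
  moreover have "7 * v4 = 0"
  proof -
    have "7 * v4 = (zeta^3 - 1) * y1 + (zeta^6 - 1) * y2 + (zeta^2 - 1) * y3 + (zeta^5 - 1) * y4 + (zeta^1 - 1) * y5 + (zeta^4 - 1) * y6"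
      unfolding y using zeta_sum by Groebner_Basis.algebra
    then show ?thesis by (simp add: y0)
  qed
  moreover have "7 * v5 = 0"
  proof -
    have "7 * v5 = (zeta^2 - 1) * y1 + (zeta^4 - 1) * y2 + (zeta^6 - 1) * y3 + (zeta^1 - 1) * y4 + (zeta^3 - 1) * y5 + (zeta^5 - 1) * y6"
      unfolding y using zeta_sum by Groebner_Basis.algebra
    then show ?thesis by (simp add: y0)
  qed
  moreover have "7 * v6 = 0"
  proof -
    have "7 * v6 = (zeta^1 - 1) * y1 + (zeta^2 - 1) * y2 + (zeta^3 - 1) * y3 + (zeta^4 - 1) * y4 + (zeta^5 - 1) * y5 + (zeta^6 - 1) * y6"
      unfolding y using zeta_sum by Groebner_Basis.algebra
    then show ?thesis by (simp add: y0)
  qed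
  ultimately show "u = 0" by (simp add: vec6_eq_iff v)
qed

text \<open>The coefficients \<open>s\<close> and \<open>t\<close> of the two cyclic sums serve as
  coordinates on the pencil; those of u1 u2 u4 and u3 u5 u6 are then determined. In these
  coordinates the determinantal members are \<open>s = 0\<close> and \<open>t = 0\<close>.\<close>

definition klein :: "complex \<Rightarrow> complex \<Rightarrow> complex^6 \<Rightarrow> complex" where
  "klein s t u = ((eta + 2) * s - eta * t) * (u$1 * u$2 * u$4) + ((eta + 1) * s + (1 - eta) * t) * (u$3 * u$5 * u$6)
     + s * (u$1 * (u$3)\<^sup>2 + u$2 * (u$6)\<^sup>2 + u$4 * (u$5)\<^sup>2) + t * ((u$1)\<^sup>2 * u$5 + (u$2)\<^sup>2 * u$3 + (u$4)\<^sup>2 * u$6)"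

lemma f1_fourier:
  "f1 (fourier *v u) = 7 * (6 * (u$1 * u$2 * u$4) + 6 * (u$3 * u$5 * u$6)
     + 3 * (u$1 * (u$3)\<^sup>2 + u$2 * (u$6)\<^sup>2 + u$4 * (u$5)\<^sup>2) + 3 * ((u$1)\<^sup>2 * u$5 + (u$2)\<^sup>2 * u$3 + (u$4)\<^sup>2 * u$6))"
proof -
  define v1 v2 v3 v4 v5 v6 where v: "v1 = u$1" "v2 = u$2" "v3 = u$3" "v4 = u$4" "v5 = u$5" "v6 = u$6"
  show ?thesis
    unfolding f1_def to_hyperplane_def sum_7 vector_7 fourier_def matrix_vector_mult_def vec_lambda_beta sum_6 vector_6
      v[symmetric]
    using zeta_sum by Groebner_Basis.algebra
qed

lemma f2_fourier:
  "f2 (fourier *v u) = 7 * ((2 - eta) * (u$1 * u$2 * u$4) + (3 + eta) * (u$3 * u$5 * u$6)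
     + (- 1 - eta) * (u$1 * (u$3)\<^sup>2 + u$2 * (u$6)\<^sup>2 + u$4 * (u$5)\<^sup>2)
     + eta * ((u$1)\<^sup>2 * u$5 + (u$2)\<^sup>2 * u$3 + (u$4)\<^sup>2 * u$6))"
proof -
  define v1 v2 v3 v4 v5 v6 where v: "v1 = u$1" "v2 = u$2" "v3 = u$3" "v4 = u$4" "v5 = u$5" "v6 = u$6"
  show ?thesis
    unfolding f2_def to_hyperplane_def Let_def vector_7 fourier_def matrix_vector_mult_def vec_lambda_beta sum_6 vector_6
      v[symmetric] eta_def
    using zeta_sum by Groebner_Basis.algebra
qed

lemma pencil_fourier:
  "pencil a (fourier *v u) = 7 * klein (3 * a$1 - (1 + eta) * a$2) (3 * a$1 + eta * a$2) u"
proof -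
  define v1 v2 v3 v4 v5 v6 where v: "v1 = u$1" "v2 = u$2" "v3 = u$3" "v4 = u$4" "v5 = u$5" "v6 = u$6"
  define b1 b2 where b: "b1 = a$1" "b2 = a$2"
  show ?thesis
    unfolding pencil_def f1_fourier f2_fourier klein_def v[symmetric] b[symmetric]
    using eta_eq by Groebner_Basis.algebra
qed

definition klein_grad :: "complex \<Rightarrow> complex \<Rightarrow> complex^6 \<Rightarrow> complex^6" where
  "klein_grad s t u = vector [
     ((eta + 2) * s - eta * t) * (u$2 * u$4) + s * (u$3)\<^sup>2 + 2 * t * (u$1 * u$5),
     ((eta + 2) * s - eta * t) * (u$1 * u$4) + s * (u$6)\<^sup>2 + 2 * t * (u$2 * u$3),
     ((eta + 1) * s + (1 - eta) * t) * (u$5 * u$6) + 2 * s * (u$1 * u$3) + t * (u$2)\<^sup>2,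
     ((eta + 2) * s - eta * t) * (u$1 * u$2) + s * (u$5)\<^sup>2 + 2 * t * (u$4 * u$6),
     ((eta + 1) * s + (1 - eta) * t) * (u$3 * u$6) + 2 * s * (u$4 * u$5) + t * (u$1)\<^sup>2,
     ((eta + 1) * s + (1 - eta) * t) * (u$3 * u$5) + 2 * s * (u$2 * u$6) + t * (u$4)\<^sup>2]"

lemma klein_has_derivative:
  "(klein s t has_derivative (\<lambda>h. \<Sum>i\<in>UNIV. klein_grad s t u $ i * h $ i)) (at u)"
  unfolding klein_def[abs_def] klein_grad_def sum_6 vector_6
  by (auto intro!: derivative_eq_intros has_derivative_vec_nth simp: power2_eq_square algebra_simps)

lemma holo_klein: "holo_fun_on U (klein s t)"
  unfolding holo_fun_on_def using klein_has_derivative by blast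

lemma grad_klein: "grad (klein s t) u = klein_grad s t u"
  by (rule grad_eqI) (rule klein_has_derivative)

lemma klein_euler: "3 * klein s t u = (\<Sum>i\<in>UNIV. klein_grad s t u $ i * u $ i)"
  unfolding klein_def klein_grad_def sum_6 vector_6 by (simp add: power2_eq_square algebra_simps)

text \<open>Euler's identity for a cubic form makes the equation itself redundant at a critical
  point.\<close>

lemma sing_locus_klein: "sing_locus (klein s t) = proj_pt ` {u. u \<noteq> 0 \<and> klein_grad s t u = 0}"
proof -
  have "klein s t u = 0" if "klein_grad s t u = 0" for u
    using klein_euler[of s t u] that by simp
  then show ?thesis unfolding sing_locus_def grad_klein by (metis (no_types, lifting))
qed

lemma to_hyperplane_in_forms: "(\<lambda>x. to_hyperplane x $ i) \<in> forms 1"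
  using exhaust_7[of i] unfolding to_hyperplane_def
  by (elim disjE; simp only: vector_7) (intro forms_nth forms_uminus forms_add)+

lemma f1_in_forms: "f1 \<in> forms 3"
proof -
  have "f1 \<in> forms (3 * 1)"
    unfolding f1_def[abs_def] by (intro forms_sum forms_power to_hyperplane_in_forms)
  then show ?thesis by simp
qed

lemma f2_in_forms: "f2 \<in> forms 3"
proof -
  have "f2 \<in> forms (1 + 1 + 1)"
    unfolding f2_def[abs_def] Let_def by (intro forms_add forms_mult to_hyperplane_in_forms)
  then show ?thesis by (simp add: numeral_3_eq_3)
qed

lemma pencil_in_forms: "pencil a \<in> forms 3"
  unfolding pencil_def by (intro forms_add forms_scale f1_in_forms f2_in_forms)

lemma holo_pencil: "holo_fun_on U (pencil a)"
  using holo_forms[OF pencil_in_forms] unfolding holo_fun_on_def by blast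

lemma sing_locus_pencil:
  "sing_locus (pencil a) = (\<lambda>L. (*v) fourier ` L) `
     sing_locus (klein (3 * a$1 - (1 + eta) * a$2) (3 * a$1 + eta * a$2))"
proof -
  have "sing_locus (\<lambda>u. pencil a (fourier *v u)) = sing_locus (klein (3 * a$1 - (1 + eta) * a$2) (3 * a$1 + eta * a$2))"
    unfolding pencil_fourier by (rule sing_locus_scale[OF holo_klein]) simp
  then show ?thesis using sing_locus_compose[OF invertible_fourier holo_pencil, of a] by simp
qed

section \<open>Critical points of the pencil\<close>

text \<open>Multiplying each partial derivative by its variable gives linear relations between the eight monomials;
  those with squares are determined by \<open>abc\<close> and \<open>fgh\<close>, and the relations between the exponents
  leave one parameter \<open>\<alpha>\<close> and a cube root of unity \<open>\<epsilon>\<close>.\<close>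

lemma klein_critical:
  fixes a b c f g h s t p q :: complex
  assumes "s \<noteq> 0" "t \<noteq> 0" and nz: "\<not> (a = 0 \<and> b = 0 \<and> c = 0 \<and> f = 0 \<and> g = 0 \<and> h = 0)"
    and E: "p * (b * c) + s * f^2 + 2 * t * (a * h) = 0"
      "p * (a * c) + s * g^2 + 2 * t * (b * f) = 0"
      "q * (h * g) + 2 * s * (a * f) + t * b^2 = 0"
      "p * (a * b) + s * h^2 + 2 * t * (c * g) = 0"
      "q * (f * g) + 2 * s * (c * h) + t * a^2 = 0"
      "q * (f * h) + 2 * s * (b * g) + t * c^2 = 0"
  shows "\<exists>\<alpha> \<epsilon>. \<epsilon>^3 = 1 \<and> p * \<alpha>^2 + 2 * t * \<epsilon> * \<alpha> + s = 0 \<and> q + t * \<epsilon> * \<alpha>^2 + 2 * s * \<alpha> = 0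
     \<and> f \<noteq> 0 \<and> g \<noteq> 0 \<and> h \<noteq> 0 \<and> a * f = \<alpha> * g * h \<and> b * g = \<alpha> * f * h \<and> c * h = \<alpha> * f * g
     \<and> g * h^2 = \<epsilon> * f^3 \<and> f^2 * h = \<epsilon> * g^3"
proof -
  define A where "A = a * f^2" define B where "B = b * g^2" define C where "C = c * h^2"
  define D where "D = a^2 * h" define F where "F = b^2 * f" define G where "G = c^2 * g"
  define U where "U = a * b * c" define V where "V = f * g * h"
  note defs = A_def B_def C_def D_def F_def G_def U_def V_def
  have L: "p * U + s * A + 2 * t * D = 0" "p * U + s * B + 2 * t * F = 0" "p * U + s * C + 2 * t * G = 0"
    "q * V + 2 * s * A + t * F = 0" "q * V + 2 * s * B + t * G = 0" "q * V + 2 * s * C + t * D = 0"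
    using E unfolding defs by Groebner_Basis.algebra+
  \<comment> \<open>Eliminating A, B, C leaves the operator P - 4 on the differences of D, F, G,
    where P permutes them cyclically. Its determinant on vectors of sum 0 is 16 + 4 + 1 =
    21.\<close>
  have "t * (F - D) * 21 = 0" "t * (G - D) * 21 = 0" "s * (B - A) * 21 = 0" "s * (C - A) * 21 = 0"
    using L by Groebner_Basis.algebra+
  then have eq: "F = D" "G = D" "B = A" "C = A" using assms(1,2) by auto
  have "A * B * C = U * V^2" "D * F * G = U^2 * V" unfolding defs by (simp_all add: power2_eq_square)
  then have cubes: "A^3 = U * V^2" "D^3 = U^2 * V" unfolding eq by (simp_all add: power3_eq_cube)
  have "U \<noteq> 0 \<and> V \<noteq> 0"
  proof (rule ccontr)
    assume "\<not> (U \<noteq> 0 \<and> V \<noteq> 0)"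
    then have "A = 0" "D = 0" using cubes by auto
    then have z: "A = 0" "B = 0" "C = 0" "D = 0" "F = 0" "G = 0" using eq by auto
    then have "a = 0 \<or> f = 0" "a = 0 \<or> h = 0" "b = 0 \<or> g = 0" "b = 0 \<or> f = 0" "c = 0 \<or> h = 0" "c = 0 \<or> g = 0"
      by (auto simp: defs)
    then have "a = 0" "b = 0" "c = 0" using E assms(1,2) by auto
    then have "f = 0" "g = 0" "h = 0" using E assms(1,2) by auto
    with nz \<open>a = 0\<close> \<open>b = 0\<close> \<open>c = 0\<close> show False by blast
  qed
  then have U: "U \<noteq> 0" and V: "V \<noteq> 0" by auto
  then have nz': "f \<noteq> 0" "g \<noteq> 0" "h \<noteq> 0" by (auto simp: V_def)
  define \<alpha> where "\<alpha> = A / V"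
  have A: "A = \<alpha> * V" using V by (simp add: \<alpha>_def)
  have "U * V^2 = (\<alpha>^3 * V) * V^2" unfolding cubes(1)[symmetric] A by (simp add: power2_eq_square power3_eq_cube)
  then have U': "U = \<alpha>^3 * V" using V by simp
  with U have \<alpha>: "\<alpha> \<noteq> 0" by auto
  define \<epsilon> where "\<epsilon> = D / (\<alpha>^2 * V)"
  have D: "D = \<epsilon> * \<alpha>^2 * V" using V \<alpha> by (simp add: \<epsilon>_def)
  have "\<epsilon>^3 = D^3 / (\<alpha>^6 * V^3)" by (simp add: \<epsilon>_def power_divide power_mult_distrib power_mult[symmetric])
  also have "\<dots> = 1" using V \<alpha> unfolding cubes(2) U' by (simp add: power_mult_distrib power_mult[symmetric] field_simps)
    (simp add: power2_eq_square power3_eq_cube)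
  finally have \<epsilon>: "\<epsilon>^3 = 1" .
  have af: "a * f = \<alpha> * g * h" using A nz' unfolding A_def V_def by (simp add: power2_eq_square mult_ac)
  have bg: "b * g = \<alpha> * f * h" using A eq(3) nz' unfolding B_def V_def by (simp add: power2_eq_square mult_ac)
  have ch: "c * h = \<alpha> * f * g" using A eq(4) nz' unfolding C_def V_def by (simp add: power2_eq_square mult_ac)
  have aa: "a^2 = \<epsilon> * \<alpha>^2 * f * g" using D nz' unfolding D_def V_def by (simp add: mult_ac)
  have bb: "b^2 = \<epsilon> * \<alpha>^2 * g * h" using D eq(1) nz' unfolding F_def V_def by (simp add: mult_ac)
  have "\<alpha>^2 * g * (g * h^2) = (a * f)^2" unfolding af by (simp add: power_mult_distrib power2_eq_square mult_ac)
  also have "\<dots> = \<alpha>^2 * g * (\<epsilon> * f^3)" unfolding power_mult_distrib aa by (simp add: power2_eq_square power3_eq_cube mult_ac)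
  finally have 1: "g * h^2 = \<epsilon> * f^3" using \<alpha> nz' by simp
  have "\<alpha>^2 * h * (f^2 * h) = (b * g)^2" unfolding bg by (simp add: power_mult_distrib power2_eq_square mult_ac)
  also have "\<dots> = \<alpha>^2 * h * (\<epsilon> * g^3)" unfolding power_mult_distrib bb by (simp add: power2_eq_square power3_eq_cube mult_ac)
  finally have 2: "f^2 * h = \<epsilon> * g^3" using \<alpha> nz' by simp
  have "\<alpha> * V * (p * \<alpha>^2 + 2 * t * \<epsilon> * \<alpha> + s) = 0" using L(1) unfolding A D U'
    by (simp add: power2_eq_square power3_eq_cube algebra_simps)
  moreover have "V * (q + t * \<epsilon> * \<alpha>^2 + 2 * s * \<alpha>) = 0" using L(4) unfolding A eq(1) D
    by (simp add: algebra_simps)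
  ultimately show ?thesis using V \<alpha> \<epsilon> nz' af bg ch 1 2 by auto
qed

text \<open>Both equations are linear in \<open>s\<close> and \<open>t\<close>, so a nonzero
  solution forces their 2 by 2 determinant, a quartic in \<open>\<alpha>\<close>, to vanish. For
  each kind of \<open>\<epsilon>\<close> it splits into linear factors over the field generated by
  \<open>eta\<close> and \<open>\<epsilon>\<close>. The values of \<open>\<alpha>\<close> and
  \<open>\<epsilon>\<close> are kept only for the ratios -15 and -3, where they bound the number of
  singular points; the other two ratios are reached by duality.\<close>

lemma klein_parameters:
  fixes a1 a2 \<alpha> \<epsilon> s t :: complex
  assumes st: "s = 3 * a1 - (1 + eta) * a2" "t = 3 * a1 + eta * a2" "s \<noteq> 0" "t \<noteq> 0" and \<epsilon>: "\<epsilon>^3 = 1"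
    and e1: "((eta + 2) * s - eta * t) * \<alpha>^2 + 2 * t * \<epsilon> * \<alpha> + s = 0"
    and e2: "(eta + 1) * s + (1 - eta) * t + t * \<epsilon> * \<alpha>^2 + 2 * s * \<alpha> = 0"
  shows "\<epsilon> = 1 \<and> \<alpha> = 1 \<and> a2 = - 15 * a1 \<or> 10 * a2 = - 3 * a1
     \<or> \<epsilon>^2 + \<epsilon> + 1 = 0 \<and> \<alpha> = eta + \<epsilon> + eta * \<epsilon> \<and> a2 = - 3 * a1 \<or> 2 * a2 = - 3 * a1"
proof -
  note eta = eta_eq
  have one: "((eta + 2) * s - eta * t) * \<alpha>^2 + 2 * t * \<epsilon> * \<alpha> + s
     = s * (1 + (eta + 2) * \<alpha>^2) + t * (2 * \<epsilon> * \<alpha> - eta * \<alpha>^2)"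
    "(eta + 1) * s + (1 - eta) * t + t * \<epsilon> * \<alpha>^2 + 2 * s * \<alpha>
     = s * (2 * \<alpha> + eta + 1) + t * (\<epsilon> * \<alpha>^2 + 1 - eta)" by (simp_all add: algebra_simps)
  have "s * ((1 + (eta + 2) * \<alpha>^2) * (\<epsilon> * \<alpha>^2 + 1 - eta) - (2 * \<epsilon> * \<alpha> - eta * \<alpha>^2) * (2 * \<alpha> + eta + 1)) = 0"
    using e1 e2 by Groebner_Basis.algebra
  with st(3) have det: "(1 + (eta + 2) * \<alpha>^2) * (\<epsilon> * \<alpha>^2 + 1 - eta)
      - (2 * \<epsilon> * \<alpha> - eta * \<alpha>^2) * (2 * \<alpha> + eta + 1) = 0" by simp
  have "(\<epsilon> - 1) * (\<epsilon>^2 + \<epsilon> + 1) = 0" using \<epsilon> by Groebner_Basis.algebra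
  then consider (1) "\<epsilon> = 1" | (2) "\<epsilon>^2 + \<epsilon> + 1 = 0" by auto
  then show ?thesis
  proof cases
    case 1
    \<comment> \<open>The first root forces \<open>t = 0\<close> and the second
      \<open>s = 0\<close>, both excluded. The last two yield the parameters with 7 nodes. The same
      pattern with a primitive cube root of unity yields 14 nodes.\<close>
    have "(eta * \<alpha> - 1) * (eta * \<alpha> - 2) * (\<alpha> - 1) * (2 * \<alpha> - (eta - 1)) = 0"
      using det eta unfolding 1 by Groebner_Basis.algebra
    then consider "eta * \<alpha> - 1 = 0" | "eta * \<alpha> - 2 = 0" | "\<alpha> = 1" | "2 * \<alpha> - (eta - 1) = 0" by auto
    then show ?thesis
    proof cases
      case 1
      then have "t * 3 = 0" using e2 eta unfolding \<open>\<epsilon> = 1\<close> by Groebner_Basis.algebra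
      then show ?thesis using st(3,4) by simp
    next
      case 2
      then have "s * 3 = 0" using e1 eta unfolding \<open>\<epsilon> = 1\<close> by Groebner_Basis.algebra
      then show ?thesis using st(3,4) by simp
    next
      case 3
      have "s * (eta + 3) + t * (2 - eta) = 0" using e1 1 3 by (simp add: algebra_simps)
      then have "a2 + 15 * a1 = 0" using eta unfolding st(1,2) by Groebner_Basis.algebra
      then show ?thesis using 1 3 by (simp add: eq_neg_iff_add_eq_0)
    next
      case 4
      have "10 * a2 + 3 * a1 = 0" using e1 eta 4 unfolding \<open>\<epsilon> = 1\<close> st(1,2) by Groebner_Basis.algebra
      then show ?thesis by (simp add: eq_neg_iff_add_eq_0)
    qed
  next
    case 2
    have "(eta * \<alpha> - 1) * (eta * \<alpha> - 2 * \<epsilon>) * (eta * \<alpha> - (eta - 1 - 2 * \<epsilon>)) * (eta * \<alpha> - (- eta - 2 - 2 * \<epsilon>)) = 0"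
      using det eta 2 by Groebner_Basis.algebra
    then consider "eta * \<alpha> - 1 = 0" | "eta * \<alpha> - 2 * \<epsilon> = 0" | "eta * \<alpha> - (eta - 1 - 2 * \<epsilon>) = 0"
      | "eta * \<alpha> - (- eta - 2 - 2 * \<epsilon>) = 0" by auto
    then show ?thesis
    proof cases
      case 1
      then have "t * 21 = 0" using e2 eta \<open>\<epsilon>^2 + \<epsilon> + 1 = 0\<close> by Groebner_Basis.algebra
      then show ?thesis using st(3,4) by simp
    next
      case 2
      then have "s * 21 = 0" using e1 eta \<open>\<epsilon>^2 + \<epsilon> + 1 = 0\<close> by Groebner_Basis.algebra
      then show ?thesis using st(3,4) by simp
    next
      case 3
      have "2 * a2 + 3 * a1 = 0" using e1 eta 3 \<open>\<epsilon>^2 + \<epsilon> + 1 = 0\<close> unfolding st(1,2) by Groebner_Basis.algebra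
      then show ?thesis by (simp add: eq_neg_iff_add_eq_0)
    next
      case 4
      have "a2 + 3 * a1 = 0" using e1 eta 4 \<open>\<epsilon>^2 + \<epsilon> + 1 = 0\<close> unfolding st(1,2) by Groebner_Basis.algebra
      moreover have "\<alpha> - (eta + \<epsilon> + eta * \<epsilon>) = 0" using eta 4 \<open>\<epsilon>^2 + \<epsilon> + 1 = 0\<close> by Groebner_Basis.algebra
      ultimately show ?thesis using 2 by (simp add: eq_neg_iff_add_eq_0)
    qed
  qed
qed

section \<open>The generic symmetric determinant\<close>

lemma generic_sym_det_alt:
  "generic_sym_det x = x$1 * x$4 * x$6 + 2 * x$2 * x$3 * x$5 - x$1 * (x$5)\<^sup>2 - x$4 * (x$3)\<^sup>2 - x$6 * (x$2)\<^sup>2"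
  by (simp add: generic_sym_det_def det_3 power2_eq_square algebra_simps)

text \<open>The signed cofactors of the generic symmetric matrix, in the order in which its entries
  are numbered.\<close>

definition minors :: "complex^6 \<Rightarrow> complex^6" where
  "minors x = vector [x$4 * x$6 - x$5 * x$5, x$3 * x$5 - x$2 * x$6, x$2 * x$5 - x$3 * x$4,
     x$1 * x$6 - x$3 * x$3, x$2 * x$3 - x$1 * x$5, x$1 * x$4 - x$2 * x$2]"

lemma minors_simps:
  "minors x $ 1 = x$4 * x$6 - x$5 * x$5" "minors x $ 2 = x$3 * x$5 - x$2 * x$6"
  "minors x $ 3 = x$2 * x$5 - x$3 * x$4" "minors x $ 4 = x$1 * x$6 - x$3 * x$3"
  "minors x $ 5 = x$2 * x$3 - x$1 * x$5" "minors x $ 6 = x$1 * x$4 - x$2 * x$2"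
  by (simp_all add: minors_def)

text \<open>The off-diagonal variables x2, x3, x5 occur twice in the matrix, hence the factor 2
  before their cofactors.\<close>

lemma gsd_has_derivative:
  "(generic_sym_det has_derivative (\<lambda>h. \<Sum>i\<in>UNIV. (vector [minors x $ 1, 2 * minors x $ 2, 2 * minors x $ 3,
     minors x $ 4, 2 * minors x $ 5, minors x $ 6] :: complex^6) $ i * h $ i)) (at x)"
  unfolding generic_sym_det_alt[abs_def] minors_simps sum_6 vector_6
  by (auto intro!: derivative_eq_intros has_derivative_vec_nth simp: power2_eq_square algebra_simps)

lemma holo_gsd: "holo_fun_on U generic_sym_det"
  unfolding holo_fun_on_def using gsd_has_derivative by blast

text \<open>A symmetric matrix of rank at most one is y y^T. A square root of a nonzero diagonal
  entry provides one coordinate of y and division the others; if the diagonal vanishes, the minors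
  force the off-diagonal entries to vanish too.\<close>

lemma minors_zero_iff_veronese: "minors x = 0 \<longleftrightarrow> (\<exists>y. x = veronese y)"
proof
  assume m: "minors x = 0"
  then have *: "x$4 * x$6 = x$5 * x$5" "x$3 * x$5 = x$2 * x$6" "x$2 * x$5 = x$3 * x$4"
    "x$1 * x$6 = x$3 * x$3" "x$2 * x$3 = x$1 * x$5" "x$1 * x$4 = x$2 * x$2"
    by (simp_all add: vec6_eq_iff minors_simps)
  have ver: "veronese y $ 1 = (y$1)\<^sup>2" "veronese y $ 2 = y$1 * y$2" "veronese y $ 3 = y$1 * y$3"
    "veronese y $ 4 = (y$2)\<^sup>2" "veronese y $ 5 = y$2 * y$3" "veronese y $ 6 = (y$3)\<^sup>2" for y
    by (simp_all add: veronese_def)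
  consider "x$1 \<noteq> 0" | "x$4 \<noteq> 0" | "x$6 \<noteq> 0" | "x$1 = 0" "x$4 = 0" "x$6 = 0" by blast
  then show "\<exists>y. x = veronese y"
  proof cases
    case 1
    define r where "r = csqrt (x$1)"
    have r: "r \<noteq> 0" "x$1 = r * r" using 1 by (auto simp: r_def power2_csqrt power2_eq_square[symmetric])
    have "x = veronese (vector [r, x$2 / r, x$3 / r])"
      using * r by (simp add: vec6_eq_iff ver power2_eq_square field_simps)
    then show ?thesis by blast
  next
    case 2
    define r where "r = csqrt (x$4)"
    have r: "r \<noteq> 0" "x$4 = r * r" using 2 by (auto simp: r_def power2_csqrt power2_eq_square[symmetric])
    have "x = veronese (vector [x$2 / r, r, x$5 / r])"
      using * r by (simp add: vec6_eq_iff ver power2_eq_square field_simps)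
    then show ?thesis by blast
  next
    case 3
    define r where "r = csqrt (x$6)"
    have r: "r \<noteq> 0" "x$6 = r * r" using 3 by (auto simp: r_def power2_csqrt power2_eq_square[symmetric])
    have "x = veronese (vector [x$3 / r, x$5 / r, r])"
      using * r by (simp add: vec6_eq_iff ver power2_eq_square field_simps)
    then show ?thesis by blast
  next
    case 4
    then have "x = veronese 0" using * by (simp add: vec6_eq_iff ver)
    then show ?thesis by blast
  qed
next
  assume "\<exists>y. x = veronese y"
  then show "minors x = 0" by (auto simp: vec6_eq_iff minors_simps veronese_def power2_eq_square)
qed

lemma veronese_zero_iff: "veronese y = 0 \<longleftrightarrow> y = 0"
  by (auto simp: veronese_def vec6_eq_iff vec_eq_iff forall_3)

lemma sing_locus_gsd_minors: "sing_locus generic_sym_det = proj_pt ` {x. x \<noteq> 0 \<and> minors x = 0}"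
proof -
  have "grad generic_sym_det x = 0 \<longleftrightarrow> minors x = 0" for x
    unfolding grad_eqI[OF gsd_has_derivative] by (simp add: vec6_eq_iff)
  moreover have "generic_sym_det x = 0" if "minors x = 0" for x
    using that minors_zero_iff_veronese[of x]
    by (auto simp: generic_sym_det_alt veronese_def power2_eq_square)
  ultimately show ?thesis unfolding sing_locus_def by metis
qed

lemma sing_locus_gsd: "sing_locus generic_sym_det = (\<lambda>y. proj_pt (veronese y)) ` {y. y \<noteq> 0}"
proof -
  have "{x. x \<noteq> 0 \<and> minors x = 0} = veronese ` {y. y \<noteq> 0}"
    unfolding minors_zero_iff_veronese using veronese_zero_iff by auto
  then show ?thesis unfolding sing_locus_gsd_minors by (simp add: image_image)
qed

section \<open>Smoothness of the Veronese surface\<close>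

lemma rank_eq_if_independent_rows:
  fixes A :: "complex^'n^'m"
  assumes "\<And>c. (\<Sum>i\<in>UNIV. c i *s row i A) = 0 \<Longrightarrow> (\<forall>i. c i = 0)"
  shows "rank A = CARD('m)"
proof -
  obtain B :: "complex^'m^'n" where "A ** B = mat 1"
    using assms matrix_right_invertible_independent_rows[of A] by blast
  then have "transpose B ** transpose A = mat 1"
    by (metis matrix_transpose_mul transpose_mat)
  then have inj: "inj ((*v) (transpose A))" unfolding matrix_left_invertible_injective[symmetric] by blast
  have "row i A = transpose A *v axis i 1" for i
    by (simp add: matrix_vector_mult_def transpose_def row_def axis_def vec_eq_iff
        if_distrib[of "\<lambda>c. _ * c"] sum.delta cong: if_cong)
  then have "rows A = (*v) (transpose A) ` range (\<lambda>i. axis i 1)"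
    by (auto simp: rows_def)
  also have "vec.dim \<dots> = vec.dim (range (\<lambda>i. axis i 1) :: (complex^'m) set)"
    by (rule vec.dim_image_eq) (use inj in \<open>auto intro: inj_on_subset\<close>)
  also have "\<dots> = CARD('m)"
  proof -
    have "vec.dim (cart_basis :: (complex^'m) set) = card (cart_basis :: (complex^'m) set)"
      by (rule vec.dim_eq_card_independent[OF independent_cart_basis])
    moreover have "range (\<lambda>i. axis i 1) = (cart_basis :: (complex^'m) set)" by (auto simp: cart_basis_def)
    ultimately show ?thesis by (simp add: card_cart_basis)
  qed
  finally show ?thesis by (simp add: row_rank_def_gen)
qed

text \<open>Next to a nonzero pivot \<open>x\<close>, the three minors through it express the
  remaining block by the row of the pivot, so the other minors vanish.\<close>

lemma rank_one_minors:
  fixes x b c d e f :: complex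
  assumes "x \<noteq> 0" "x * d = b * b" "x * e = b * c" "x * f = c * c"
  shows "d * f = e * e" "c * e = b * f" "b * e = c * d"
proof -
  have "d = b * b / x" "e = b * c / x" "f = c * c / x" using assms by (simp_all add: field_simps)
  then show "d * f = e * e" "c * e = b * f" "b * e = c * d" by (simp_all add: field_simps)
qed

lemma grad_quadric:
  "grad (\<lambda>x. x $ i * x $ j - x $ k * x $ l) v = axis i (v $ j) + axis j (v $ i) - axis k (v $ l) - axis l (v $ k)"
  for i j k l :: "'n::finite"
proof (rule grad_eqI)
  have "(\<lambda>h::complex^'n. \<Sum>m\<in>UNIV. (axis i (v $ j) + axis j (v $ i) - axis k (v $ l) - axis l (v $ k)) $ m * h $ m)
    = (\<lambda>h. v $ i * h $ j + h $ i * v $ j - (v $ k * h $ l + h $ k * v $ l))"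
    by (rule ext) (simp add: axis_def ring_distribs sum.distrib sum_subtractf if_distrib[of "\<lambda>c. c * _"] sum.delta cong: if_cong)
  then show "((\<lambda>x. x $ i * x $ j - x $ k * x $ l) has_derivative (\<lambda>h. \<Sum>m\<in>UNIV. (axis i (v $ j) + axis j (v $ i)
     - axis k (v $ l) - axis l (v $ k)) $ m * h $ m)) (at v)"
    by (auto intro!: derivative_eq_intros has_derivative_vec_nth)
qed

lemma quadric_in_forms: "(\<lambda>x. x $ i * x $ j - x $ k * x $ l) \<in> forms 2" for i j k l :: "'n::finite"
  using forms_diff[OF forms_mult[OF forms_nth[of i] forms_nth[of j]] forms_mult[OF forms_nth[of k] forms_nth[of l]]]
  by (simp add: numeral_2_eq_2)

lemma minors_in_forms: "(\<lambda>x. minors x $ i) \<in> forms 2"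
  using exhaust_6[of i] by (elim disjE; simp only: minors_simps quadric_in_forms)

lemma proj_pt_mem_minors:
  assumes "w \<noteq> 0"
  shows "proj_pt w \<in> proj_pt ` {x. x \<noteq> 0 \<and> minors x = 0} \<longleftrightarrow> minors w = 0"
proof
  assume "proj_pt w \<in> proj_pt ` {x. x \<noteq> 0 \<and> minors x = 0}"
  then obtain x where x: "x \<noteq> 0" "minors x = 0" "proj_pt w = proj_pt x" by auto
  then obtain c where "w = c *s x" using proj_pt_eq_iff[OF x(1)] by auto
  moreover have "minors (c *s x) = c^2 *s minors x"
    by (simp add: vec6_eq_iff minors_simps power2_eq_square algebra_simps)
  ultimately show "minors w = 0" using x(2) by simp
qed (use assms in auto)

text \<open>A nonzero symmetric matrix of rank one has a nonzero diagonal entry. Taking it as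
  \<open>h\<close>, the three minors through it cut out the surface where \<open>h\<close> is
  nonzero. Their gradients are independent because each of the three entries outside the row and
  column of the pivot occurs in just one of these minors, multiplied by the pivot up to
  sign.\<close>

lemma smooth_surface_gsd: "smooth_surface (sing_locus generic_sym_det)"
  unfolding smooth_surface_def
proof (intro conjI allI impI)
  show "sing_locus generic_sym_det \<noteq> {}"
    unfolding sing_locus_gsd by (auto intro!: exI[of _ "axis 1 1"] simp: axis_eq_0_iff)
  show "\<exists>G\<subseteq>\<Union>d. forms d. sing_locus generic_sym_det = proj_pt ` {v. v \<noteq> 0 \<and> (\<forall>g\<in>G. g v = 0)}"
  proof (intro exI conjI)
    show "range (\<lambda>i x. minors x $ i) \<subseteq> (\<Union>d. forms d)" using minors_in_forms by blast
    have "(\<forall>g\<in>range (\<lambda>i x. minors x $ i). g v = 0) \<longleftrightarrow> minors v = 0" for v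
      by (simp add: vec_eq_iff)
    then show "sing_locus generic_sym_det = proj_pt ` {v. v \<noteq> 0 \<and> (\<forall>g\<in>range (\<lambda>i x. minors x $ i). g v = 0)}"
      unfolding sing_locus_gsd_minors by simp
  qed
  fix v :: "complex^6"
  assume "v \<noteq> 0 \<and> proj_pt v \<in> sing_locus generic_sym_det"
  then have v: "v \<noteq> 0" "minors v = 0" using proj_pt_mem_minors unfolding sing_locus_gsd_minors by auto
  have "\<exists>j i1 i2 i3. v $ j \<noteq> 0 \<and> (\<forall>w. w $ j \<noteq> 0 \<longrightarrow> (minors w = 0 \<longleftrightarrow>
      minors w $ i1 = 0 \<and> minors w $ i2 = 0 \<and> minors w $ i3 = 0))
     \<and> (\<forall>c1 c2 c3. c1 *s grad (\<lambda>x. minors x $ i1) v + c2 *s grad (\<lambda>x. minors x $ i2) v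
          + c3 *s grad (\<lambda>x. minors x $ i3) v = 0 \<longrightarrow> c1 = 0 \<and> c2 = 0 \<and> c3 = 0)"
  proof -
    have "v$1 \<noteq> 0 \<or> v$4 \<noteq> 0 \<or> v$6 \<noteq> 0"
      using v by (auto simp: vec6_eq_iff minors_simps)
    then consider "v$1 \<noteq> 0" | "v$4 \<noteq> 0" | "v$6 \<noteq> 0" by blast
    then show ?thesis
    proof cases
      case 1
      have cut: "minors w = 0" if "w$1 \<noteq> 0" "minors w $ 6 = 0" "minors w $ 5 = 0" "minors w $ 4 = 0" for w
        using rank_one_minors[of "w$1" "w$4" "w$2" "w$5" "w$3" "w$6"] that by (simp add: vec6_eq_iff minors_simps mult.commute)
      have "minors w = 0 \<longleftrightarrow> minors w $ 6 = 0 \<and> minors w $ 5 = 0 \<and> minors w $ 4 = 0" if "w$1 \<noteq> 0" for w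
      proof
        assume "minors w = 0"
        then show "minors w $ 6 = 0 \<and> minors w $ 5 = 0 \<and> minors w $ 4 = 0" by simp
      qed (elim conjE, rule cut[OF that])
      moreover have "c1 = 0 \<and> c2 = 0 \<and> c3 = 0"
        if "c1 *s grad (\<lambda>x. minors x $ 6) v + c2 *s grad (\<lambda>x. minors x $ 5) v
          + c3 *s grad (\<lambda>x. minors x $ 4) v = 0" for c1 c2 c3
        using arg_cong[OF that, of "\<lambda>v. v $ 4"] arg_cong[OF that, of "\<lambda>v. v $ 5"]
          arg_cong[OF that, of "\<lambda>v. v $ 6"] 1
        by (simp add: minors_simps grad_quadric axis_def)
      ultimately show ?thesis using 1 by blast
    next
      case 2
      have cut: "minors w = 0" if "w$4 \<noteq> 0" "minors w $ 6 = 0" "minors w $ 1 = 0" "minors w $ 3 = 0" for w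
        using rank_one_minors[of "w$4" "w$1" "w$2" "w$3" "w$5" "w$6"] that by (simp add: vec6_eq_iff minors_simps mult.commute)
      have "minors w = 0 \<longleftrightarrow> minors w $ 6 = 0 \<and> minors w $ 1 = 0 \<and> minors w $ 3 = 0" if "w$4 \<noteq> 0" for w
      proof
        assume "minors w = 0"
        then show "minors w $ 6 = 0 \<and> minors w $ 1 = 0 \<and> minors w $ 3 = 0" by simp
      qed (elim conjE, rule cut[OF that])
      moreover have "c1 = 0 \<and> c2 = 0 \<and> c3 = 0"
        if "c1 *s grad (\<lambda>x. minors x $ 6) v + c2 *s grad (\<lambda>x. minors x $ 1) v
          + c3 *s grad (\<lambda>x. minors x $ 3) v = 0" for c1 c2 c3
        using arg_cong[OF that, of "\<lambda>v. v $ 1"] arg_cong[OF that, of "\<lambda>v. v $ 6"]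
          arg_cong[OF that, of "\<lambda>v. v $ 3"] 2
        by (simp add: minors_simps grad_quadric axis_def)
      ultimately show ?thesis using 2 by blast
    next
      case 3
      have cut: "minors w = 0" if "w$6 \<noteq> 0" "minors w $ 1 = 0" "minors w $ 4 = 0" "minors w $ 2 = 0" for w
        using rank_one_minors[of "w$6" "w$1" "w$3" "w$2" "w$5" "w$4"] that by (simp add: vec6_eq_iff minors_simps mult.commute)
      have "minors w = 0 \<longleftrightarrow> minors w $ 1 = 0 \<and> minors w $ 4 = 0 \<and> minors w $ 2 = 0" if "w$6 \<noteq> 0" for w
      proof
        assume "minors w = 0"
        then show "minors w $ 1 = 0 \<and> minors w $ 4 = 0 \<and> minors w $ 2 = 0" by simp
      qed (elim conjE, rule cut[OF that])
      moreover have "c1 = 0 \<and> c2 = 0 \<and> c3 = 0"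
        if "c1 *s grad (\<lambda>x. minors x $ 1) v + c2 *s grad (\<lambda>x. minors x $ 4) v
          + c3 *s grad (\<lambda>x. minors x $ 2) v = 0" for c1 c2 c3
        using arg_cong[OF that, of "\<lambda>v. v $ 4"] arg_cong[OF that, of "\<lambda>v. v $ 1"]
          arg_cong[OF that, of "\<lambda>v. v $ 2"] 3
        by (simp add: minors_simps grad_quadric axis_def)
      ultimately show ?thesis using 3 by blast
    qed
  qed
  then obtain j i1 i2 i3 where H: "v $ j \<noteq> 0 \<and> (\<forall>w. w $ j \<noteq> 0 \<longrightarrow> (minors w = 0 \<longleftrightarrow>
      minors w $ i1 = 0 \<and> minors w $ i2 = 0 \<and> minors w $ i3 = 0))
     \<and> (\<forall>c1 c2 c3. c1 *s grad (\<lambda>x. minors x $ i1) v + c2 *s grad (\<lambda>x. minors x $ i2) v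
          + c3 *s grad (\<lambda>x. minors x $ i3) v = 0 \<longrightarrow> c1 = 0 \<and> c2 = 0 \<and> c3 = 0)"
    by (elim exE) (rule that)
  note j = conjunct1[OF H] and cut = conjunct1[OF conjunct2[OF H], rule_format]
    and ind = conjunct2[OF conjunct2[OF H], rule_format]
  define I :: "3 \<Rightarrow> 6" where "I r = (if r = 1 then i1 else if r = 2 then i2 else i3)" for r
  define A where "A = (\<chi> r. grad (\<lambda>x. minors x $ I r) v)"
  have "rank A = CARD(3)"
  proof (rule rank_eq_if_independent_rows)
    fix c :: "3 \<Rightarrow> complex" assume "(\<Sum>i\<in>UNIV. c i *s row i A) = 0"
    then have "c 1 *s grad (\<lambda>x. minors x $ i1) v + c 2 *s grad (\<lambda>x. minors x $ i2) v
          + c 3 *s grad (\<lambda>x. minors x $ i3) v = 0"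
      by (simp add: sum_3 row_def A_def I_def vec_nth_inverse)
    from ind[OF this] show "\<forall>i. c i = 0" by (simp add: forall_3)
  qed
  then show "\<exists>h e g d. h \<in> forms e \<and> h v \<noteq> 0 \<and> (\<forall>i. g i \<in> forms (d i)) \<and> rank (\<chi> i::3. grad (g i) v) = 3 \<and>
     (\<forall>w. w \<noteq> 0 \<and> h w \<noteq> 0 \<longrightarrow> (proj_pt w \<in> sing_locus generic_sym_det) = (\<forall>i. g i w = 0))"
    using j cut minors_in_forms forms_nth[of j] proj_pt_mem_minors unfolding sing_locus_gsd_minors
    by (intro exI[of _ "\<lambda>x. x $ j"] exI[of _ 1] exI[of _ "\<lambda>r x. minors x $ I r"] exI[of _ "\<lambda>_. 2"])
       (auto simp: A_def forall_3 I_def)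
qed

text \<open>Equations are pulled back along the inverse \<open>B\<close>. All gradients are then
  multiplied by \<open>transpose B\<close>, an injective map, which preserves the rank.\<close>

lemma smooth_surface_image:
  assumes S: "smooth_surface S" and A: "invertible A"
  shows "smooth_surface ((\<lambda>L. (*v) A ` L) ` S)"
proof -
  obtain B where B: "invertible B" "\<And>x. A *v (B *v x) = x" "\<And>x. B *v (A *v x) = x"
    by (rule invertible_obtain_inverse[OF A]) metis
  have nz: "B *v w \<noteq> 0 \<longleftrightarrow> w \<noteq> 0" for w using invertible_kernel[OF B(1)] by simp
  have mem: "proj_pt w \<in> (\<lambda>L. (*v) A ` L) ` S \<longleftrightarrow> proj_pt (B *v w) \<in> S" for w
  proof
    assume "proj_pt w \<in> (\<lambda>L. (*v) A ` L) ` S"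
    then obtain L where L: "L \<in> S" "proj_pt w = (*v) A ` L" by auto
    then have "proj_pt (B *v w) = (*v) B ` (*v) A ` L" by (metis image_proj_pt)
    then show "proj_pt (B *v w) \<in> S" using L(1) B(3) by (simp add: image_image)
  next
    assume "proj_pt (B *v w) \<in> S"
    moreover have "proj_pt w = (*v) A ` proj_pt (B *v w)" by (simp add: image_proj_pt B)
    ultimately show "proj_pt w \<in> (\<lambda>L. (*v) A ` L) ` S" by blast
  qed
  obtain G where G: "G \<subseteq> (\<Union>d. forms d)" "S = proj_pt ` {v. v \<noteq> 0 \<and> (\<forall>g\<in>G. g v = 0)}"
    using conjunct1[OF conjunct2[OF S[unfolded smooth_surface_def]]] by blast
  have loc: "\<exists>h e. \<exists>g::3 \<Rightarrow> complex^6 \<Rightarrow> complex. \<exists>d.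
           h \<in> forms e \<and> h v \<noteq> 0 \<and> (\<forall>i. g i \<in> forms (d i)) \<and>
           rank (\<chi> i. grad (g i) v) = 3 \<and>
           (\<forall>w. w \<noteq> 0 \<and> h w \<noteq> 0 \<longrightarrow> (proj_pt w \<in> S \<longleftrightarrow> (\<forall>i. g i w = 0)))"
    if "v \<noteq> 0" "proj_pt v \<in> S" for v
    using conjunct2[OF conjunct2[OF S[unfolded smooth_surface_def]], rule_format, OF conjI, OF that] .
  show ?thesis unfolding smooth_surface_def
  proof (intro conjI allI impI)
    show "(\<lambda>L. (*v) A ` L) ` S \<noteq> {}" using S by (auto simp: smooth_surface_def)
    show "\<exists>G\<subseteq>\<Union>d. forms d. (\<lambda>L. (*v) A ` L) ` S = proj_pt ` {v. v \<noteq> 0 \<and> (\<forall>g\<in>G. g v = 0)}"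
    proof (intro exI[of _ "(\<lambda>g x. g (B *v x)) ` G"] conjI)
      show "(\<lambda>g x. g (B *v x)) ` G \<subseteq> (\<Union>d. forms d)" using G(1) forms_compose_matrix by blast
      have "{v. v \<noteq> 0 \<and> (\<forall>g\<in>(\<lambda>g x. g (B *v x)) ` G. g v = 0)} = (*v) A ` {v. v \<noteq> 0 \<and> (\<forall>g\<in>G. g v = 0)}"
        using B(2,3) nz by (auto simp: image_iff) (metis B(2))+
      then show "(\<lambda>L. (*v) A ` L) ` S = proj_pt ` {v. v \<noteq> 0 \<and> (\<forall>g\<in>(\<lambda>g x. g (B *v x)) ` G. g v = 0)}"
        unfolding G(2) by (simp add: image_image image_proj_pt)
    qed
    fix v assume "v \<noteq> 0 \<and> proj_pt v \<in> (\<lambda>L. (*v) A ` L) ` S"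
    then have "B *v v \<noteq> 0" "proj_pt (B *v v) \<in> S" using nz mem by auto
    from loc[OF this] obtain h e and g::"3 \<Rightarrow> complex^6 \<Rightarrow> complex" and d where
      h: "h \<in> forms e" "h (B *v v) \<noteq> 0" "\<forall>i. g i \<in> forms (d i)" "rank (\<chi> i. grad (g i) (B *v v)) = 3"
      "\<forall>w. w \<noteq> 0 \<and> h w \<noteq> 0 \<longrightarrow> (proj_pt w \<in> S \<longleftrightarrow> (\<forall>i. g i w = 0))" by blast
    have "rank (\<chi> i. grad (\<lambda>x. g i (B *v x)) v) = 3"
    proof -
      have "grad (\<lambda>x. g i (B *v x)) v = transpose B *v grad (g i) (B *v v)" for i
        using h(3) by (intro grad_compose_matrix holo_forms) auto
      then have "rows (\<chi> i. grad (\<lambda>x. g i (B *v x)) v) = (*v) (transpose B) ` rows (\<chi> i. grad (g i) (B *v v))"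
        by (auto simp: rows_def row_def vec_nth_inverse)
      moreover have "inj ((*v) (transpose B))"
        unfolding matrix_left_invertible_injective[symmetric] using invertible_transpose[OF B(1)]
        by (auto simp: invertible_def)
      ultimately have "vec.dim (rows (\<chi> i. grad (\<lambda>x. g i (B *v x)) v)) = vec.dim (rows (\<chi> i. grad (g i) (B *v v)))"
        by (simp only: vec.dim_image_eq[OF matrix_vector_mul_linear_gen inj_on_subset[OF _ subset_UNIV]])
      then show ?thesis using h(4) by (simp add: row_rank_def_gen)
    qed
    then show "\<exists>h e g d. h \<in> forms e \<and> h v \<noteq> 0 \<and> (\<forall>i. g i \<in> forms (d i)) \<and> rank (\<chi> i::3. grad (g i) v) = 3 \<and>
        (\<forall>w. w \<noteq> 0 \<and> h w \<noteq> 0 \<longrightarrow> (proj_pt w \<in> (\<lambda>L. (*v) A ` L) ` S) = (\<forall>i. g i w = 0))"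
      using h forms_compose_matrix[of _ _ B] nz
      by (intro exI[of _ "\<lambda>x. h (B *v x)"] exI[of _ e] exI[of _ "\<lambda>i x. g i (B *v x)"] exI[of _ d])
         (auto simp: mem)
  qed
qed

section \<open>The two determinantal members of the pencil\<close>

lemma determinantal_properties:
  fixes A L :: "complex^6^6"
  assumes "holo_fun_on UNIV F" "invertible A" "invertible L" "c \<noteq> 0"
    and F: "\<And>u. F (A *v u) = c * generic_sym_det (L *v u)"
  shows "determinantal F" "veronese_surface (sing_locus F)" "smooth_surface (sing_locus F)"
proof -
  obtain B where B: "invertible B" "\<And>x. L *v (B *v x) = x"
    by (rule invertible_obtain_inverse[OF assms(3)]) metis
  have AB: "invertible (A ** B)" using assms(2) B(1) by (rule invertible_mult)
  have *: "F ((A ** B) *v x) = c * generic_sym_det x" for x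
    by (simp add: matrix_vector_mul_assoc[symmetric] F B(2))
  have "proj_zeros F = (\<lambda>L. (*v) (A ** B) ` L) ` proj_zeros generic_sym_det"
    using proj_zeros_compose[OF AB, of F] by (simp add: * proj_zeros_scale[OF assms(4)])
  then show "determinantal F" unfolding determinantal_def proj_equivalent_def using AB by blast
  have sing: "sing_locus F = (\<lambda>L. (*v) (A ** B) ` L) ` sing_locus generic_sym_det"
    using sing_locus_compose[OF AB assms(1)] by (simp add: * sing_locus_scale[OF holo_gsd assms(4)])
  then show "veronese_surface (sing_locus F)" "smooth_surface (sing_locus F)"
    unfolding veronese_surface_def proj_equivalent_def sing_locus_gsd[symmetric]
    using AB smooth_surface_image[OF smooth_surface_gsd AB] by auto
qed

lemma pencil_determinantal:
  assumes "a \<noteq> 0" and "3 * a$1 - (1 + eta) * a$2 = 0 \<or> 3 * a$1 + eta * a$2 = 0"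
  shows "determinantal (pencil a)" "veronese_surface (sing_locus (pencil a))" "smooth_surface (sing_locus (pencil a))"
proof -
  define s where "s = 3 * a$1 - (1 + eta) * a$2"
  define t where "t = 3 * a$1 + eta * a$2"
  have "s \<noteq> 0 \<or> t \<noteq> 0"
  proof (rule ccontr)
    assume "\<not> (s \<noteq> 0 \<or> t \<noteq> 0)"
    then have st: "3 * a$1 - (1 + eta) * a$2 = 0" "3 * a$1 + eta * a$2 = 0" by (auto simp: s_def t_def)
    then have "(2 * eta + 1) * a$2 = 0" by (simp add: algebra_simps)
    moreover have "(2 * eta + 1) * (2 * eta + 1) = -7" using eta_eq by Groebner_Basis.algebra
    ultimately have "a$2 = 0" by auto
    with st have "a$1 = 0" by simp
    with \<open>a$2 = 0\<close> assms(1) show False by (simp add: vec_eq_iff forall_2)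
  qed
  \<comment> \<open>The diagonal of the symmetric matrix is made of multiples of u1, u2, u4 and the
    off-diagonal of multiples of u5, u6, u3, so that the determinant has exactly the monomials of
    \<open>klein s 0\<close>. The factors at u1 and u3 are read off the coefficients of u1 u2 u4 and
    u3 u5 u6; the coefficient of u1 u3^2 then agrees since (eta + 2)(eta + 1)^2 = -4. For
    \<open>L2\<close> the triples exchange their roles.\<close>
  define L1 :: "complex^6^6" where "L1 = vector [vector [- (eta + 2), 0, 0, 0, 0, 0], vector [0, 0, 0, 0, 1, 0],
    vector [0, 0, 0, 0, 0, 1], vector [0, 1, 0, 0, 0, 0], vector [0, 0, - (eta + 1) / 2, 0, 0, 0], vector [0, 0, 0, 1, 0, 0]]"
  define L2 :: "complex^6^6" where "L2 = vector [vector [0, 0, 0, 0, eta - 1, 0], vector [0, 0, 0, 1, 0, 0],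
    vector [0, 1, 0, 0, 0, 0], vector [0, 0, 1, 0, 0, 0], vector [eta / 2, 0, 0, 0, 0, 0], vector [0, 0, 0, 0, 0, 1]]"
  have "- eta \<noteq> 2" "- eta \<noteq> 1" using eta_nz by (metis add.right_inverse)+
  then have inv: "invertible L1" "invertible L2"
    unfolding invertible_left_inverse matrix_left_invertible_ker
    using eta_nz by (auto simp: vec6_eq_iff matrix_vector_mult_def sum_6 L1_def L2_def)
  have k1: "klein s 0 u = - s * generic_sym_det (L1 *v u)" for u
  proof -
    define v1 v2 v3 v4 v5 v6 where v: "v1 = u$1" "v2 = u$2" "v3 = u$3" "v4 = u$4" "v5 = u$5" "v6 = u$6"
    show ?thesis unfolding generic_sym_det_alt klein_def L1_def
      using eta_eq by (simp add: matrix_vector_mult_def sum_6 v[symmetric]) Groebner_Basis.algebra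
  qed
  have k2: "klein 0 t u = - t * generic_sym_det (L2 *v u)" for u
  proof -
    define v1 v2 v3 v4 v5 v6 where v: "v1 = u$1" "v2 = u$2" "v3 = u$3" "v4 = u$4" "v5 = u$5" "v6 = u$6"
    \<comment> \<open>Replacing \<open>eta\<close> by twice a new unknown removes the fraction
      before the polynomial identity is checked.\<close>
    define k where "k = eta / 2"
    have k: "eta = 2 * k" by (simp add: k_def)
    show ?thesis unfolding generic_sym_det_alt klein_def L2_def
      using eta_eq unfolding k by (simp add: matrix_vector_mult_def sum_6 v[symmetric]) Groebner_Basis.algebra
  qed
  have "\<exists>L c. invertible L \<and> c \<noteq> 0 \<and> (\<forall>u. pencil a (fourier *v u) = c * generic_sym_det (L *v u))"
  proof (cases "s = 0")
    case True
    then have "t \<noteq> 0" using \<open>s \<noteq> 0 \<or> t \<noteq> 0\<close> by simp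
    then show ?thesis using inv(2) True
      by (intro exI[of _ L2] exI[of _ "- 7 * t"]) (simp add: pencil_fourier s_def[symmetric] t_def[symmetric] k2)
  next
    case False
    then have "t = 0" using assms(2) by (auto simp: s_def t_def)
    then show ?thesis using inv(1) False
      by (intro exI[of _ L1] exI[of _ "- 7 * s"]) (simp add: pencil_fourier s_def[symmetric] t_def[symmetric] k1)
  qed
  then obtain L c where L: "invertible L" "c \<noteq> 0" "\<And>u. pencil a (fourier *v u) = c * generic_sym_det (L *v u)" by blast
  note p = determinantal_properties[OF holo_pencil invertible_fourier L(1,2), of a, OF L(3)]
  show "determinantal (pencil a)" "veronese_surface (sing_locus (pencil a))" "smooth_surface (sing_locus (pencil a))"
    by (fact p)+
qed

section \<open>The permutation representation\<close>

definition swap12_36 :: "7 \<Rightarrow> 7" where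
  "swap12_36 = Transposition.transpose 1 2 \<circ> Transposition.transpose 3 6"

lemma swap12_36_simps [simp]:
  "swap12_36 1 = 2" "swap12_36 2 = 1" "swap12_36 3 = 6" "swap12_36 4 = 4" "swap12_36 5 = 5"
  "swap12_36 6 = 3" "swap12_36 7 = 7"
  by (simp_all add: swap12_36_def transpose_def)

lemma swap12_36_invol: "swap12_36 (swap12_36 i) = i"
  using exhaust_7[of i] by auto

lemma inv_swap12_36 [simp]: "inv_into UNIV swap12_36 = swap12_36"
  by (rule inv_unique_comp) (simp_all add: fun_eq_iff swap12_36_invol)

abbreviation shift7 :: "7 \<Rightarrow> 7" where "shift7 \<equiv> \<lambda>i. i + 1"
abbreviation unshift7 :: "7 \<Rightarrow> 7" where "unshift7 \<equiv> \<lambda>i. i - 1"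

lemma numeral_7_wrap: "(0 :: 7) = 7" "(8 :: 7) = 1"
  by simp_all

lemma inv_shift7 [simp]: "inv_into UNIV shift7 = unshift7" "inv_into UNIV unshift7 = shift7"
  by (rule inv_unique_comp; simp add: fun_eq_iff)+

lemma bij_generators: "bij swap12_36" "bij shift7" "bij unshift7"
  by (rule o_bij[of swap12_36] o_bij[of unshift7] o_bij[of shift7]; simp add: fun_eq_iff swap12_36_invol)+

lemma BijGroup_UNIV_mult: "bij g \<Longrightarrow> bij f \<Longrightarrow> g \<otimes>\<^bsub>BijGroup UNIV\<^esub> f = g \<circ> f"
  by (simp add: BijGroup_def Bij_def extensional_def compose_def fun_eq_iff)

lemma BijGroup_UNIV_one: "\<one>\<^bsub>BijGroup UNIV\<^esub> = id"
  by (simp add: BijGroup_def restrict_def fun_eq_iff)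

lemma inv_BijGroup_UNIV: "bij g \<Longrightarrow> inv\<^bsub>BijGroup UNIV\<^esub> g = inv_into UNIV g"
  by (simp add: inv_BijGroup Bij_def extensional_def fun_eq_iff)

lemma L2_7_bij: "\<sigma> \<in> L2_7 \<Longrightarrow> bij \<sigma>"
  unfolding L2_7_def swap12_36_def[symmetric]
proof (induction rule: generate.induct)
  case one
  then show ?case by (simp add: BijGroup_def restrict_def bij_def inj_on_def surj_def)
next
  case (incl h)
  then show ?case using bij_generators by auto
next
  case (inv h)
  then show ?case using bij_generators by (auto simp: inv_BijGroup_UNIV)
next
  case (eng h1 h2)
  then show ?case using bij_comp by (metis BijGroup_UNIV_mult)
qed

lemma L2_7_closed: "id \<in> L2_7" "swap12_36 \<in> L2_7" "shift7 \<in> L2_7" "unshift7 \<in> L2_7"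
  "\<sigma> \<in> L2_7 \<Longrightarrow> \<tau> \<in> L2_7 \<Longrightarrow> \<sigma> \<circ> \<tau> \<in> L2_7"
proof -
  show "id \<in> L2_7" unfolding L2_7_def by (metis generate.one BijGroup_UNIV_one)
  show "swap12_36 \<in> L2_7" "shift7 \<in> L2_7"
    unfolding L2_7_def swap12_36_def[symmetric] by (auto intro: generate.incl)
  have "inv\<^bsub>BijGroup UNIV\<^esub> shift7 \<in> L2_7"
    unfolding L2_7_def by (auto intro: generate.inv)
  then show "unshift7 \<in> L2_7" using bij_generators by (simp add: inv_BijGroup_UNIV)
  assume "\<sigma> \<in> L2_7" "\<tau> \<in> L2_7"
  then show "\<sigma> \<circ> \<tau> \<in> L2_7"
    using BijGroup_UNIV_mult[OF L2_7_bij L2_7_bij, of \<sigma> \<tau>] generate.eng[of \<sigma> "BijGroup UNIV" _ \<tau>]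
    unfolding L2_7_def by metis
qed

text \<open>Generation also admits inverses of generators. Since \<open>swap12_36\<close> is an
  involution, only \<open>unshift7\<close> adds a case.\<close>

lemma L2_7_induct [consumes 1, case_names id swap shift unshift comp]:
  assumes "\<sigma> \<in> L2_7" "P id" "P swap12_36" "P shift7" "P unshift7"
    and "\<And>\<sigma> \<tau>. \<sigma> \<in> L2_7 \<Longrightarrow> \<tau> \<in> L2_7 \<Longrightarrow> P \<sigma> \<Longrightarrow> P \<tau> \<Longrightarrow> P (\<sigma> \<circ> \<tau>)"
  shows "P \<sigma>"
  using assms(1) unfolding L2_7_def swap12_36_def[symmetric]
proof (induction rule: generate.induct)
  case one
  show ?case using assms(2) by (simp only: BijGroup_UNIV_one)
next
  case (incl h)
  then show ?case using assms(3,4) by auto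
next
  case (inv h)
  then show ?case using bij_generators assms(3,5) by (auto simp: inv_BijGroup_UNIV)
next
  case (eng h1 h2)
  then have "h1 \<in> L2_7" "h2 \<in> L2_7" by (simp_all add: L2_7_def swap12_36_def)
  then show ?case using eng(3,4) assms(6)[of h1 h2] by (simp only: BijGroup_UNIV_mult L2_7_bij)
qed

lemma to_hyperplane_nth:
  "to_hyperplane x $ 1 = x $ 1" "to_hyperplane x $ 2 = x $ 2" "to_hyperplane x $ 3 = x $ 3"
  "to_hyperplane x $ 4 = x $ 4" "to_hyperplane x $ 5 = x $ 5" "to_hyperplane x $ 6 = x $ 6"
  "to_hyperplane x $ 7 = - (x$1 + x$2 + x$3 + x$4 + x$5 + x$6)"
  by (simp_all add: to_hyperplane_def)

lemma first_coords_nth: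
  "first_coords y $ 1 = y $ 1" "first_coords y $ 2 = y $ 2" "first_coords y $ 3 = y $ 3"
  "first_coords y $ 4 = y $ 4" "first_coords y $ 5 = y $ 5" "first_coords y $ 6 = y $ 6"
  by (simp_all add: first_coords_def)

lemma sum_to_hyperplane: "(\<Sum>i\<in>UNIV. to_hyperplane x $ i) = 0"
  by (simp add: sum_7 to_hyperplane_nth)

lemma first_coords_to_hyperplane [simp]: "first_coords (to_hyperplane x) = x"
  by (simp add: vec6_eq_iff first_coords_nth to_hyperplane_nth)

lemma vec7_eq_iff: "x = y \<longleftrightarrow> x $ 1 = y $ 1 \<and> x $ 2 = y $ 2 \<and> x $ 3 = y $ 3 \<and> x $ 4 = y $ 4
    \<and> x $ 5 = y $ 5 \<and> x $ 6 = y $ 6 \<and> x $ 7 = y $ 7" for x y :: "'a^7"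
  by (simp add: vec_eq_iff forall_7)

lemma to_hyperplane_first_coords: "(\<Sum>i\<in>UNIV. y $ i) = 0 \<Longrightarrow> to_hyperplane (first_coords y) = y"
  by (simp add: vec7_eq_iff to_hyperplane_nth first_coords_nth sum_7 add_eq_0_iff)

lemma to_hyperplane_inject: "to_hyperplane x = to_hyperplane y \<longleftrightarrow> x = y"
  by (metis first_coords_to_hyperplane)

lemma to_hyperplane_linear:
  "to_hyperplane (x + y) = to_hyperplane x + to_hyperplane y" "to_hyperplane (c *s x) = c *s to_hyperplane x"
  by (simp_all add: vec7_eq_iff to_hyperplane_nth algebra_simps)

lemma to_hyperplane_perm_rep:
  assumes "bij \<sigma>" shows "to_hyperplane (perm_rep \<sigma> x) = (\<chi> i. to_hyperplane x $ inv_into UNIV \<sigma> i)"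
proof -
  have "(\<Sum>i\<in>UNIV. to_hyperplane x $ inv_into UNIV \<sigma> i) = (\<Sum>i\<in>UNIV. to_hyperplane x $ i)"
    by (rule sum.reindex_bij_betw) (rule bij_imp_bij_inv[OF assms])
  then show ?thesis unfolding perm_rep_def
    by (intro to_hyperplane_first_coords) (simp add: sum_to_hyperplane)
qed

lemma perm_rep_comp:
  assumes "bij \<sigma>" "bij \<tau>" shows "perm_rep (\<sigma> \<circ> \<tau>) x = perm_rep \<sigma> (perm_rep \<tau> x)"
  by (simp add: to_hyperplane_inject[symmetric] to_hyperplane_perm_rep assms bij_comp o_inv_distrib)

lemma perm_rep_id [simp]: "perm_rep id x = x"
  by (simp add: to_hyperplane_inject[symmetric] to_hyperplane_perm_rep vec_eq_iff)

lemma perm_rep_linear: "bij \<sigma> \<Longrightarrow> Vector_Spaces.linear (*s) (*s) (perm_rep \<sigma>)"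
  by unfold_locales (simp_all add: to_hyperplane_inject[symmetric] to_hyperplane_linear to_hyperplane_perm_rep vec_eq_iff)

lemma matrix_perm_rep: "bij \<sigma> \<Longrightarrow> matrix (perm_rep \<sigma>) *v x = perm_rep \<sigma> x"
  by (rule matrix_works[OF perm_rep_linear])

lemma invertible_perm_rep:
  assumes "bij \<sigma>" shows "invertible (matrix (perm_rep \<sigma>))"
proof -
  have "perm_rep (inv_into UNIV \<sigma>) (perm_rep \<sigma> x) = x" for x
    using perm_rep_comp[OF bij_imp_bij_inv[OF assms] assms, of x] assms by (simp add: inv_o_cancel bij_is_inj)
  then have "matrix (perm_rep (inv_into UNIV \<sigma>)) ** matrix (perm_rep \<sigma>) = mat 1"
    by (simp add: matrix_eq matrix_vector_mul_assoc[symmetric] matrix_perm_rep assms bij_imp_bij_inv)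
  then show ?thesis unfolding invertible_left_inverse by blast
qed

lemma f1_perm_rep: "bij \<sigma> \<Longrightarrow> f1 (perm_rep \<sigma> x) = f1 x"
  unfolding f1_def by (simp add: to_hyperplane_perm_rep)
    (rule sum.reindex_bij_betw[OF bij_imp_bij_inv, where g = "\<lambda>i. to_hyperplane x $ i ^ 3"])

lemma f2_perm_rep:
  assumes "\<sigma> \<in> L2_7" shows "f2 (perm_rep \<sigma> x) = f2 x"
  using assms
proof (induction arbitrary: x rule: L2_7_induct)
  case swap
  show ?case unfolding f2_def Let_def to_hyperplane_perm_rep[OF bij_generators(1)] vec_lambda_beta inv_swap12_36
    by simp
next
  case shift
  show ?case unfolding f2_def Let_def to_hyperplane_perm_rep[OF bij_generators(2)] vec_lambda_beta inv_shift7
    by (simp add: mult_ac numeral_7_wrap)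
next
  case unshift
  show ?case unfolding f2_def Let_def to_hyperplane_perm_rep[OF bij_generators(3)] vec_lambda_beta inv_shift7
    by (simp add: mult_ac numeral_7_wrap)
next
  case (comp \<sigma> \<tau>)
  then show ?case by (simp only: perm_rep_comp L2_7_bij)
qed simp

lemma pencil_perm_rep: "\<sigma> \<in> L2_7 \<Longrightarrow> pencil a (perm_rep \<sigma> x) = pencil a x"
  by (simp add: pencil_def f1_perm_rep f2_perm_rep L2_7_bij)

lemma pencil_invariant: "pencil a \<in> invariant_cubics"
  by (simp add: invariant_cubics_def pencil_in_forms pencil_perm_rep)

text \<open>The point with coordinates 6 at \<open>i\<close> and \<open>-1\<close> elsewhere, a multiple of the projection of \<open>e\<^sub>i\<close>.\<close>

definition basevec :: "7 \<Rightarrow> complex^6" where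
  "basevec i = first_coords (\<chi> j. if j = i then 6 else -1)"

lemma to_hyperplane_basevec: "to_hyperplane (basevec i) = (\<chi> j. if j = i then 6 else -1)"
  unfolding basevec_def by (rule to_hyperplane_first_coords) (use exhaust_7[of i] in \<open>auto simp: sum_7\<close>)

lemma perm_rep_basevec:
  assumes "bij \<sigma>" shows "perm_rep \<sigma> (basevec i) = basevec (\<sigma> i)"
proof -
  have "inv_into UNIV \<sigma> j = i \<longleftrightarrow> j = \<sigma> i" for j using assms by (metis bij_inv_eq_iff)
  then show ?thesis
    by (simp add: to_hyperplane_inject[symmetric] to_hyperplane_perm_rep assms to_hyperplane_basevec vec_eq_iff)
qed

text \<open>The vector \<open>basevec i\<close> is 7 e_i minus the all-ones vector, whose
  contributions cancel because the coordinates of a point of the hyperplane add up to 0.\<close>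

lemma basevec_expansion: "7 *s x = (\<Sum>i\<in>UNIV. to_hyperplane x $ i *s basevec i)"
  by (simp add: sum_7 vec6_eq_iff basevec_def first_coords_nth to_hyperplane_nth)

section \<open>The outer automorphism\<close>

text \<open>The coordinates of the image are indexed by the lines of the Fano plane, the line with index \<open>k\<close>
  being \<open>{1 - k, 2 - k, 4 - k}\<close>; this labelling makes the incidence matrix symmetric.\<close>

definition duality :: "complex^6 \<Rightarrow> complex^6" where
  "duality x = (let y = to_hyperplane x in first_coords (vector [y$7 + y$1 + y$3, y$6 + y$7 + y$2,
     y$5 + y$6 + y$1, y$4 + y$5 + y$7, y$3 + y$4 + y$6, y$2 + y$3 + y$5, y$1 + y$2 + y$4]))"

lemma to_hyperplane_duality:
  "to_hyperplane (duality x) = (let y = to_hyperplane x in vector [y$7 + y$1 + y$3, y$6 + y$7 + y$2,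
     y$5 + y$6 + y$1, y$4 + y$5 + y$7, y$3 + y$4 + y$6, y$2 + y$3 + y$5, y$1 + y$2 + y$4])"
  unfolding duality_def Let_def
  by (rule to_hyperplane_first_coords) (simp add: sum_7 to_hyperplane_nth)

text \<open>Every point of the Fano plane lies on three lines and two points share one line, so the
  square of the symmetric incidence matrix is 2 I + J, and the all-ones matrix J kills the
  hyperplane.\<close>

lemma duality_duality: "duality (duality x) = 2 *s x"
  unfolding to_hyperplane_inject[symmetric] to_hyperplane_duality
  by (simp add: vec7_eq_iff Let_def to_hyperplane_nth)

lemma duality_linear: "Vector_Spaces.linear (*s) (*s) duality"
  by unfold_locales (simp_all add: to_hyperplane_inject[symmetric] to_hyperplane_linear to_hyperplane_duality
      vec7_eq_iff Let_def algebra_simps)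

lemma matrix_duality: "matrix duality *v x = duality x"
  by (rule matrix_works[OF duality_linear])

lemma duality_scale: "duality (c *s x) = c *s duality x"
  by (simp add: matrix_duality[symmetric] vector_scalar_commute)

text \<open>In the sum of the cubes of the line sums every y_i^3 occurs three times and every y_i^2
  y_j with coefficient 3. On the hyperplane the sum of the y_i^2 y_j over i \<noteq> j is minus the
  sum of cubes, so only 6 times the sum of the products along lines survives.\<close>

lemma f1_duality: "f1 (duality x) = 6 * f2 x"
proof -
  define y1 y2 y3 y4 y5 y6 where y: "y1 = x$1" "y2 = x$2" "y3 = x$3" "y4 = x$4" "y5 = x$5" "y6 = x$6"
  show ?thesis unfolding f1_def f2_def to_hyperplane_duality Let_def sum_7 vector_7 to_hyperplane_nth y[symmetric]
    by Groebner_Basis.algebra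
qed

lemma f1_scale: "f1 (c *s x) = c^3 * f1 x" and f2_scale: "f2 (c *s x) = c^3 * f2 x"
  using forms_homogeneous[OF f1_in_forms] forms_homogeneous[OF f2_in_forms] by auto

text \<open>Applying the formula for \<open>f1\<close> twice avoids a second expansion: the square
  of \<open>duality\<close> is multiplication by 2, which multiplies cubics by 8.\<close>

lemma f2_duality: "f2 (duality x) = 4 / 3 * f1 x"
proof -
  have "6 * f2 (duality x) = f1 (2 *s x)" by (simp only: f1_duality[symmetric] duality_duality)
  then have "3 * f2 (duality x) = 4 * f1 x" by (simp add: f1_scale)
  then show ?thesis by (simp add: field_simps)
qed

text \<open>Since line k is {1 - k, 2 - k, 4 - k}, shifting the points forward shifts the labels of
  the lines backward.\<close>

lemma duality_perm_rep:
  "duality (perm_rep swap12_36 x) = perm_rep swap12_36 (duality x)"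
  "duality (perm_rep shift7 x) = perm_rep unshift7 (duality x)"
  "duality (perm_rep unshift7 x) = perm_rep shift7 (duality x)"
  unfolding to_hyperplane_inject[symmetric] to_hyperplane_duality to_hyperplane_perm_rep[OF bij_generators(1)]
    to_hyperplane_perm_rep[OF bij_generators(2)] to_hyperplane_perm_rep[OF bij_generators(3)]
  by (simp_all add: vec7_eq_iff Let_def add_ac numeral_7_wrap)

text \<open>Conjugation by the incidence matrix preserves the group because it does so on
  generators; this is what puts a multiple of it into the normalizer.\<close>

lemma duality_conj:
  assumes "\<sigma> \<in> L2_7"
  shows "\<exists>\<tau>\<in>L2_7. \<forall>x. duality (perm_rep \<sigma> x) = perm_rep \<tau> (duality x)"
  using assms
proof (induction rule: L2_7_induct)
  case id
  show ?case using L2_7_closed(1) by (intro bexI[of _ id]) (simp_all only: perm_rep_id simp_thms)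
next
  case swap
  then show ?case using L2_7_closed duality_perm_rep by blast
next
  case shift
  then show ?case using L2_7_closed duality_perm_rep by blast
next
  case unshift
  then show ?case using L2_7_closed duality_perm_rep by blast
next
  case (comp \<sigma> \<tau>)
  then obtain \<sigma>' \<tau>' where "\<sigma>' \<in> L2_7" "\<tau>' \<in> L2_7"
    "\<And>x. duality (perm_rep \<sigma> x) = perm_rep \<sigma>' (duality x)"
    "\<And>x. duality (perm_rep \<tau> x) = perm_rep \<tau>' (duality x)" by auto
  then show ?case using comp(1,2) L2_7_closed(5)
    by (intro bexI[of _ "\<sigma>' \<circ> \<tau>'"]) (simp_all only: perm_rep_comp L2_7_bij simp_thms)
qed

section \<open>Cubic forms as trilinear forms\<close>

definition trilinear :: "('n::finite \<Rightarrow> 'n \<Rightarrow> 'n \<Rightarrow> complex) \<Rightarrow> complex^'n \<Rightarrow> complex^'n \<Rightarrow> complex^'n \<Rightarrow> complex" where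
  "trilinear c x y z = (\<Sum>i\<in>UNIV. \<Sum>j\<in>UNIV. \<Sum>k\<in>UNIV. c i j k * x $ i * y $ j * z $ k)"

lemma monomial_split:
  fixes m :: "'n::finite \<Rightarrow> nat"
  assumes "(\<Sum>i\<in>UNIV. m i) = Suc d"
  shows "\<exists>p m'. (\<Sum>i\<in>UNIV. m' i) = d
    \<and> (\<forall>x::complex^'n. (\<Prod>i\<in>UNIV. x $ i ^ m i) = x $ p * (\<Prod>i\<in>UNIV. x $ i ^ m' i))"
proof -
  have "\<exists>i. m i \<noteq> 0" using assms by (metis Zero_not_Suc sum.neutral)
  then obtain i where i: "m i \<noteq> 0" by blast
  define m' where "m' = m(i := m i - 1)"
  have "(\<Sum>i\<in>UNIV. m i) = m i + (\<Sum>j\<in>UNIV - {i}. m j)" by (rule sum.remove) auto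
  moreover have "(\<Sum>i\<in>UNIV. m' i) = m' i + (\<Sum>j\<in>UNIV - {i}. m' j)" by (rule sum.remove) auto
  moreover have "(\<Sum>j\<in>UNIV - {i}. m' j) = (\<Sum>j\<in>UNIV - {i}. m j)" by (rule sum.cong) (auto simp: m'_def)
  ultimately have 1: "(\<Sum>i\<in>UNIV. m' i) = d" using assms i by (simp add: m'_def)
  have 2: "(\<Prod>i\<in>UNIV. x $ i ^ m i) = x $ i * (\<Prod>i\<in>UNIV. x $ i ^ m' i)" for x :: "complex^'n"
  proof -
    have "(\<Prod>i\<in>UNIV. x $ i ^ m i) = x $ i ^ m i * (\<Prod>j\<in>UNIV - {i}. x $ j ^ m j)" by (rule prod.remove) auto
    also have "(\<Prod>j\<in>UNIV - {i}. x $ j ^ m j) = (\<Prod>j\<in>UNIV - {i}. x $ j ^ m' j)"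
      by (rule prod.cong) (auto simp: m'_def)
    also have "x $ i ^ m i = x $ i * x $ i ^ m' i" using i by (cases "m i") (auto simp: m'_def)
    also have "x $ i * x $ i ^ m' i * (\<Prod>j\<in>UNIV - {i}. x $ j ^ m' j) = x $ i * (\<Prod>i\<in>UNIV. x $ i ^ m' i)"
      by (subst prod.remove[of UNIV i]) auto
    finally show ?thesis .
  qed
  show ?thesis using 1 2 by blast
qed

lemma trilinear_lin:
  "trilinear c (x + x') y z = trilinear c x y z + trilinear c x' y z"
  "trilinear c x (y + y') z = trilinear c x y z + trilinear c x y' z"
  "trilinear c x y (z + z') = trilinear c x y z + trilinear c x y z'"
  "trilinear c (k *s x) y z = k * trilinear c x y z"
  "trilinear c x (k *s y) z = k * trilinear c x y z"
  "trilinear c x y (k *s z) = k * trilinear c x y z"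
  by (simp_all add: trilinear_def ring_distribs sum.distrib sum_distrib_left mult_ac)

lemma trilinear_sum:
  "trilinear c (\<Sum>i\<in>I. f i) y z = (\<Sum>i\<in>I. trilinear c (f i) y z)"
  "trilinear c x (\<Sum>i\<in>I. f i) z = (\<Sum>i\<in>I. trilinear c x (f i) z)"
  "trilinear c x y (\<Sum>i\<in>I. f i) = (\<Sum>i\<in>I. trilinear c x y (f i))"
proof -
  have zero: "trilinear c 0 y z = 0" "trilinear c x 0 z = 0" "trilinear c x y 0 = 0"
    by (simp_all add: trilinear_def)
  show "trilinear c (\<Sum>i\<in>I. f i) y z = (\<Sum>i\<in>I. trilinear c (f i) y z)"
    by (induction I rule: infinite_finite_induct) (simp_all add: trilinear_lin zero)
  show "trilinear c x (\<Sum>i\<in>I. f i) z = (\<Sum>i\<in>I. trilinear c x (f i) z)"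
    by (induction I rule: infinite_finite_induct) (simp_all add: trilinear_lin zero)
  show "trilinear c x y (\<Sum>i\<in>I. f i) = (\<Sum>i\<in>I. trilinear c x y (f i))"
    by (induction I rule: infinite_finite_induct) (simp_all add: trilinear_lin zero)
qed

text \<open>Each monomial is split into three linear factors, and averaging the coefficients over
  the six orders of the indices makes them symmetric without changing the cubic.\<close>

lemma cubic_form_trilinear:
  fixes F :: "complex^'n \<Rightarrow> complex"
  assumes "F \<in> forms 3"
  obtains c where "\<And>x. F x = trilinear c x x x"
    "\<And>i j k. c i j k = c j i k" "\<And>i j k. c i j k = c i k j"
proof -
  define R where "R F \<longleftrightarrow> (\<exists>c. \<forall>x::complex^'n. F x = trilinear c x x x)" for F
  have zero: "R (\<lambda>x. 0)" unfolding R_def by (rule exI[of _ "\<lambda>_ _ _. 0"]) (simp add: trilinear_def)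
  have add: "R (\<lambda>x. F x + G x)" if "R F" "R G" for F G
  proof -
    from that obtain a b where "\<And>x. F x = trilinear a x x x" "\<And>x. G x = trilinear b x x x"
      unfolding R_def by blast
    then show ?thesis unfolding R_def
      by (intro exI[of _ "\<lambda>i j k. a i j k + b i j k"]) (simp add: trilinear_def ring_distribs sum.distrib)
  qed
  have sum: "R (\<lambda>x. \<Sum>m\<in>M. G m x)" if "\<And>m. m \<in> M \<Longrightarrow> R (G m)" for M and G :: "('n \<Rightarrow> nat) \<Rightarrow> _"
    using that by (induction M rule: infinite_finite_induct) (auto intro: zero add)
  have mono: "R (\<lambda>x. a * (\<Prod>i\<in>UNIV. x $ i ^ m i))" if m: "(\<Sum>i\<in>UNIV. m i) = 3" for a m
  proof -
    from m have "(\<Sum>i\<in>UNIV. m i) = Suc (Suc (Suc 0))" by simp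
    then obtain p m1 where 1: "(\<Sum>i\<in>UNIV. m1 i) = Suc (Suc 0)"
       "\<And>x::complex^'n. (\<Prod>i\<in>UNIV. x $ i ^ m i) = x $ p * (\<Prod>i\<in>UNIV. x $ i ^ m1 i)" using monomial_split by blast
    from 1(1) obtain q m2 where 2: "(\<Sum>i\<in>UNIV. m2 i) = Suc 0"
       "\<And>x::complex^'n. (\<Prod>i\<in>UNIV. x $ i ^ m1 i) = x $ q * (\<Prod>i\<in>UNIV. x $ i ^ m2 i)" using monomial_split by blast
    from 2(1) obtain r m3 where 3: "(\<Sum>i\<in>UNIV. m3 i) = 0"
       "\<And>x::complex^'n. (\<Prod>i\<in>UNIV. x $ i ^ m2 i) = x $ r * (\<Prod>i\<in>UNIV. x $ i ^ m3 i)" using monomial_split by blast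
    have aux: "(\<Sum>k\<in>(UNIV :: 'n set). if P then g k else 0) = (if P then \<Sum>k\<in>UNIV. g k else 0)"
      for P and g :: "'n \<Rightarrow> complex" by simp
    have "trilinear (\<lambda>i j k. if i = p then if j = q then if k = r then a else 0 else 0 else 0) x x x
      = a * x $ p * x $ q * x $ r" for x :: "complex^'n"
      by (simp add: trilinear_def if_distrib[of "\<lambda>c. c * _"] sum.delta aux cong: if_cong)
    moreover have "(\<Prod>i\<in>UNIV. x $ i ^ m i) = x $ p * x $ q * x $ r" for x :: "complex^'n"
      using 3(1) by (simp add: 1(2) 2(2) 3(2) mult_ac)
    ultimately show ?thesis unfolding R_def
      by (intro exI[of _ "\<lambda>i j k. if i = p then if j = q then if k = r then a else 0 else 0 else 0"]) (simp add: mult_ac)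
  qed
  from assms obtain a where "F = (\<lambda>x. \<Sum>m | (\<Sum>i\<in>UNIV. m i) = 3. a m * (\<Prod>i\<in>UNIV. x $ i ^ m i))"
    unfolding forms_def by blast
  then have "R F" by (simp only:) (intro sum mono, simp)
  then obtain c where c: "\<And>x. F x = trilinear c x x x" unfolding R_def by blast
  define d where "d i j k = (c i j k + c i k j + c j i k + c j k i + c k i j + c k j i) / 6" for i j k
  have "F x = trilinear d x x x" for x
  proof -
    have swap12: "trilinear (\<lambda>i j k. c' j i k) x x x = trilinear c' x x x" for c' :: "'n \<Rightarrow> 'n \<Rightarrow> 'n \<Rightarrow> complex"
      unfolding trilinear_def by (subst sum.swap) (simp add: mult_ac)
    have swap23: "trilinear (\<lambda>i j k. c' i k j) x x x = trilinear c' x x x" for c' :: "'n \<Rightarrow> 'n \<Rightarrow> 'n \<Rightarrow> complex"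
      unfolding trilinear_def by (rule sum.cong[OF refl], subst sum.swap) (simp add: mult_ac)
    note s = swap12[of c] swap23[of c] swap12[of "\<lambda>i j k. c i k j"] swap23[of "\<lambda>i j k. c j i k"]
      swap12[of "\<lambda>i j k. c k i j"]
    have "6 * trilinear d x x x = trilinear c x x x + trilinear (\<lambda>i j k. c i k j) x x x
      + trilinear (\<lambda>i j k. c j i k) x x x + trilinear (\<lambda>i j k. c j k i) x x x
      + trilinear (\<lambda>i j k. c k i j) x x x + trilinear (\<lambda>i j k. c k j i) x x x"
      unfolding trilinear_def sum_distrib_left sum.distrib[symmetric]
      by (intro sum.cong refl) (simp add: d_def field_simps)
    then show ?thesis using s c by simp
  qed
  moreover have "d i j k = d j i k" "d i j k = d i k j" for i j k by (simp_all add: d_def add_ac)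
  ultimately show thesis by (rule that)
qed

lemma trilinear_swap:
  assumes "\<And>i j k. c i j k = c j i k" "\<And>i j k. c i j k = c i k j"
  shows "trilinear c x y z = trilinear c y x z" "trilinear c x y z = trilinear c x z y"
proof -
  have "trilinear c x y z = (\<Sum>j\<in>UNIV. \<Sum>i\<in>UNIV. \<Sum>k\<in>UNIV. c i j k * x $ i * y $ j * z $ k)"
    unfolding trilinear_def by (rule sum.swap)
  also have "\<dots> = trilinear c y x z" unfolding trilinear_def
    by (intro sum.cong refl) (subst assms(1), simp add: mult_ac)
  finally show "trilinear c x y z = trilinear c y x z" .
  have "trilinear c x y z = (\<Sum>i\<in>UNIV. \<Sum>k\<in>UNIV. \<Sum>j\<in>UNIV. c i j k * x $ i * y $ j * z $ k)"
    unfolding trilinear_def by (intro sum.cong refl sum.swap)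
  also have "\<dots> = trilinear c x z y" unfolding trilinear_def
    by (intro sum.cong refl) (subst assms(2), simp add: mult_ac)
  finally show "trilinear c x y z = trilinear c x z y" .
qed

text \<open>The polar form is expressed by values of the cubic alone, so it inherits every
  invariance of the cubic under linear maps.\<close>

lemma trilinear_polarization:
  assumes F: "\<And>x. F x = trilinear c x x x"
    and sym: "\<And>i j k. c i j k = c j i k" "\<And>i j k. c i j k = c i k j"
  shows "6 * trilinear c x y z = F (x + y + z) - F (x + y) - F (x + z) - F (y + z) + F x + F y + F z"
proof -
  note s = trilinear_swap[of c, OF sym]
  have "trilinear c y x w = trilinear c x y w" "trilinear c z x w = trilinear c x z w"
    "trilinear c z y w = trilinear c y z w" "trilinear c w y x = trilinear c w x y"
    "trilinear c w z x = trilinear c w x z" "trilinear c w z y = trilinear c w y z" for w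
    using s by metis+
  then show ?thesis unfolding F trilinear_lin by simp
qed

section \<open>The invariant cubics\<close>

text \<open>Triples are grouped by their differences, that is, into orbits of the 7-cycle.\<close>

lemma cyclic_sum_7:
  "(\<Sum>i\<in>UNIV. \<Sum>j\<in>UNIV. \<Sum>k\<in>UNIV. g i j k) = (\<Sum>d\<in>UNIV. \<Sum>e\<in>UNIV. \<Sum>i\<in>(UNIV :: 7 set). g i (i + d) (i + e))"
  for g :: "7 \<Rightarrow> 7 \<Rightarrow> 7 \<Rightarrow> complex"
proof -
  have bij: "bij ((+) i)" for i :: 7 by (rule o_bij[of "\<lambda>j. j - i"]) (auto simp: fun_eq_iff)
  have "(\<Sum>i\<in>UNIV. \<Sum>j\<in>UNIV. \<Sum>k\<in>UNIV. g i j k) = (\<Sum>i\<in>UNIV. \<Sum>d\<in>UNIV. \<Sum>e\<in>UNIV. g i (i + d) (i + e))"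
  proof (rule sum.cong[OF refl])
    fix i
    have "(\<Sum>d\<in>UNIV. \<Sum>e\<in>UNIV. g i (i + d) (i + e)) = (\<Sum>d\<in>UNIV. \<Sum>k\<in>UNIV. g i (i + d) k)"
      by (intro sum.cong refl sum.reindex_bij_betw[OF bij])
    also have "\<dots> = (\<Sum>j\<in>UNIV. \<Sum>k\<in>UNIV. g i j k)"
      by (rule sum.reindex_bij_betw[OF bij, of "\<lambda>j. \<Sum>k\<in>UNIV. g i j k"])
    finally show "(\<Sum>j\<in>UNIV. \<Sum>k\<in>UNIV. g i j k) = (\<Sum>d\<in>UNIV. \<Sum>e\<in>UNIV. g i (i + d) (i + e))" ..
  qed
  also have "\<dots> = (\<Sum>d\<in>UNIV. \<Sum>i\<in>UNIV. \<Sum>e\<in>UNIV. g i (i + d) (i + e))" by (rule sum.swap)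
  also have "\<dots> = (\<Sum>d\<in>UNIV. \<Sum>e\<in>UNIV. \<Sum>i\<in>UNIV. g i (i + d) (i + e))" by (intro sum.cong refl sum.swap)
  finally show ?thesis .
qed

lemma numeral_7_wraps: "(0::7) = 7" "(8::7) = 1" "(9::7) = 2" "(10::7) = 3" "(11::7) = 4" "(12::7) = 5"
  "(13::7) = 6" "(14::7) = 7"
  by simp_all

text \<open>An invariant symmetric function of three indices takes four values: on \<open>(i, i, i)\<close>, on \<open>(i, i, j)\<close>,
  on the lines of the Fano plane, and on the other triples.\<close>

lemma invariant_triples:
  fixes T :: "7 \<Rightarrow> 7 \<Rightarrow> 7 \<Rightarrow> complex"
  assumes sym: "\<And>i j k. T i j k = T j i k" "\<And>i j k. T i j k = T i k j"
    and shift: "\<And>i j k. T (i + 1) (j + 1) (k + 1) = T i j k"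
    and swap: "\<And>i j k. T (swap12_36 i) (swap12_36 j) (swap12_36 k) = T i j k"
  shows "T i (i + d) (i + e) = T 7 d e"
    and "T 7 7 2 = T 7 7 1" "T 7 7 3 = T 7 7 1" "T 7 7 4 = T 7 7 1" "T 7 7 5 = T 7 7 1" "T 7 7 6 = T 7 7 1"
    and "T 7 1 1 = T 7 7 1" "T 7 2 2 = T 7 7 1" "T 7 3 3 = T 7 7 1" "T 7 4 4 = T 7 7 1" "T 7 5 5 = T 7 7 1"
      "T 7 6 6 = T 7 7 1"
    and "T 7 2 6 = T 7 1 3" "T 7 4 5 = T 7 1 3"
    and "T 7 1 4 = T 7 1 2" "T 7 1 5 = T 7 1 2" "T 7 1 6 = T 7 1 2" "T 7 2 3 = T 7 1 2" "T 7 2 4 = T 7 1 2"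
      "T 7 2 5 = T 7 1 2" "T 7 3 4 = T 7 1 2" "T 7 3 5 = T 7 1 2" "T 7 3 6 = T 7 1 2" "T 7 4 6 = T 7 1 2"
      "T 7 5 6 = T 7 1 2"
proof -
  have sh: "T (i + m) (j + m) (k + m) = T i j k" for i j k m
  proof -
    have "T (i + of_nat n) (j + of_nat n) (k + of_nat n) = T i j k" for n
    proof (induction n)
      case (Suc n)
      then show ?case using shift[of "i + of_nat n" "j + of_nat n" "k + of_nat n"] by (simp add: ac_simps)
    qed simp
    from this[of 1] this[of 2] this[of 3] this[of 4] this[of 5] this[of 6] this[of 7]
    show ?thesis using exhaust_7[of m] by (elim disjE) (simp_all only: of_nat_numeral of_nat_1)
  qed
  show "T i (i + d) (i + e) = T 7 d e"
  proof -
    have "7 + i = i" by simp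
    then show ?thesis using sh[of 7 i d e] by (simp only: add.commute[of d] add.commute[of e])
  qed
  have s: "T i i j = T 7 7 (j - i)" for i j
  proof -
    have "7 + i = i" by simp
    then show ?thesis using sh[of 7 i 7 "j - i"] by (simp only: diff_add_cancel)
  qed
  have b: "T 7 7 1 = T 7 7 2" "T 7 7 3 = T 7 7 6" "T 7 7 4 = T 7 7 1" "T 7 7 3 = T 7 7 2" "T 7 7 5 = T 7 7 1"
    using swap[of 7 7 1] swap[of 7 7 3] swap[of 3 3 7] swap[of 1 1 4] swap[of 1 1 6]
      s[of 6 7] s[of 3 7] s[of 2 4] s[of 1 4] s[of 2 3] s[of 1 6] by simp_all
  show 1: "T 7 7 2 = T 7 7 1" "T 7 7 3 = T 7 7 1" "T 7 7 4 = T 7 7 1" "T 7 7 5 = T 7 7 1" "T 7 7 6 = T 7 7 1"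
    using b by simp_all
  have "T 7 j j = T 7 7 (7 - j)" for j
    using sym(2)[of j j 7] sym(1)[of j 7 j] s[of j 7] by metis
  then show "T 7 1 1 = T 7 7 1" "T 7 2 2 = T 7 7 1" "T 7 3 3 = T 7 7 1" "T 7 4 4 = T 7 7 1" "T 7 5 5 = T 7 7 1"
      "T 7 6 6 = T 7 7 1" using 1 by simp_all
  have perm: "T i j k = T j i k" "T i j k = T i k j" "T i j k = T k j i" "T i j k = T j k i" "T i j k = T k i j" for i j k
    using sym by metis+
  have t16: "T 7 1 6 = T 7 1 2"
    using sh[of 7 1 1 6] perm(5)[of 1 2 7] by (simp add: numeral_7_wraps)
  have t23: "T 7 2 3 = T 7 1 5"
    using sh[of 7 5 2 3] perm(4)[of 5 7 1] by (simp add: numeral_7_wraps)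
  have t25: "T 7 2 5 = T 7 2 4"
    using sh[of 7 2 2 5] perm(5)[of 2 4 7] by (simp add: numeral_7_wraps)
  have t26: "T 7 2 6 = T 7 1 3"
    using sh[of 7 1 2 6] perm(5)[of 1 3 7] by (simp add: numeral_7_wraps)
  have t34: "T 7 3 4 = T 7 1 4"
    using sh[of 7 4 3 4] perm(4)[of 4 7 1] by (simp add: numeral_7_wraps)
  have t35: "T 7 3 5 = T 7 2 4"
    using sh[of 7 4 3 5] perm(4)[of 4 7 2] by (simp add: numeral_7_wraps)
  have t36: "T 7 3 6 = T 7 1 4"
    using sh[of 7 1 3 6] perm(5)[of 1 4 7] by (simp add: numeral_7_wraps)
  have t45: "T 7 4 5 = T 7 1 3"
    using sh[of 7 3 4 5] perm(4)[of 3 7 1] by (simp add: numeral_7_wraps)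
  have t46: "T 7 4 6 = T 7 1 5"
    using sh[of 7 1 4 6] perm(5)[of 1 5 7] by (simp add: numeral_7_wraps)
  have t56: "T 7 5 6 = T 7 1 2"
    using sh[of 7 2 5 6] perm(4)[of 2 7 1] by (simp add: numeral_7_wraps)
  show "T 7 2 6 = T 7 1 3" "T 7 4 5 = T 7 1 3" by (fact t26 t45)+
  \<comment> \<open>Up to order and translation there are five classes of triples of distinct
    indices: the lines and four others. These three instances of the swap fuse the four
    others.\<close>
  have "T 7 1 4 = T 7 2 4" "T 7 1 5 = T 7 2 5" "T 7 1 6 = T 7 2 3"
    using swap[of 7 1 4] swap[of 7 1 5] swap[of 7 1 6] by simp_all
  then show "T 7 1 4 = T 7 1 2" "T 7 1 5 = T 7 1 2" "T 7 1 6 = T 7 1 2" "T 7 2 3 = T 7 1 2" "T 7 2 4 = T 7 1 2"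
      "T 7 2 5 = T 7 1 2" "T 7 3 4 = T 7 1 2" "T 7 3 5 = T 7 1 2" "T 7 3 6 = T 7 1 2" "T 7 4 6 = T 7 1 2"
      "T 7 5 6 = T 7 1 2"
    using t16 t56 t34 t36 t23 t46 t25 t35 by simp_all
qed

lemma invariant_cubic_in_pencil:
  assumes "F \<in> invariant_cubics" shows "\<exists>a. F = pencil a"
proof -
  from assms have F: "F \<in> forms 3" "\<And>\<sigma> x. \<sigma> \<in> L2_7 \<Longrightarrow> F (perm_rep \<sigma> x) = F x"
    by (auto simp: invariant_cubics_def)
  obtain c where c: "\<And>x. F x = trilinear c x x x"
    "\<And>i j k. c i j k = c j i k" "\<And>i j k. c i j k = c i k j" using cubic_form_trilinear[OF F(1)] by blast
  define T where "T i j k = trilinear c (basevec i) (basevec j) (basevec k)" for i j k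
  have inv: "T (\<sigma> i) (\<sigma> j) (\<sigma> k) = T i j k" if "\<sigma> \<in> L2_7" for \<sigma> i j k
  proof -
    have "bij \<sigma>" using that by (rule L2_7_bij)
    have lin: "perm_rep \<sigma> (x + y) = perm_rep \<sigma> x + perm_rep \<sigma> y" for x y
      using Vector_Spaces.linear.axioms(1)[OF perm_rep_linear[OF \<open>bij \<sigma>\<close>]]
      by (metis matrix_perm_rep[OF \<open>bij \<sigma>\<close>] matrix_vector_right_distrib)
    have "6 * trilinear c (perm_rep \<sigma> x) (perm_rep \<sigma> y) (perm_rep \<sigma> z) = 6 * trilinear c x y z" for x y z
      unfolding trilinear_polarization[OF c] lin[symmetric] F(2)[OF that] ..
    then show ?thesis unfolding T_def perm_rep_basevec[OF \<open>bij \<sigma>\<close>, symmetric] by simp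
  qed
  have sym: "T i j k = T j i k" "T i j k = T i k j" for i j k
    unfolding T_def using trilinear_swap[of c, OF c(2,3)] by auto
  note tri = invariant_triples[of T, OF sym inv[OF L2_7_closed(3)] inv[OF L2_7_closed(2)]]
  define \<alpha> where "\<alpha> = T 7 7 7"
  define \<beta> where "\<beta> = T 7 7 1"
  define \<gamma> where "\<gamma> = T 7 1 3"
  define \<delta> where "\<delta> = T 7 1 2"
  have perm: "T 7 1 7 = T 7 7 1" "T 7 2 7 = T 7 7 2" "T 7 3 7 = T 7 7 3" "T 7 4 7 = T 7 7 4" "T 7 5 7 = T 7 7 5"
    "T 7 6 7 = T 7 7 6" using sym by blast+
  have comm: "T 7 3 1 = T 7 1 3" "T 7 6 2 = T 7 2 6" "T 7 5 4 = T 7 4 5" "T 7 2 1 = T 7 1 2" "T 7 4 1 = T 7 1 4"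
     "T 7 5 1 = T 7 1 5" "T 7 6 1 = T 7 1 6" "T 7 3 2 = T 7 2 3" "T 7 4 2 = T 7 2 4" "T 7 5 2 = T 7 2 5"
     "T 7 4 3 = T 7 3 4" "T 7 5 3 = T 7 3 5" "T 7 6 3 = T 7 3 6" "T 7 6 4 = T 7 4 6" "T 7 6 5 = T 7 5 6"
    using sym by blast+
  \<comment> \<open>The expansion of 7 x in the seven vectors brings in 343 = 7^3. The numerators
    collect the coefficients of \<open>f1\<close> and \<open>f2\<close> after the four orbit sums
    \<open>A\<close>, \<open>B\<close>, \<open>C\<close>, \<open>D\<close> are rewritten.\<close>
  have "F x = pencil (vector [(\<alpha> - 3 * \<beta> + 2 * \<delta>) / 343, 6 * (\<gamma> - \<delta>) / 343]) x" for x
  proof -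
    define y1 y2 y3 y4 y5 y6 where y: "y1 = x$1" "y2 = x$2" "y3 = x$3" "y4 = x$4" "y5 = x$5" "y6 = x$6"
    define S where "S d e = (\<Sum>i\<in>UNIV. to_hyperplane x $ i * to_hyperplane x $ (i + d) * to_hyperplane x $ (i + e))"
      for d e :: 7
    define A where "A = S 7 7"
    define B where "B = S 7 1 + S 1 7 + S 1 1 + S 7 2 + S 2 7 + S 2 2 + S 7 3 + S 3 7 + S 3 3 + S 7 4 + S 4 7 + S 4 4 + S 7 5 + S 5 7 + S 5 5 + S 7 6 + S 6 7 + S 6 6"
    define C where "C = S 1 3 + S 3 1 + S 2 6 + S 6 2 + S 4 5 + S 5 4"
    define D where "D = S 1 2 + S 2 1 + S 1 4 + S 4 1 + S 1 5 + S 5 1 + S 1 6 + S 6 1 + S 2 3 + S 3 2 + S 2 4 + S 4 2 + S 2 5 + S 5 2 + S 3 4 + S 4 3 + S 3 5 + S 5 3 + S 3 6 + S 6 3 + S 4 6 + S 6 4 + S 5 6 + S 6 5"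
    have e1: "343 * F x = F (7 *s x)" by (simp add: forms_homogeneous[OF F(1)])
    have e2: "F (7 *s x) = (\<Sum>i\<in>UNIV. \<Sum>j\<in>UNIV. \<Sum>k\<in>UNIV. to_hyperplane x $ i * to_hyperplane x $ j * to_hyperplane x $ k * T i j k)"
      unfolding c(1) basevec_expansion trilinear_sum(1) unfolding trilinear_sum(2) unfolding trilinear_sum(3)
      by (simp add: trilinear_lin T_def mult_ac)
    have e3: "(\<Sum>i\<in>UNIV. \<Sum>j\<in>UNIV. \<Sum>k\<in>UNIV. to_hyperplane x $ i * to_hyperplane x $ j * to_hyperplane x $ k * T i j k)
      = (\<Sum>d\<in>UNIV. \<Sum>e\<in>UNIV. T 7 d e * S d e)"
      by (subst cyclic_sum_7) (simp only: tri(1) S_def sum_distrib_left mult.commute)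
    have e4: "(\<Sum>d\<in>UNIV. \<Sum>e\<in>UNIV. T 7 d e * S d e) = \<alpha> * A + \<beta> * B + \<gamma> * C + \<delta> * D"
      unfolding sum_7 tri(2-) perm comm \<alpha>_def[symmetric] \<beta>_def[symmetric] \<gamma>_def[symmetric] \<delta>_def[symmetric]
        A_def B_def C_def D_def by (simp add: ring_distribs)
    \<comment> \<open>The coordinate sum is 0, which has two consequences. The sum of the y_i^2 y_j
      over i \<noteq> j is minus the sum of cubes, and the third elementary symmetric function is a
      third of it. This reduces four orbit values to a two-dimensional space.\<close>
    have ABCD: "A = f1 x" "B = - 3 * f1 x" "C = 6 * f2 x" "D = 2 * f1 x - 6 * f2 x"
      unfolding A_def B_def C_def D_def S_def f1_def f2_def Let_def
      by (simp_all add: numeral_7_wraps to_hyperplane_nth sum_7 y[symmetric]) Groebner_Basis.algebra+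
    have "343 * F x = (\<alpha> - 3 * \<beta> + 2 * \<delta>) * f1 x + 6 * (\<gamma> - \<delta>) * f2 x"
      unfolding trans[OF e1 trans[OF e2 trans[OF e3 e4]]] ABCD by (simp add: algebra_simps)
    then have "F x = ((\<alpha> - 3 * \<beta> + 2 * \<delta>) * f1 x + 6 * (\<gamma> - \<delta>) * f2 x) / 343"
      by (simp only: eq_divide_eq) (simp add: mult.commute)
    then show ?thesis by (simp add: pencil_def add_divide_distrib)
  qed
  then show ?thesis by blast
qed

lemma pencil_inj: "pencil a = pencil b \<Longrightarrow> a = b"
proof -
  assume eq: "pencil a = pencil b"
  have "pencil a (vector [1, -1, 0, 0, 0, 0] + vector [0, 0, 1, -1, 0, 0]) = pencil b (vector [1, -1, 0, 0, 0, 0] + vector [0, 0, 1, -1, 0, 0])"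
    "pencil a (vector [1, 1, 0, 0, 0, 0]) = pencil b (vector [1, 1, 0, 0, 0, 0])"
    "pencil a (vector [1, 1, 0, 1, 0, 0]) = pencil b (vector [1, 1, 0, 1, 0, 0])" using eq by simp_all
  then show "a = b"
    by (simp add: pencil_def f1_def f2_def Let_def sum_7 to_hyperplane_nth vec_eq_iff forall_2)
qed

lemma bij_pencil: "bij_betw pencil UNIV invariant_cubics"
  by (rule bij_betwI') (use pencil_inj pencil_invariant invariant_cubic_in_pencil in blast)+

section \<open>Nodes\<close>

lemma closed_proj_pt: "closed (proj_pt v)"
proof -
  have "subspace (proj_pt v)"
    unfolding subspace_def proj_pt_alt
  proof (intro conjI ballI allI)
    show "0 \<in> range (\<lambda>c. c *s v)" by (rule range_eqI[of _ _ 0]) simp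
    fix x assume "x \<in> range (\<lambda>c. c *s v)"
    then obtain c where c: "x = c *s v" by blast
    show "r *\<^sub>R x \<in> range (\<lambda>c. c *s v)" for r
      by (rule range_eqI[of _ _ "of_real r * c"]) (simp add: c vec_eq_iff, simp add: scaleR_conv_of_real)
    fix y assume "y \<in> range (\<lambda>c. c *s v)"
    then obtain d where "y = d *s v" by blast
    then have "x + y = (c + d) *s v" by (simp add: c vec_eq_iff ring_distribs)
    then show "x + y \<in> range (\<lambda>c. c *s v)" by blast
  qed
  then show ?thesis by (rule closed_subspace)
qed

text \<open>The union of the finitely many other lines is closed, and together with the origin it is
  the complement of the required neighbourhood.\<close>

lemma isolated_if_finite:
  assumes "finite (sing_locus F)" "L \<in> sing_locus F" shows "isolated_singularity F L"
  unfolding isolated_singularity_def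
proof (intro conjI exI)
  have pts: "\<exists>v. v \<noteq> 0 \<and> M = proj_pt v" if "M \<in> sing_locus F" for M
    using that by (auto simp: sing_locus_def)
  define U where "U = - (\<Union>(sing_locus F - {L}) \<union> {0})"
  have "closed (\<Union>(sing_locus F - {L}))"
    using assms(1) pts closed_proj_pt by (intro closed_Union) auto
  then show "open U" unfolding U_def by (intro open_Compl closed_Un closed_singleton)
  show "0 \<notin> U" by (simp add: U_def)
  obtain v where v: "v \<noteq> 0" "L = proj_pt v" using pts[OF assms(2)] by auto
  have "v \<notin> M" if M: "M \<in> sing_locus F - {L}" for M
  proof
    assume "v \<in> M"
    obtain w where w: "w \<noteq> 0" "M = proj_pt w" using pts[of M] M by blast
    with \<open>v \<in> M\<close> obtain c where "v = c *s w" by (auto simp: proj_pt_alt)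
    with v(1) have "c \<noteq> 0" by auto
    then have "proj_pt v = proj_pt w" using \<open>v = c *s w\<close> proj_pt_eq_iff[OF w(1)] by blast
    then show False using M v(2) w(2) by simp
  qed
  then have "v \<in> U" using v(1) by (auto simp: U_def)
  then show "L \<inter> U \<noteq> {}" using v(2) proj_pt_self by blast
  show "\<forall>M\<in>sing_locus F. M \<inter> U \<noteq> {} \<longrightarrow> M = L" by (auto simp: U_def)
qed (use assms in auto)

text \<open>The scalar is absorbed into the unit \<open>u\<close>.\<close>

lemma A1_germ_scale:
  fixes g :: "complex^'n \<Rightarrow> complex"
  assumes "A1_germ (\<lambda>z. k * g z)" "k \<noteq> 0" shows "A1_germ g"
proof -
  from assms(1) obtain U W u and \<phi> \<psi> :: "complex^'n \<Rightarrow> complex^'n" where *: "open U \<and> open W \<and> 0 \<in> U \<and> \<phi> 0 = 0 \<and>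
     homeomorphism U W \<phi> \<psi> \<and> holo_map_on U \<phi> \<and> holo_map_on W \<psi> \<and>
     holo_fun_on U u \<and> (\<forall>z\<in>U. u z \<noteq> 0) \<and> (\<forall>z\<in>U. k * g (\<phi> z) = u z * (\<Sum>i\<in>UNIV. (z $ i)\<^sup>2))"
    unfolding A1_germ_def by (elim exE) (erule that)
  have "g (\<phi> z) = (1 / k * u z) * (\<Sum>i\<in>UNIV. (z $ i)\<^sup>2)" if "z \<in> U" for z
  proof -
    have "k * g (\<phi> z) = u z * (\<Sum>i\<in>UNIV. (z $ i)\<^sup>2)" using * that by blast
    then show ?thesis using assms(2) by (simp add: field_simps)
  qed
  moreover have "holo_fun_on U u" using * by blast
  then have "holo_fun_on U (\<lambda>z. 1 / k * u z)" by (intro holo_fun_mult holo_fun_const)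
  moreover have "\<forall>z\<in>U. 1 / k * u z \<noteq> 0" using * assms(2) by simp
  ultimately have "open U \<and> open W \<and> 0 \<in> U \<and> \<phi> 0 = 0 \<and>
     homeomorphism U W \<phi> \<psi> \<and> holo_map_on U \<phi> \<and> holo_map_on W \<psi> \<and>
     holo_fun_on U (\<lambda>z. 1 / k * u z) \<and> (\<forall>z\<in>U. 1 / k * u z \<noteq> 0) \<and>
     (\<forall>z\<in>U. g (\<phi> z) = (1 / k * u z) * (\<Sum>i\<in>UNIV. (z $ i)\<^sup>2))"
    using * by simp
  then show ?thesis unfolding A1_germ_def by (intro exI)
qed

text \<open>A linear map carries the chart \<open>v + B *v z\<close> to the chart with
  \<open>A *v v\<close> and \<open>A ** B\<close>, in which the local equation changes by the factor
  \<open>k\<close> only.\<close>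

lemma A1_singularity_transport:
  assumes "invertible A" "k \<noteq> 0" and eq: "\<And>x. F (A *v x) = k * G x" and "A1_singularity G L"
  shows "A1_singularity F ((*v) A ` L)"
proof -
  from assms(4) obtain v and B :: "complex^5^6" where B: "L = proj_pt v"
    "\<forall>z c. B *v z + c *s v = 0 \<longrightarrow> z = 0 \<and> c = 0" "A1_germ (\<lambda>z. G (v + B *v z))"
    unfolding A1_singularity_def by blast
  have lin: "(A ** B) *v z + c *s (A *v v) = A *v (B *v z + c *s v)" "A *v v + (A ** B) *v z = A *v (v + B *v z)" for z c
    by (simp_all add: matrix_vector_mul_assoc[symmetric] matrix_vector_right_distrib vector_scalar_commute)
  have "A1_germ (\<lambda>z. F (A *v v + (A ** B) *v z))"
    unfolding lin eq by (rule A1_germ_scale[of "1 / k"]) (use assms(2) B(3) in simp_all)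
  moreover have "\<forall>z c. (A ** B) *v z + c *s (A *v v) = 0 \<longrightarrow> z = 0 \<and> c = 0"
    unfolding lin invertible_kernel[OF assms(1)] by (rule B(2))
  ultimately show ?thesis unfolding A1_singularity_def B(1) image_proj_pt by blast
qed

lemma sing_locus_transport:
  fixes A :: "complex^6^6"
  assumes "invertible A" "k \<noteq> 0" "\<And>x. F (A *v x) = k * G x" "holo_fun_on UNIV F" "holo_fun_on UNIV G"
  shows "sing_locus F = (\<lambda>L. (*v) A ` L) ` sing_locus G"
  using sing_locus_compose[OF assms(1,4)] by (simp add: assms(3) sing_locus_scale[OF assms(5,2)])

lemma inj_image_invertible:
  fixes A :: "complex^6^6"
  assumes "invertible A" shows "inj (\<lambda>L. (*v) A ` L)"
proof -
  have "inj ((*v) A)" using assms unfolding matrix_left_invertible_injective[symmetric] by (auto simp: invertible_def)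
  then show ?thesis by (simp add: inj_image_eq_iff inj_def)
qed

lemma nodes_transport:
  assumes "invertible A" "k \<noteq> 0" "\<And>x. F (A *v x) = k * G x" "holo_fun_on UNIV F" "holo_fun_on UNIV G"
    and "singular_exactly_in_nodes n G"
  shows "singular_exactly_in_nodes n F"
proof -
  note sl = sing_locus_transport[OF assms(1-5)]
  have "finite (sing_locus F)" "card (sing_locus F) = n"
    using assms(6) unfolding sl singular_exactly_in_nodes_def
    by (auto simp: card_image inj_on_subset[OF inj_image_invertible[OF assms(1)]])
  moreover have "node F L" if L: "L \<in> sing_locus F" for L
  proof -
    obtain M where "M \<in> sing_locus G" "L = (*v) A ` M" using L unfolding sl by blast
    then have "A1_singularity F L" using A1_singularity_transport[of A k F G, OF assms(1,2,3)] assms(6)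
      by (auto simp: singular_exactly_in_nodes_def node_def)
    then show ?thesis using isolated_if_finite[OF \<open>finite (sing_locus F)\<close> L] by (simp add: node_def)
  qed
  ultimately show ?thesis by (simp add: singular_exactly_in_nodes_def)
qed

text \<open>The last hypothesis says that the expansion at \<open>v\<close> has no constant and no
  linear term and that the columns of \<open>B\<close> diagonalize its quadratic part. Dividing the
  coordinates by square roots of the \<open>w i\<close> normalizes this part, and the cubic rest is
  of the shape treated by \<open>A1_germ_cubic\<close>.\<close>

lemma A1_singularity_criterion:
  fixes B :: "complex^5^6"
  assumes F: "F \<in> forms 3" and w: "\<And>i. w i \<noteq> 0"
    and ker: "\<And>z c. B *v z + c *s v = 0 \<Longrightarrow> z = 0 \<and> c = 0"
    and eq: "\<And>z. F (v + B *v z) = (\<Sum>i\<in>UNIV. w i * (z $ i)\<^sup>2) + F (B *v z)"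
  shows "A1_singularity F (proj_pt v)"
proof -
  define r where "r i = csqrt (w i)" for i
  have r: "r i \<noteq> 0" "r i ^ 2 = w i" for i using w by (simp_all add: r_def)
  define R :: "complex^5^5" where "R = (\<chi> i j. if i = j then 1 / r i else 0)"
  have R: "(R *v z) $ i = z $ i / r i" for z i
    by (simp add: R_def matrix_vector_mult_def if_distrib[of "\<lambda>c. c * _"] sum.delta cong: if_cong)
  have "(\<lambda>z. F ((B ** R) *v z)) \<in> forms 3" by (rule forms_compose_matrix[OF F])
  then obtain c where c: "\<And>z. F ((B ** R) *v z) = trilinear c z z z"
    "\<And>i j k. c i j k = c j i k" "\<And>i j k. c i j k = c i k j" using cubic_form_trilinear by blast
  have "F (v + (B ** R) *v z) = (\<Sum>i\<in>UNIV. (z $ i)\<^sup>2) +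
    (\<Sum>i\<in>UNIV. \<Sum>j\<in>UNIV. (\<Sum>k\<in>UNIV. c i j k * z $ k) * z $ i * z $ j)" for z
  proof -
    have "w i * ((R *v z) $ i)\<^sup>2 = (z $ i)\<^sup>2" for i using r[of i] w[of i] by (simp add: R power_divide)
    moreover have "trilinear c z z z = (\<Sum>i\<in>UNIV. \<Sum>j\<in>UNIV. (\<Sum>k\<in>UNIV. c i j k * z $ k) * z $ i * z $ j)"
      unfolding trilinear_def sum_distrib_right by (intro sum.cong refl) (simp add: mult_ac)
    ultimately show ?thesis using eq[of "R *v z"] c(1)[of z]
      by (simp only: matrix_vector_mul_assoc)
  qed
  then have "A1_germ (\<lambda>z. F (v + (B ** R) *v z))" using A1_germ_cubic[of c, OF c(2)] by simp
  moreover have "z = 0 \<and> d = 0" if "(B ** R) *v z + d *s v = 0" for z d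
  proof -
    have "R *v z = 0" "d = 0" using ker[of "R *v z" d] that by (simp_all add: matrix_vector_mul_assoc)
    moreover from this have "z $ i = 0" for i using R[of z i] r(1)[of i] by simp
    ultimately show ?thesis by (simp add: vec_eq_iff)
  qed
  ultimately show ?thesis unfolding A1_singularity_def by blast
qed

section \<open>Singular points of the pencil\<close>

lemma to_hyperplane_has_derivative:
  "((\<lambda>x. to_hyperplane x $ i) has_derivative (\<lambda>h. to_hyperplane h $ i)) (at x)"
  using exhaust_7[of i] by (elim disjE; simp only: to_hyperplane_nth)
    (auto intro!: derivative_eq_intros has_derivative_vec_nth)

lemma pencil_has_derivative:
  fixes x :: "complex^6" and a :: "complex^2"
  defines "y \<equiv> to_hyperplane x"
  shows "(pencil a has_derivative (\<lambda>h. \<Sum>i\<in>UNIV. (3 * a$1 * (y$i)\<^sup>2 + a$2 *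
     (vector [y$2 * y$4 + y$5 * y$6 + y$3 * y$7, y$1 * y$4 + y$3 * y$5 + y$6 * y$7,
      y$2 * y$5 + y$4 * y$6 + y$1 * y$7, y$1 * y$2 + y$3 * y$6 + y$5 * y$7, y$2 * y$3 + y$1 * y$6 + y$4 * y$7,
      y$3 * y$4 + y$1 * y$5 + y$2 * y$7, y$1 * y$3 + y$4 * y$5 + y$2 * y$6] :: complex^7) $ i)
      * to_hyperplane h $ i)) (at x)"
  unfolding pencil_def f1_def f2_def Let_def sum_7 vector_7 y_def
  by (auto intro!: derivative_eq_intros to_hyperplane_has_derivative simp: algebra_simps)

text \<open>Lagrange multipliers: on the hyperplane of coordinate sum 0 a point is critical if the
  seven partial derivatives share a common value \<open>m\<close>.\<close>

lemma pencil_singular_pointI: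
  assumes "v \<noteq> 0" and y: "y = to_hyperplane v"
    "3 * a$1 * (y$1)\<^sup>2 + a$2 * (y$2 * y$4 + y$5 * y$6 + y$3 * y$7) = m"
    "3 * a$1 * (y$2)\<^sup>2 + a$2 * (y$1 * y$4 + y$3 * y$5 + y$6 * y$7) = m"
    "3 * a$1 * (y$3)\<^sup>2 + a$2 * (y$2 * y$5 + y$4 * y$6 + y$1 * y$7) = m"
    "3 * a$1 * (y$4)\<^sup>2 + a$2 * (y$1 * y$2 + y$3 * y$6 + y$5 * y$7) = m"
    "3 * a$1 * (y$5)\<^sup>2 + a$2 * (y$2 * y$3 + y$1 * y$6 + y$4 * y$7) = m"
    "3 * a$1 * (y$6)\<^sup>2 + a$2 * (y$3 * y$4 + y$1 * y$5 + y$2 * y$7) = m"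
    "3 * a$1 * (y$7)\<^sup>2 + a$2 * (y$1 * y$3 + y$4 * y$5 + y$2 * y$6) = m"
  shows "proj_pt v \<in> sing_locus (pencil a)"
proof -
  define q :: "complex^7" where "q = vector [y$2 * y$4 + y$5 * y$6 + y$3 * y$7, y$1 * y$4 + y$3 * y$5 + y$6 * y$7,
      y$2 * y$5 + y$4 * y$6 + y$1 * y$7, y$1 * y$2 + y$3 * y$6 + y$5 * y$7, y$2 * y$3 + y$1 * y$6 + y$4 * y$7,
      y$3 * y$4 + y$1 * y$5 + y$2 * y$7, y$1 * y$3 + y$4 * y$5 + y$2 * y$6]"
  have m: "3 * a$1 * (y$i)\<^sup>2 + a$2 * q $ i = m" for i
    using exhaust_7[of i] y(2-) unfolding q_def by (elim disjE) simp_all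
  have "(pencil a has_derivative (\<lambda>h. \<Sum>i\<in>UNIV. (3 * a$1 * (y$i)\<^sup>2 + a$2 * q $ i) * to_hyperplane h $ i)) (at v)"
    unfolding q_def y(1) by (rule pencil_has_derivative)
  then have "(pencil a has_derivative (\<lambda>h. \<Sum>i\<in>UNIV. 0 $ i * h $ i)) (at v)"
    unfolding m sum_distrib_left[symmetric] sum_to_hyperplane by simp
  then have g: "grad (pencil a) v = 0" by (rule grad_eqI)
  have "3 * pencil a v = (\<Sum>i\<in>UNIV. (3 * a$1 * (y$i)\<^sup>2 + a$2 * q $ i) * y $ i)"
    unfolding q_def pencil_def f1_def f2_def Let_def sum_7 vector_7 y(1)
    by (simp add: power2_eq_square power3_eq_cube algebra_simps)
  also have "\<dots> = 0" unfolding m sum_distrib_left[symmetric] unfolding y(1) sum_to_hyperplane by simp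
  finally have "pencil a v = 0" by simp
  then show ?thesis using g assms(1) by (auto simp: sing_locus_def)
qed

lemma to_hyperplane_zero [simp]: "to_hyperplane 0 = 0"
  using to_hyperplane_linear(2)[of 0 0] by simp

lemma sing_locus_pencil_perm:
  assumes "\<sigma> \<in> L2_7" "proj_pt v \<in> sing_locus (pencil a)" shows "proj_pt (perm_rep \<sigma> v) \<in> sing_locus (pencil a)"
proof -
  have b: "bij \<sigma>" using assms(1) by (rule L2_7_bij)
  have "sing_locus (pencil a) = (\<lambda>L. (*v) (matrix (perm_rep \<sigma>)) ` L) ` sing_locus (pencil a)"
    by (rule sing_locus_transport[OF invertible_perm_rep[OF b], of 1])
       (simp_all add: matrix_perm_rep b pencil_perm_rep assms(1) holo_pencil)
  then have "(*v) (matrix (perm_rep \<sigma>)) ` proj_pt v \<in> sing_locus (pencil a)" using assms(2) by blast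
  then show ?thesis unfolding image_proj_pt matrix_perm_rep[OF b] .
qed

lemma A1_singularity_pencil_perm:
  assumes "\<sigma> \<in> L2_7" "A1_singularity (pencil a) (proj_pt v)"
  shows "A1_singularity (pencil a) (proj_pt (perm_rep \<sigma> v))"
proof -
  have b: "bij \<sigma>" using assms(1) by (rule L2_7_bij)
  have "A1_singularity (pencil a) ((*v) (matrix (perm_rep \<sigma>)) ` proj_pt v)"
    by (rule A1_singularity_transport[OF invertible_perm_rep[OF b], of 1 _ "pencil a"])
       (simp_all add: matrix_perm_rep b pencil_perm_rep assms)
  then show ?thesis unfolding image_proj_pt matrix_perm_rep[OF b] .
qed

lemma shift_induct_7: "P (7::7) \<Longrightarrow> (\<And>k. P k \<Longrightarrow> P (k + 1)) \<Longrightarrow> P k"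
proof -
  assume 7: "P (7::7)" and s: "\<And>k. P k \<Longrightarrow> P (k + 1)"
  have 1: "P 1" using s[OF 7] by (simp add: numeral_7_wraps)
  have 2: "P 2" using s[OF 1] by simp
  have 3: "P 3" using s[OF 2] by simp
  have 4: "P 4" using s[OF 3] by simp
  have 5: "P 5" using s[OF 4] by simp
  have 6: "P 6" using s[OF 5] by simp
  show "P k" using exhaust_7[of k] 1 2 3 4 5 6 7 by auto
qed

lemma basevec_nonzero: "basevec i \<noteq> 0"
proof
  assume "basevec i = 0"
  then have "to_hyperplane (basevec i) $ i = 0" by simp
  then show False by (simp add: to_hyperplane_basevec)
qed

lemma proj_basevec_inj: "inj (\<lambda>i. proj_pt (basevec i))"
proof (rule injI)
  fix i j assume "proj_pt (basevec i) = proj_pt (basevec j)"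
  then obtain c where c: "basevec i = c *s basevec j" using proj_pt_eq_iff[OF basevec_nonzero] by blast
  have *: "(if l = i then 6 else -1) = c * (if l = j then 6 else -1)" for l
    using arg_cong[OF c, of "\<lambda>v. to_hyperplane v $ l"] by (simp add: to_hyperplane_linear to_hyperplane_basevec)
  show "i = j"
  proof (rule ccontr)
    assume "i \<noteq> j"
    with *[of i] *[of j] have "6 = - c" "-1 = c * 6" by simp_all
    then have "c = - 6" by (metis minus_minus)
    with \<open>-1 = c * 6\<close> show False by simp
  qed
qed

lemma sing_basevec:
  assumes "a$2 = - 15 * a$1" shows "proj_pt (basevec i) \<in> sing_locus (pencil a)"
proof (rule shift_induct_7[of "\<lambda>i. proj_pt (basevec i) \<in> sing_locus (pencil a)"])
  show "proj_pt (basevec 7) \<in> sing_locus (pencil a)"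
    by (rule pencil_singular_pointI[OF basevec_nonzero to_hyperplane_basevec[symmetric], where m = "63 * a$1"])
       (simp_all add: assms)
  show "proj_pt (basevec (k + 1)) \<in> sing_locus (pencil a)" if "proj_pt (basevec k) \<in> sing_locus (pencil a)" for k
    using sing_locus_pencil_perm[OF L2_7_closed(3) that] by (simp add: perm_rep_basevec bij_generators)
qed

lemma A1_basevec:
  assumes "a$2 = - 15 * a$1" "a$1 \<noteq> 0" shows "A1_singularity (pencil a) (proj_pt (basevec i))"
proof (rule shift_induct_7[of "\<lambda>i. A1_singularity (pencil a) (proj_pt (basevec i))"])
  \<comment> \<open>The lines through the point 7 are {1, 3, 7}, {4, 5, 7}, {2, 6, 7}. The first
    three columns are differences of the two other points of a line, the last two are constant on
    these pairs. The Hessian at \<open>basevec 7\<close> is diagonal in them, with the entries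
    \<open>w\<close>.\<close>
  define B :: "complex^5^6" where "B = vector [vector [1, 0, 0, 1, 1], vector [0, 0, 1, -2, 0], vector [-1, 0, 0, 1, 1],
    vector [0, 1, 0, 1, -1], vector [0, -1, 0, 1, -1], vector [0, 0, -1, -2, 0]]"
  define w :: "5 \<Rightarrow> complex" where "w i = a$1 * (if i = 4 then -756 else if i = 5 then -252 else 84)" for i
  define b where "b = a$1"
  show "A1_singularity (pencil a) (proj_pt (basevec 7))"
  proof (rule A1_singularity_criterion[OF pencil_in_forms, of w B])
    show "w i \<noteq> 0" for i using assms(2) by (simp add: w_def)
    show "z = 0 \<and> c = 0" if "B *v z + c *s basevec 7 = 0" for z :: "complex^5" and c
    proof -
      define z1 z2 z3 z4 z5 where z: "z1 = z$1" "z2 = z$2" "z3 = z$3" "z4 = z$4" "z5 = z$5"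
      have e: "z1 + z4 + z5 - c = 0" "z3 - 2 * z4 - c = 0" "- z1 + z4 + z5 - c = 0" "z2 + z4 - z5 - c = 0"
        "- z2 + z4 - z5 - c = 0" "- z3 - 2 * z4 - c = 0"
        using that by (simp_all add: vec6_eq_iff matrix_vector_mult_def sum_5 B_def basevec_def first_coords_nth z)
      have "2 * z1 = 0" "2 * z2 = 0" "2 * z3 = 0" "6 * z4 = 0" "2 * z5 = 0" "3 * c = 0" using e by Groebner_Basis.algebra+
      then show ?thesis using z by (simp add: vec_eq_iff forall_5)
    qed
    fix z :: "complex^5"
    define z1 z2 z3 z4 z5 where z: "z1 = z$1" "z2 = z$2" "z3 = z$3" "z4 = z$4" "z5 = z$5"
    show "pencil a (basevec 7 + B *v z) = (\<Sum>i\<in>UNIV. w i * (z $ i)\<^sup>2) + pencil a (B *v z)"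
      unfolding pencil_def f1_def f2_def Let_def sum_7 to_hyperplane_nth assms(1) w_def sum_5
      by (simp add: matrix_vector_mult_def sum_5 B_def basevec_def first_coords_nth z[symmetric] b_def[symmetric]) Groebner_Basis.algebra
  qed
  show "A1_singularity (pencil a) (proj_pt (basevec (k + 1)))" if "A1_singularity (pencil a) (proj_pt (basevec k))" for k
    using A1_singularity_pencil_perm[OF L2_7_closed(3) that] by (simp add: perm_rep_basevec bij_generators)
qed

text \<open>A line of the Fano plane with the three cube roots of unity at its points.\<close>

definition linevec :: "complex \<Rightarrow> 7 \<Rightarrow> complex^6" where
  "linevec e k = first_coords (\<chi> j. if j = k + 1 then 1 else if j = k + 2 then e else if j = k + 4 then e\<^sup>2 else 0)"

lemma to_hyperplane_linevec:
  assumes "e\<^sup>2 + e + 1 = 0"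
  shows "to_hyperplane (linevec e k) = (\<chi> j. if j = k + 1 then 1 else if j = k + 2 then e else if j = k + 4 then e\<^sup>2 else 0)"
  unfolding linevec_def
  by (rule to_hyperplane_first_coords) (use exhaust_7[of k] assms in \<open>auto simp: sum_7 numeral_7_wraps algebra_simps\<close>)

lemma linevec_nonzero: assumes "e\<^sup>2 + e + 1 = 0" shows "linevec e k \<noteq> 0"
proof
  assume "linevec e k = 0"
  then have "to_hyperplane (linevec e k) $ (k + 1) = 0" by simp
  then show False by (simp add: to_hyperplane_linevec[OF assms])
qed

lemma perm_rep_shift_linevec:
  assumes "e\<^sup>2 + e + 1 = 0" shows "perm_rep shift7 (linevec e k) = linevec e (k + 1)"
  unfolding to_hyperplane_inject[symmetric] to_hyperplane_perm_rep[OF bij_generators(2)] to_hyperplane_linevec[OF assms]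
  by (simp add: vec_eq_iff algebra_simps)

text \<open>The support is a translate of {1, 2, 4}, which no nonzero translation modulo 7
  preserves, so it determines \<open>k\<close>. The first entry then fixes the scalar and the second
  one \<open>e\<close>.\<close>

lemma proj_linevec_inj:
  assumes "e\<^sup>2 + e + 1 = 0" "e'\<^sup>2 + e' + 1 = 0" "proj_pt (linevec e k) = proj_pt (linevec e' k')"
  shows "e = e' \<and> k = k'"
proof -
  obtain c where c: "c \<noteq> 0" "linevec e k = c *s linevec e' k'"
    using assms(3) proj_pt_eq_iff[OF linevec_nonzero[OF assms(2)]] by blast
  have nz: "e \<noteq> 0" "e' \<noteq> 0" using assms by auto
  have *: "(if l = k + 1 then 1 else if l = k + 2 then e else if l = k + 4 then e\<^sup>2 else 0)
      = c * (if l = k' + 1 then 1 else if l = k' + 2 then e' else if l = k' + 4 then e'\<^sup>2 else 0)" for l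
    using arg_cong[OF c(2), of "\<lambda>v. to_hyperplane v $ l"]
    by (simp add: to_hyperplane_linear to_hyperplane_linevec[OF assms(1)] to_hyperplane_linevec[OF assms(2)])
  have supp: "k + d - k' \<in> {1, 2, 4}" if "d \<in> {1, 2, 4}" for d
  proof (rule ccontr)
    assume "k + d - k' \<notin> {1, 2, 4}"
    then have "k + d \<noteq> k' + 1" "k + d \<noteq> k' + 2" "k + d \<noteq> k' + 4" by (auto simp: algebra_simps)
    with *[of "k + d"] that nz show False by auto
  qed
  have "k - k' = 7"
  proof -
    define m where "m = k - k'"
    have "k + d - k' = m + d" for d by (simp add: m_def)
    then have "m + 1 \<in> {1, 2, 4}" "m + 2 \<in> {1, 2, 4}" "m + 4 \<in> {1, 2, 4}"
      using supp[of 1] supp[of 2] supp[of 4] by (simp_all only: insert_iff simp_thms)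
    then have "m = 7" using exhaust_7[of m] by (elim disjE) (simp_all add: numeral_7_wraps)
    then show ?thesis by (simp add: m_def)
  qed
  then have k: "k = k'" by (simp add: diff_eq_eq)
  have "c = 1" using *[of "k + 1"] k by simp
  then have "e = e'" using *[of "k + 2"] k by simp
  with k show ?thesis by simp
qed

lemma sing_linevec:
  assumes "e\<^sup>2 + e + 1 = 0" "a$2 = - 3 * a$1" shows "proj_pt (linevec e i) \<in> sing_locus (pencil a)"
proof (rule shift_induct_7[of "\<lambda>i. proj_pt (linevec e i) \<in> sing_locus (pencil a)"])
  have "e ^ 4 - e = 0" "e * e\<^sup>2 - 1 = 0" using assms(1) by Groebner_Basis.algebra+
  then have e: "e ^ 4 = e" "e * e\<^sup>2 = 1" "e\<^sup>2 * e = 1" by (simp_all add: mult.commute)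
  show "proj_pt (linevec e 7) \<in> sing_locus (pencil a)"
    by (rule pencil_singular_pointI[OF linevec_nonzero[OF assms(1)] to_hyperplane_linevec[OF assms(1), symmetric], where m = 0])
       (simp_all add: assms(2) numeral_7_wraps e)
  show "proj_pt (linevec e (k + 1)) \<in> sing_locus (pencil a)" if "proj_pt (linevec e k) \<in> sing_locus (pencil a)" for k
    using sing_locus_pencil_perm[OF L2_7_closed(3) that] by (simp add: perm_rep_shift_linevec[OF assms(1)])
qed

lemma A1_linevec:
  assumes e: "e\<^sup>2 + e + 1 = 0" and "a$2 = - 3 * a$1" "a$1 \<noteq> 0" shows "A1_singularity (pencil a) (proj_pt (linevec e i))"
proof (rule shift_induct_7[of "\<lambda>i. A1_singularity (pencil a) (proj_pt (linevec e i))"])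
  \<comment> \<open>For k = 7 the line is {1, 2, 4}. The first three columns are the balanced sign
    vectors on its complement {3, 5, 6, 7}, up to sign. The last two are constant on the complement
    and, together with \<open>linevec e 7\<close>, span the remaining directions. The Hessian is
    diagonal in these columns, with the entries \<open>w\<close>.\<close>
  define B :: "complex^5^6" where "B = vector [vector [0, 0, 0, 8, 0], vector [0, 0, 0, - 4 * e, 8 + 4 * e],
    vector [1, 1, 1, -3, -3], vector [0, 0, 0, 4 + 4 * e, 4 - 4 * e], vector [-1, 1, -1, -3, -3], vector [-1, -1, 1, -3, -3]]"
  define w :: "5 \<Rightarrow> complex" where "w i = a$1 * (if i = 1 then -12 else if i = 2 then - 12 * e else if i = 3 then - 12 * e\<^sup>2
     else if i = 4 then 432 else -432)" for i
  define b where "b = a$1"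
  have nz: "e \<noteq> 0" "e \<noteq> 1" "e \<noteq> -1" using e by auto
  show "A1_singularity (pencil a) (proj_pt (linevec e 7))"
  proof (rule A1_singularity_criterion[OF pencil_in_forms, of w B])
    show "w i \<noteq> 0" for i using assms(3) nz by (simp add: w_def)
    show "z = 0 \<and> c = 0" if "B *v z + c *s linevec e 7 = 0" for z :: "complex^5" and c
    proof -
      define z1 z2 z3 z4 z5 where z: "z1 = z$1" "z2 = z$2" "z3 = z$3" "z4 = z$4" "z5 = z$5"
      have E: "8 * z4 + c = 0" "- (4 * e * z4) + (8 + 4 * e) * z5 + c * e = 0" "z1 + z2 + z3 - 3 * z4 - 3 * z5 = 0"
        "(4 + 4 * e) * z4 + (4 - 4 * e) * z5 + c * e\<^sup>2 = 0" "- z1 + z2 - z3 - 3 * z4 - 3 * z5 = 0"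
        "- z1 - z2 + z3 - 3 * z4 - 3 * z5 = 0"
        using that by (simp_all add: vec6_eq_iff matrix_vector_mult_def sum_5 B_def linevec_def first_coords_nth
            numeral_7_wraps z)
      have "36 * z4 = 0" "36 * z5 = 0" using E(1,2,4) e by Groebner_Basis.algebra+
      then have z45: "z4 = 0" "z5 = 0" by simp_all
      have "2 * z2 = 0" "2 * z1 = 0" "2 * z3 = 0" using E(3,5,6) unfolding z45 by Groebner_Basis.algebra+
      then show ?thesis using z45 E(1) z by (simp add: vec_eq_iff forall_5)
    qed
    fix z :: "complex^5"
    define z1 z2 z3 z4 z5 where z: "z1 = z$1" "z2 = z$2" "z3 = z$3" "z4 = z$4" "z5 = z$5"
    have Bz: "(B *v z) $ 1 = 8 * z4" "(B *v z) $ 2 = (8 + 4 * e) * z5 - 4 * e * z4" "(B *v z) $ 3 = z1 + z2 + z3 - 3 * z4 - 3 * z5"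
      "(B *v z) $ 4 = (4 + 4 * e) * z4 + (4 - 4 * e) * z5" "(B *v z) $ 5 = z2 - z1 - z3 - 3 * z4 - 3 * z5"
      "(B *v z) $ 6 = z3 - z1 - z2 - 3 * z4 - 3 * z5"
      by (simp_all add: matrix_vector_mult_def sum_5 B_def z)
    have l: "linevec e 7 $ 1 = 1" "linevec e 7 $ 2 = e" "linevec e 7 $ 3 = 0" "linevec e 7 $ 4 = e\<^sup>2"
      "linevec e 7 $ 5 = 0" "linevec e 7 $ 6 = 0"
      by (simp_all add: linevec_def first_coords_nth numeral_7_wraps)
    have w: "w 1 = - 12 * b" "w 2 = - 12 * e * b" "w 3 = - 12 * e\<^sup>2 * b" "w 4 = 432 * b" "w 5 = - 432 * b"
      by (simp_all add: w_def b_def)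
    show "pencil a (linevec e 7 + B *v z) = (\<Sum>i\<in>UNIV. w i * (z $ i)\<^sup>2) + pencil a (B *v z)"
      unfolding pencil_def f1_def f2_def Let_def sum_7 to_hyperplane_nth assms(2) sum_5 w vector_add_component Bz l
        z[symmetric] b_def[symmetric]
      using e by Groebner_Basis.algebra
  qed
  show "A1_singularity (pencil a) (proj_pt (linevec e (k + 1)))" if "A1_singularity (pencil a) (proj_pt (linevec e k))" for k
    using A1_singularity_pencil_perm[OF L2_7_closed(3) that] by (simp add: perm_rep_shift_linevec[OF e])
qed

text \<open>The coordinate u3 is nonzero and scaled to 1; all others are then monomials in
  \<open>\<alpha>\<close>, \<open>\<epsilon>\<close> and \<open>g\<close> = u6 / u3. As
  \<open>g\<close> is a seventh root of a given number, each pair (\<open>\<alpha>\<close>,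
  \<open>\<epsilon>\<close>) contributes at most seven points.\<close>

lemma pencil_singular_points:
  fixes a :: "complex^2"
  defines "s \<equiv> 3 * a$1 - (1 + eta) * a$2" and "t \<equiv> 3 * a$1 + eta * a$2"
  assumes "s \<noteq> 0" "t \<noteq> 0" "L \<in> sing_locus (pencil a)"
  shows "\<exists>\<alpha> \<epsilon> g. \<epsilon>^3 = 1 \<and> ((eta + 2) * s - eta * t) * \<alpha>^2 + 2 * t * \<epsilon> * \<alpha> + s = 0
    \<and> (eta + 1) * s + (1 - eta) * t + t * \<epsilon> * \<alpha>^2 + 2 * s * \<alpha> = 0 \<and> g ^ 7 = \<epsilon>\<^sup>2
    \<and> L = proj_pt (fourier *v vector [\<alpha> * \<epsilon> * g^4, \<alpha> * \<epsilon> * g^2, 1, \<alpha> * g^5, \<epsilon> * g^3, g])"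
proof -
  have "L \<in> (\<lambda>L. (*v) fourier ` L) ` sing_locus (klein s t)"
    using assms(5) unfolding sing_locus_pencil s_def t_def .
  then obtain u where u: "u \<noteq> 0" "klein_grad s t u = 0" "L = proj_pt (fourier *v u)"
    unfolding sing_locus_klein by (auto simp: image_proj_pt)
  have nz: "\<not> (u$1 = 0 \<and> u$2 = 0 \<and> u$4 = 0 \<and> u$3 = 0 \<and> u$6 = 0 \<and> u$5 = 0)"
    using u(1) by (auto simp: vec6_eq_iff)
  have E: "((eta + 2) * s - eta * t) * (u$2 * u$4) + s * (u$3)\<^sup>2 + 2 * t * (u$1 * u$5) = 0"
     "((eta + 2) * s - eta * t) * (u$1 * u$4) + s * (u$6)\<^sup>2 + 2 * t * (u$2 * u$3) = 0"
     "((eta + 1) * s + (1 - eta) * t) * (u$5 * u$6) + 2 * s * (u$1 * u$3) + t * (u$2)\<^sup>2 = 0"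
     "((eta + 2) * s - eta * t) * (u$1 * u$2) + s * (u$5)\<^sup>2 + 2 * t * (u$4 * u$6) = 0"
     "((eta + 1) * s + (1 - eta) * t) * (u$3 * u$6) + 2 * s * (u$4 * u$5) + t * (u$1)\<^sup>2 = 0"
     "((eta + 1) * s + (1 - eta) * t) * (u$3 * u$5) + 2 * s * (u$2 * u$6) + t * (u$4)\<^sup>2 = 0"
    using u(2) unfolding klein_grad_def vec6_eq_iff vector_6 by simp_all
  from klein_critical[OF assms(3,4) nz E] obtain \<alpha> \<epsilon> where
    ae: "\<epsilon>^3 = 1" "((eta + 2) * s - eta * t) * \<alpha>^2 + 2 * t * \<epsilon> * \<alpha> + s = 0"
      "(eta + 1) * s + (1 - eta) * t + t * \<epsilon> * \<alpha>^2 + 2 * s * \<alpha> = 0"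
    and uu: "u$3 \<noteq> 0" "u$6 \<noteq> 0" "u$5 \<noteq> 0" "u$1 * u$3 = \<alpha> * u$6 * u$5" "u$2 * u$6 = \<alpha> * u$3 * u$5"
      "u$4 * u$5 = \<alpha> * u$3 * u$6" "u$6 * (u$5)^2 = \<epsilon> * (u$3)^3" "(u$3)^2 * u$5 = \<epsilon> * (u$6)^3"
    by blast
  define f where "f = u$3"
  define g where "g = u$6 / f"
  have f: "f \<noteq> 0" "u$3 = f" "u$6 = f * g" using uu(1) by (auto simp: f_def g_def)
  have g0: "g \<noteq> 0" using uu(2) f by simp
  have "\<epsilon> \<noteq> 0" using ae(1) by auto
  have h: "u$5 = f * (\<epsilon> * g^3)" using uu(8) f by (simp add: power2_eq_square power3_eq_cube)
  have "f^3 * (\<epsilon> * (\<epsilon> * g^7)) = f^3 * \<epsilon>" using uu(7) unfolding f(2,3) h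
    by (simp add: power_mult_distrib power_mult[symmetric] algebra_simps numeral_eq_Suc)
  then have "\<epsilon> * g^7 = 1" using f(1) \<open>\<epsilon> \<noteq> 0\<close> by simp
  \<comment> \<open>From \<epsilon> g^7 = 1 and \<epsilon>^3 = 1 the seventh power of g is the
    inverse of \<epsilon>, which is its square.\<close>
  then have "\<epsilon>^3 * g^7 = \<epsilon>^2" by (simp add: power2_eq_square power3_eq_cube mult.assoc)
  then have g: "g^7 = \<epsilon>^2" using ae(1) by simp
  have a: "u$1 = f * (\<alpha> * \<epsilon> * g^4)"
  proof -
    have "f * u$1 = f * (f * (\<alpha> * \<epsilon> * g^4))" using uu(4) unfolding f(2,3) h
      by (simp add: numeral_eq_Suc algebra_simps)
    then show ?thesis using f(1) by simp
  qed
  have b: "u$2 = f * (\<alpha> * \<epsilon> * g^2)"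
  proof -
    have "(f * g) * u$2 = (f * g) * (f * (\<alpha> * \<epsilon> * g^2))" using uu(5) unfolding f(2,3) h
      by (simp add: numeral_eq_Suc algebra_simps)
    then show ?thesis using f(1) g0 by simp
  qed
  have c: "u$4 = f * (\<alpha> * g^5)"
  proof -
    have u6: "(f * (\<epsilon> * g^3)) * u$4 = \<alpha> * f * (f * g)" using uu(6) unfolding f(2,3) h
      by (simp only: mult.commute[of "u$4"])
    have "(f * (\<epsilon> * g^3)) * (f * (\<alpha> * g^5)) = \<alpha> * f * (f * g) * (\<epsilon> * g^7)"
      by (simp add: numeral_eq_Suc algebra_simps)
    also have "\<dots> = (f * (\<epsilon> * g^3)) * u$4" unfolding u6 \<open>\<epsilon> * g^7 = 1\<close> by simp
    finally show ?thesis using f(1) g0 \<open>\<epsilon> \<noteq> 0\<close> by simp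
  qed
  have "u = f *s vector [\<alpha> * \<epsilon> * g^4, \<alpha> * \<epsilon> * g^2, 1, \<alpha> * g^5, \<epsilon> * g^3, g]"
    by (simp add: vec6_eq_iff a b c f h)
  then have "fourier *v u = f *s (fourier *v vector [\<alpha> * \<epsilon> * g^4, \<alpha> * \<epsilon> * g^2, 1, \<alpha> * g^5, \<epsilon> * g^3, g])"
    by (simp add: vector_scalar_commute)
  moreover have "fourier *v vector [\<alpha> * \<epsilon> * g^4, \<alpha> * \<epsilon> * g^2, 1, \<alpha> * g^5, \<epsilon> * g^3, g] \<noteq> 0"
    unfolding invertible_kernel[OF invertible_fourier] by (simp add: vec6_eq_iff)
  ultimately have "L = proj_pt (fourier *v vector [\<alpha> * \<epsilon> * g^4, \<alpha> * \<epsilon> * g^2, 1, \<alpha> * g^5, \<epsilon> * g^3, g])"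
    unfolding u(3) using proj_pt_eq_iff f(1) by blast
  then show ?thesis using ae g by blast
qed

text \<open>The norm of \<open>3 * a1 + eta * a2\<close> from the quadratic field, as -1 - eta is
  the conjugate of eta. It vanishes exactly on the determinantal members and has coefficients free
  of \<open>eta\<close>.\<close>

lemma klein_parameters_product: "(3 * a1 - (1 + eta) * a2) * (3 * a1 + eta * a2) = 9 * a1\<^sup>2 - 3 * a1 * a2 + 2 * a2\<^sup>2"
  using eta_eq by Groebner_Basis.algebra

section \<open>Singular loci of the nodal members\<close>

lemma pencil_singular_cases:
  assumes "sing_locus (pencil a) \<noteq> {}"
  shows "3 * a$1 - (1 + eta) * a$2 = 0 \<or> 3 * a$1 + eta * a$2 = 0 \<or> a$2 = - 15 * a$1 \<or> 10 * a$2 = - 3 * a$1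
    \<or> a$2 = - 3 * a$1 \<or> 2 * a$2 = - 3 * a$1"
proof (cases "3 * a$1 - (1 + eta) * a$2 = 0 \<or> 3 * a$1 + eta * a$2 = 0")
  case False
  obtain L where "L \<in> sing_locus (pencil a)" using assms by blast
  with False show ?thesis using pencil_singular_points[of a L] klein_parameters[OF refl refl] by blast
qed auto

text \<open>The solutions in Fourier coordinates serve only as an upper bound of seven. The seven
  distinct points \<open>proj_pt (basevec i)\<close> are singular, so equality follows by counting,
  without matching the two descriptions.\<close>

lemma sing_locus_7:
  assumes "a$2 = - 15 * a$1" "a$1 \<noteq> 0"
  shows "sing_locus (pencil a) = range (\<lambda>i. proj_pt (basevec i))"
proof -
  define X where "X = (\<lambda>g. proj_pt (fourier *v vector [1 * 1 * g^4, 1 * 1 * g^2, 1, 1 * g^5, 1 * g^3, g])) ` {g::complex. g^7 = 1}"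
  \<comment> \<open>A nonzero value of the product shows that neither \<open>s\<close> nor
    \<open>t\<close> vanishes, as the explicit solution requires.\<close>
  have "(3 * a$1 - (1 + eta) * a$2) * (3 * a$1 + eta * a$2) = 504 * (a$1)\<^sup>2"
    unfolding klein_parameters_product assms(1) by (simp add: power2_eq_square)
  then have st: "3 * a$1 - (1 + eta) * a$2 \<noteq> 0" "3 * a$1 + eta * a$2 \<noteq> 0" using assms(2) by auto
  have sub: "sing_locus (pencil a) \<subseteq> X"
  proof
    fix L assume "L \<in> sing_locus (pencil a)"
    from pencil_singular_points[OF st this] obtain \<alpha> \<epsilon> g where *: "\<epsilon>^3 = 1"
      "((eta + 2) * (3 * a$1 - (1 + eta) * a$2) - eta * (3 * a$1 + eta * a$2)) * \<alpha>^2 + 2 * (3 * a$1 + eta * a$2) * \<epsilon> * \<alpha> + (3 * a$1 - (1 + eta) * a$2) = 0"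
      "(eta + 1) * (3 * a$1 - (1 + eta) * a$2) + (1 - eta) * (3 * a$1 + eta * a$2) + (3 * a$1 + eta * a$2) * \<epsilon> * \<alpha>^2 + 2 * (3 * a$1 - (1 + eta) * a$2) * \<alpha> = 0"
      "g ^ 7 = \<epsilon>\<^sup>2" "L = proj_pt (fourier *v vector [\<alpha> * \<epsilon> * g^4, \<alpha> * \<epsilon> * g^2, 1, \<alpha> * g^5, \<epsilon> * g^3, g])"
      by blast
    have "\<epsilon> = 1 \<and> \<alpha> = 1" using klein_parameters[OF refl refl st *(1-3)] assms by auto
    then show "L \<in> X" using *(4,5) by (auto simp: X_def)
  qed
  have c7: "card {g::complex. g^7 = 1} = 7" by (rule card_nth_roots) auto
  then have f7: "finite {g::complex. g^7 = 1}" by (intro card_ge_0_finite) simp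
  have X: "finite X" unfolding X_def by (rule finite_imageI[OF f7])
  have cX: "card X \<le> 7"
    unfolding X_def by (rule order_trans[OF card_image_le[OF f7]]) (simp only: c7 order_refl)
  have fin: "finite (sing_locus (pencil a))" "card (sing_locus (pencil a)) \<le> 7"
    by (rule finite_subset[OF sub X], rule order_trans[OF card_mono[OF X sub] cX])
  have "card (range (\<lambda>i. proj_pt (basevec i))) = 7"
    using card_image[OF proj_basevec_inj] by simp
  then have "range (\<lambda>i. proj_pt (basevec i)) = sing_locus (pencil a)"
    using fin sing_basevec[OF assms(1)] by (intro card_seteq) auto
  then show ?thesis ..
qed

lemma nodes_7:
  assumes "a$2 = - 15 * a$1" "a$1 \<noteq> 0" shows "singular_exactly_in_nodes 7 (pencil a)"
proof -
  note sl = sing_locus_7[OF assms]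
  have fin: "finite (sing_locus (pencil a))" unfolding sl by simp
  have "card (sing_locus (pencil a)) = 7" unfolding sl using card_image[OF proj_basevec_inj] by simp
  moreover have "node (pencil a) L" if "L \<in> sing_locus (pencil a)" for L
    unfolding node_def using isolated_if_finite[OF fin that] A1_basevec[OF assms] that sl by auto
  ultimately show ?thesis using fin by (simp add: singular_exactly_in_nodes_def)
qed

lemma cube_roots_card: "card {e::complex. e\<^sup>2 + e + 1 = 0} = 2"
proof -
  have "{e::complex. e^3 = 1} = insert 1 {e. e\<^sup>2 + e + 1 = 0}"
  proof -
    have "e ^ 3 = 1 \<longleftrightarrow> e = 1 \<or> e\<^sup>2 + e + 1 = 0" for e :: complex
    proof -
      have "e ^ 3 - 1 = (e - 1) * (e\<^sup>2 + e + 1)" by (simp add: power2_eq_square power3_eq_cube algebra_simps)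
      then show ?thesis by (metis eq_iff_diff_eq_0 mult_eq_0_iff)
    qed
    then show ?thesis by auto
  qed
  moreover have c3: "card {e::complex. e^3 = 1} = 3" by (rule card_nth_roots) auto
  moreover have "finite {e::complex. e^3 = 1}" using c3 by (intro card_ge_0_finite) simp
  moreover have "(1::complex) \<notin> {e. e\<^sup>2 + e + 1 = 0}" by simp
  ultimately have "Suc (card {e::complex. e\<^sup>2 + e + 1 = 0}) = 3"
    using card_insert_disjoint[of "{e::complex. e\<^sup>2 + e + 1 = 0}" 1] by simp
  then show ?thesis by simp
qed

text \<open>Counting again: two primitive cube roots of unity with seven values of g each bound the
  locus from above, and the two choices of \<open>e\<close> on each of the seven lines fill
  it.\<close>

lemma sing_locus_14:
  assumes "a$2 = - 3 * a$1" "a$1 \<noteq> 0"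
  shows "sing_locus (pencil a) = (\<lambda>(e, k). proj_pt (linevec e k)) ` ({e. e\<^sup>2 + e + 1 = 0} \<times> UNIV)"
    and "card (sing_locus (pencil a)) = 14"
proof -
  define E where "E = {e::complex. e\<^sup>2 + e + 1 = 0}"
  have E: "card E = 2" "finite E" using cube_roots_card unfolding E_def
    by (auto intro: card_ge_0_finite)
  define X where "X = (\<Union>e\<in>E. (\<lambda>g. proj_pt (fourier *v vector [(eta + e + eta * e) * e * g^4, (eta + e + eta * e) * e * g^2, 1,
     (eta + e + eta * e) * g^5, e * g^3, g])) ` {g::complex. g^7 = e\<^sup>2})"
  have "(3 * a$1 - (1 + eta) * a$2) * (3 * a$1 + eta * a$2) = 36 * (a$1)\<^sup>2"
    unfolding klein_parameters_product assms(1) by (simp add: power2_eq_square)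
  then have st: "3 * a$1 - (1 + eta) * a$2 \<noteq> 0" "3 * a$1 + eta * a$2 \<noteq> 0" using assms(2) by auto
  have sub: "sing_locus (pencil a) \<subseteq> X"
  proof
    fix L assume "L \<in> sing_locus (pencil a)"
    from pencil_singular_points[OF st this] obtain \<alpha> \<epsilon> g where *: "\<epsilon>^3 = 1"
      "((eta + 2) * (3 * a$1 - (1 + eta) * a$2) - eta * (3 * a$1 + eta * a$2)) * \<alpha>^2 + 2 * (3 * a$1 + eta * a$2) * \<epsilon> * \<alpha> + (3 * a$1 - (1 + eta) * a$2) = 0"
      "(eta + 1) * (3 * a$1 - (1 + eta) * a$2) + (1 - eta) * (3 * a$1 + eta * a$2) + (3 * a$1 + eta * a$2) * \<epsilon> * \<alpha>^2 + 2 * (3 * a$1 - (1 + eta) * a$2) * \<alpha> = 0"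
      "g ^ 7 = \<epsilon>\<^sup>2" "L = proj_pt (fourier *v vector [\<alpha> * \<epsilon> * g^4, \<alpha> * \<epsilon> * g^2, 1, \<alpha> * g^5, \<epsilon> * g^3, g])"
      by blast
    have "\<epsilon>^2 + \<epsilon> + 1 = 0 \<and> \<alpha> = eta + \<epsilon> + eta * \<epsilon>" using klein_parameters[OF refl refl st *(1-3)] assms by auto
    then show "L \<in> X" using *(4,5) by (auto simp: X_def E_def)
  qed
  have X: "finite X \<and> card X \<le> 14"
  proof -
    have nz: "e \<noteq> 0" if "e \<in> E" for e using that by (auto simp: E_def)
    have c7: "card {g::complex. g^7 = e\<^sup>2} = 7" if "e \<in> E" for e
      using nz[OF that] by (intro card_nth_roots) auto
    then have f7: "finite {g::complex. g^7 = e\<^sup>2}" if "e \<in> E" for e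
      using c7[OF that] by (intro card_ge_0_finite) simp
    have "card X \<le> (\<Sum>e\<in>E. card ((\<lambda>g. proj_pt (fourier *v vector [(eta + e + eta * e) * e * g^4, (eta + e + eta * e) * e * g^2, 1,
     (eta + e + eta * e) * g^5, e * g^3, g])) ` {g::complex. g^7 = e\<^sup>2}))"
      unfolding X_def by (rule card_UN_le[OF E(2)])
    also have "\<dots> \<le> (\<Sum>e\<in>E. 7)"
    proof (rule sum_mono)
      fix e assume e: "e \<in> E"
      show "card ((\<lambda>g. proj_pt (fourier *v vector [(eta + e + eta * e) * e * g^4, (eta + e + eta * e) * e * g^2, 1,
     (eta + e + eta * e) * g^5, e * g^3, g])) ` {g::complex. g^7 = e\<^sup>2}) \<le> 7"
        by (rule order_trans[OF card_image_le[OF f7[OF e]]]) (simp only: c7[OF e] order_refl)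
    qed
    finally have "card X \<le> 14" using E(1) by simp
    moreover have "finite X" unfolding X_def using E(2) f7 by auto
    ultimately show ?thesis by simp
  qed
  have fin: "finite (sing_locus (pencil a))" "card (sing_locus (pencil a)) \<le> 14"
    by (rule finite_subset[OF sub conjunct1[OF X]],
        rule order_trans[OF card_mono[OF conjunct1[OF X] sub] conjunct2[OF X]])
  have inj: "inj_on (\<lambda>(e, k). proj_pt (linevec e k)) (E \<times> UNIV)"
  proof (rule inj_onI)
    fix p q :: "complex \<times> 7"
    assume "p \<in> E \<times> UNIV" "q \<in> E \<times> UNIV"
    then have "(fst p)\<^sup>2 + fst p + 1 = 0" "(fst q)\<^sup>2 + fst q + 1 = 0" by (simp_all only: E_def mem_Times_iff mem_Collect_eq)
    moreover assume "(case p of (e, k) \<Rightarrow> proj_pt (linevec e k)) = (case q of (e, k) \<Rightarrow> proj_pt (linevec e k))"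
    ultimately show "p = q" using proj_linevec_inj unfolding case_prod_unfold prod_eq_iff by blast
  qed
  have c: "card ((\<lambda>(e, k). proj_pt (linevec e k)) ` (E \<times> UNIV)) = 14"
    using card_image[OF inj] E by (simp add: card_cartesian_product)
  have "(\<lambda>(e, k). proj_pt (linevec e k)) ` (E \<times> UNIV) = sing_locus (pencil a)"
    using fin c sing_linevec[OF _ assms(1)] by (intro card_seteq) (auto simp: E_def)
  then show "sing_locus (pencil a) = (\<lambda>(e, k). proj_pt (linevec e k)) ` ({e. e\<^sup>2 + e + 1 = 0} \<times> UNIV)"
    "card (sing_locus (pencil a)) = 14"
    using c by (simp_all add: E_def)
qed

lemma nodes_14:
  assumes "a$2 = - 3 * a$1" "a$1 \<noteq> 0" shows "singular_exactly_in_nodes 14 (pencil a)"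
proof -
  note sl = sing_locus_14[OF assms]
  have fin: "finite (sing_locus (pencil a))" using sl(2) by (metis card.infinite zero_neq_numeral)
  moreover have "node (pencil a) L" if "L \<in> sing_locus (pencil a)" for L
    unfolding node_def using isolated_if_finite[OF fin that] A1_linevec[OF _ assms] that sl(1) by auto
  ultimately show ?thesis using sl(2) by (simp add: singular_exactly_in_nodes_def)
qed

section \<open>Duality on the pencil and recognition of the members with seven singular
  points\<close>

lemma pencil_add_scale: "pencil (c *s a) = (\<lambda>x. c * pencil a x)"
  by (simp add: pencil_def fun_eq_iff algebra_simps)

text \<open>In the affine parameter t = a2 / a1 this is the involution t to 9 / (2 t), which
  exchanges -15 with -3/10 and -3 with -3/2.\<close>

lemma pencil_duality: "pencil a (duality x) = pencil (vector [4 / 3 * a$2, 6 * a$1]) x"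
  by (simp add: pencil_def f1_duality f2_duality)

lemma duality_square: "matrix duality ** matrix duality = mat 2"
  by (simp add: matrix_eq matrix_vector_mul_assoc[symmetric] matrix_duality duality_duality)
    (simp add: vec_eq_iff matrix_vector_mult_def mat_def if_distrib[of "\<lambda>c. c * _"] sum.delta cong: if_cong)

lemma invertible_duality: "invertible (matrix duality)"
  unfolding invertible_left_inverse matrix_left_invertible_ker matrix_duality
proof (intro allI impI)
  fix x assume "duality x = 0"
  then have "duality (duality x) = 0" using duality_scale[of 0 x] by simp
  then show "x = 0" by (simp add: duality_duality)
qed

lemma nodes_duality:
  assumes "singular_exactly_in_nodes n (pencil (vector [4 / 3 * a$2, 6 * a$1]))"
  shows "singular_exactly_in_nodes n (pencil a)"
  by (rule nodes_transport[OF invertible_duality one_neq_zero _ holo_pencil holo_pencil assms])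
    (simp add: matrix_duality pencil_duality)

lemma nodes_7': "10 * a$2 = - 3 * a$1 \<Longrightarrow> a$1 \<noteq> 0 \<Longrightarrow> singular_exactly_in_nodes 7 (pencil a)"
  by (rule nodes_duality, rule nodes_7) (auto simp: field_simps)

lemma nodes_14': "2 * a$2 = - 3 * a$1 \<Longrightarrow> a$1 \<noteq> 0 \<Longrightarrow> singular_exactly_in_nodes 14 (pencil a)"
  by (rule nodes_duality, rule nodes_14) (auto simp: field_simps)

text \<open>Separates the determinantal members from the nodal ones by finiteness of the singular
  locus; a curve [1, c, 0] in the plane already gives infinitely many points.\<close>

lemma veronese_surface_infinite:
  assumes "veronese_surface S" shows "infinite S"
proof
  assume fin: "finite S"
  obtain A where A: "invertible A" "S = (\<lambda>L. (*v) A ` L) ` (\<lambda>y. proj_pt (veronese y)) ` {y. y \<noteq> 0}"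
    using assms by (auto simp: veronese_surface_def proj_equivalent_def)
  then have "finite ((\<lambda>y. proj_pt (veronese y)) ` {y. y \<noteq> 0})"
    using fin finite_imageD inj_on_subset[OF inj_image_invertible[OF A(1)] subset_UNIV] by blast
  moreover have "range (\<lambda>c. proj_pt (veronese (vector [1, c, 0]))) \<subseteq> (\<lambda>y. proj_pt (veronese y)) ` {y. y \<noteq> 0}"
    by (auto simp: vec_eq_iff forall_3)
  ultimately have "finite (range (\<lambda>c::complex. proj_pt (veronese (vector [1, c, 0]))))"
    using finite_subset by blast
  moreover have "inj (\<lambda>c::complex. proj_pt (veronese (vector [1, c, 0])))"
  proof (rule injI)
    fix c d :: complex
    assume "proj_pt (veronese (vector [1, c, 0])) = proj_pt (veronese (vector [1, d, 0]))"
    moreover have "veronese (vector [1, d, 0]) \<noteq> 0"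
      unfolding veronese_zero_iff by (simp add: vec_eq_iff forall_3)
    ultimately obtain k where "veronese (vector [1, c, 0]) = k *s veronese (vector [1, d, 0])"
      using proj_pt_eq_iff by blast
    then show "c = d" by (simp add: veronese_def vec6_eq_iff)
  qed
  ultimately have "finite (UNIV :: complex set)" using finite_imageD by blast
  then show False using infinite_UNIV_char_0 by blast
qed

text \<open>Having exactly seven singular points is preserved by invertible substitutions, so this
  singles out two members that every substitution preserving the pencil must permute.\<close>

lemma nodes_7_converse:
  assumes "a \<noteq> 0" "finite (sing_locus (pencil a))" "card (sing_locus (pencil a)) = 7"
  shows "a$2 = - 15 * a$1 \<or> 10 * a$2 = - 3 * a$1"
proof -
  have nz: "a$1 \<noteq> 0" if "a$2 = k * a$1" for k
    using that assms(1) by (auto simp: vec_eq_iff forall_2)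
  have "sing_locus (pencil a) \<noteq> {}" using assms(3) by auto
  from pencil_singular_cases[OF this] consider "3 * a$1 - (1 + eta) * a$2 = 0 \<or> 3 * a$1 + eta * a$2 = 0"
    | "a$2 = - 15 * a$1 \<or> 10 * a$2 = - 3 * a$1" | "a$2 = - 3 * a$1" | "2 * a$2 = - 3 * a$1" by blast
  then show ?thesis
  proof cases
    case 1
    then show ?thesis using veronese_surface_infinite[OF pencil_determinantal(2)[OF assms(1)]] assms(2) by blast
  next
    case 3
    then show ?thesis using nodes_14[OF 3 nz[OF 3]] assms(3) by (simp add: singular_exactly_in_nodes_def)
  next
    case 4
    then have "a$2 = (- 3 / 2) * a$1" by (simp add: field_simps)
    then show ?thesis using nodes_14'[OF 4 nz[of "- 3 / 2"]] assms(3) by (simp add: singular_exactly_in_nodes_def)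
  qed
qed

section \<open>The normalizer in the projective linear group\<close>

lemma mat_scalar: "mat c *v x = c *s x" for c :: complex
  by (simp add: vec_eq_iff matrix_vector_mult_def mat_def if_distrib[of "\<lambda>c. c * _"] sum.delta cong: if_cong)

lemma mat_mult_mat: "mat c ** mat d = mat (c * d)" for c d :: complex
  by (simp add: matrix_eq matrix_vector_mul_assoc[symmetric] mat_scalar)

lemma mat_central: "A ** mat c = mat c ** A" for c :: complex and A :: "complex^'n^'n"
  by (simp add: matrix_eq matrix_vector_mul_assoc[symmetric] mat_scalar vector_scalar_commute)

lemma invertible_mat: "c \<noteq> 0 \<Longrightarrow> invertible (mat c :: complex^'n^'n)"
  unfolding invertible_left_inverse by (intro exI[of _ "mat (1 / c)"]) (simp add: mat_mult_mat)

lemma det_mat: "det (mat c :: complex^'n^'n) = c ^ CARD('n)"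
  by (subst det_diagonal) (simp_all add: mat_def)

lemma GL6_simps: "carrier GL6 = {A. invertible A}" "A \<otimes>\<^bsub>GL6\<^esub> B = A ** B" "\<one>\<^bsub>GL6\<^esub> = mat 1"
  by (simp_all add: GL6_def)

lemma group_GL6: "group GL6"
proof (rule groupI; unfold GL6_simps)
  fix A :: "complex^6^6"
  assume "A \<in> {A. invertible A}"
  then have A: "invertible A" by simp
  obtain B where B: "invertible B" "B ** A = mat 1"
    by (rule invertible_obtain_inverse[OF A]) metis
  then show "\<exists>B\<in>{A. invertible A}. B ** A = mat 1" by blast
next
  fix A B C :: "complex^6^6"
  assume "A \<in> {A. invertible A}" "B \<in> {A. invertible A}"
  then show "A ** B \<in> {A. invertible A}" using invertible_mult by blast
  show "A ** B ** C = A ** (B ** C)" by (rule matrix_mul_assoc[symmetric])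
qed (use invertible_mat[of 1] in simp_all)

lemma scalars_normal: "scalars \<lhd> GL6"
proof -
  interpret group GL6 by (rule group_GL6)
  have sub: "subgroup scalars GL6"
  proof (rule subgroupI)
    show "scalars \<subseteq> carrier GL6" by (auto simp: scalars_def GL6_simps invertible_mat)
    show "scalars \<noteq> {}" by (auto simp: scalars_def intro!: exI[of _ 1])
    fix A B assume "A \<in> scalars" "B \<in> scalars"
    then obtain c d where c: "A = mat c" "c \<noteq> 0" "B = mat d" "d \<noteq> 0" by (auto simp: scalars_def)
    show "A \<otimes>\<^bsub>GL6\<^esub> B \<in> scalars" using c by (auto simp: scalars_def GL6_simps mat_mult_mat)
    have "inv\<^bsub>GL6\<^esub> A = mat (1 / c)"
      by (rule inv_equality) (use c in \<open>auto simp: GL6_simps mat_mult_mat invertible_mat\<close>)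
    then show "inv\<^bsub>GL6\<^esub> A \<in> scalars" using c by (auto simp: scalars_def)
  qed
  show ?thesis
  proof (rule normal_invI[OF sub])
    fix A S assume "A \<in> carrier GL6" "S \<in> scalars"
    then obtain c where c: "S = mat c" "c \<noteq> 0" by (auto simp: scalars_def)
    have "A \<otimes>\<^bsub>GL6\<^esub> S \<otimes>\<^bsub>GL6\<^esub> inv\<^bsub>GL6\<^esub> A = S \<otimes>\<^bsub>GL6\<^esub> (A \<otimes>\<^bsub>GL6\<^esub> inv\<^bsub>GL6\<^esub> A)"
      by (simp add: GL6_simps c mat_central[of A] matrix_mul_assoc)
    also have "\<dots> = S" using \<open>A \<in> carrier GL6\<close> by (simp only: r_inv) (simp add: GL6_simps)
    finally show "A \<otimes>\<^bsub>GL6\<^esub> S \<otimes>\<^bsub>GL6\<^esub> inv\<^bsub>GL6\<^esub> A \<in> scalars" using \<open>S \<in> scalars\<close> by simp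
  qed
qed

lemma group_PGL6: "group PGL6"
  unfolding PGL6_def by (rule normal.factorgroup_is_group[OF scalars_normal])

lemma to_PGL6_alt: "to_PGL6 A = {mat c ** A |c. c \<noteq> 0}"
  by (auto simp: to_PGL6_def r_coset_def scalars_def GL6_simps)

lemma to_PGL6_eqD:
  assumes "to_PGL6 A = to_PGL6 B" shows "\<exists>c. c \<noteq> 0 \<and> A = mat c ** B"
proof -
  have "A \<in> to_PGL6 A" unfolding to_PGL6_alt by (auto intro!: exI[of _ 1])
  then have "A \<in> to_PGL6 B" unfolding assms .
  then show ?thesis unfolding to_PGL6_alt by auto
qed

lemma to_PGL6_closed: "invertible A \<Longrightarrow> to_PGL6 A \<in> carrier PGL6"
  unfolding to_PGL6_def PGL6_def FactGroup_def by (auto simp: RCOSETS_def GL6_simps)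

lemma to_PGL6_mult: "invertible A \<Longrightarrow> invertible B \<Longrightarrow> to_PGL6 A \<otimes>\<^bsub>PGL6\<^esub> to_PGL6 B = to_PGL6 (A ** B)"
  using normal.rcos_sum[OF scalars_normal, of A B]
  by (simp add: to_PGL6_def PGL6_def FactGroup_def GL6_simps)

lemma to_PGL6_one: "to_PGL6 (mat 1) = \<one>\<^bsub>PGL6\<^esub>"
  by (simp add: PGL6_def FactGroup_def to_PGL6_alt scalars_def)

lemma to_PGL6_inv: "invertible A \<Longrightarrow> invertible B \<Longrightarrow> B ** A = mat 1 \<Longrightarrow> inv\<^bsub>PGL6\<^esub> (to_PGL6 A) = to_PGL6 B"
  by (rule group.inv_equality[OF group_PGL6]) (simp_all add: to_PGL6_mult to_PGL6_one to_PGL6_closed)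

text \<open>Turns the stabilizer of a set of cosets under conjugation into a condition on
  representing matrices.\<close>

lemma normalizer_iff:
  fixes H :: "(complex^6^6) set"
  assumes A: "invertible A" "invertible A'" "A' ** A = mat 1" and H: "\<And>M. M \<in> H \<Longrightarrow> invertible M"
  shows "to_PGL6 A \<in> normalizer PGL6 (to_PGL6 ` H) \<longleftrightarrow> (\<lambda>M. to_PGL6 (A ** M ** A')) ` H = to_PGL6 ` H"
proof -
  have sub: "to_PGL6 ` H \<subseteq> carrier PGL6" using H to_PGL6_closed by blast
  have "to_PGL6 A <#\<^bsub>PGL6\<^esub> (to_PGL6 ` H) #>\<^bsub>PGL6\<^esub> inv\<^bsub>PGL6\<^esub> (to_PGL6 A) = (\<lambda>M. to_PGL6 (A ** M ** A')) ` H"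
  proof -
    have "to_PGL6 A <#\<^bsub>PGL6\<^esub> (to_PGL6 ` H) = (\<lambda>M. to_PGL6 (A ** M)) ` H"
      using H A by (auto simp: l_coset_def to_PGL6_mult)
    then show ?thesis using H A by (auto simp: to_PGL6_inv[OF A] r_coset_def to_PGL6_mult invertible_mult)
  qed
  then show ?thesis unfolding normalizer_def stabilizer_def using sub to_PGL6_closed[OF A(1)] by simp
qed

section \<open>The action of the normalizer on the invariant cubics\<close>

text \<open>The permutation character minus the trivial one. What matters later is that it is an
  integer and at least -1.\<close>

lemma trace_perm_rep:
  assumes "bij \<sigma>" shows "trace (matrix (perm_rep \<sigma>)) = of_int (int (card {i. \<sigma> i = i}) - 1)"
proof -
  define \<tau> where "\<tau> = inv_into UNIV \<sigma>"
  have \<tau>: "\<tau> j = i \<longleftrightarrow> j = \<sigma> i" for i j using assms by (metis \<tau>_def bij_inv_eq_iff)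
  have ax: "to_hyperplane (axis 1 1) $ j = (if j = 1 then 1 else 0) - (if j = 7 then 1 else 0)"
    "to_hyperplane (axis 2 1) $ j = (if j = 2 then 1 else 0) - (if j = 7 then 1 else 0)"
    "to_hyperplane (axis 3 1) $ j = (if j = 3 then 1 else 0) - (if j = 7 then 1 else 0)"
    "to_hyperplane (axis 4 1) $ j = (if j = 4 then 1 else 0) - (if j = 7 then 1 else 0)"
    "to_hyperplane (axis 5 1) $ j = (if j = 5 then 1 else 0) - (if j = 7 then 1 else 0)"
    "to_hyperplane (axis 6 1) $ j = (if j = 6 then 1 else 0) - (if j = 7 then 1 else 0)" for j
    using exhaust_7[of j] by (elim disjE; simp add: to_hyperplane_nth axis_def)+
  have "trace (matrix (perm_rep \<sigma>)) = (\<Sum>k\<in>UNIV. (if \<tau> k = k then 1 else 0) - (if \<tau> k = 7 then 1 else 0))"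
    unfolding trace_def matrix_def sum_6 sum_7 perm_rep_def \<tau>_def[symmetric] vec_lambda_beta first_coords_nth ax by simp
  also have "\<dots> = (\<Sum>k\<in>UNIV. if \<sigma> k = k then 1 else 0) - (\<Sum>k\<in>UNIV. if k = \<sigma> 7 then 1 else 0)"
    by (auto simp: sum_subtractf \<tau> intro!: arg_cong2[of _ _ _ _ "(-)"] sum.cong)
  also have "(\<Sum>k\<in>UNIV. if \<sigma> k = k then 1 else 0) = (of_nat (card {i. \<sigma> i = i}) :: complex)"
    by (simp add: sum.If_cases)
  finally show ?thesis by simp
qed

lemma perm_rep_scale: "bij \<sigma> \<Longrightarrow> perm_rep \<sigma> (c *s x) = c *s perm_rep \<sigma> x"
  by (simp add: matrix_perm_rep[symmetric] vector_scalar_commute)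

lemma perm_rep_funpow: "bij \<sigma> \<Longrightarrow> (perm_rep \<sigma> ^^ n) x = perm_rep (\<sigma> ^^ n) x"
proof (induction n)
  case (Suc n)
  have "perm_rep (\<sigma> \<circ> \<sigma> ^^ n) x = perm_rep \<sigma> (perm_rep (\<sigma> ^^ n) x)"
    by (rule perm_rep_comp[OF Suc.prems bij_betw_funpow[OF Suc.prems]])
  moreover have "(perm_rep \<sigma> ^^ Suc n) x = perm_rep \<sigma> ((perm_rep \<sigma> ^^ n) x)" by simp
  ultimately show ?case using Suc by (simp only: funpow.simps(2)[of n \<sigma>])
qed (simp only: funpow.simps perm_rep_id id_apply)

text \<open>The scalar \<open>c\<close> is a root of unity by the order of \<open>\<sigma>\<close>, and a trace that is an integer at least \<open>-1\<close>
  then forces it to be 1.\<close>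

lemma conj_scalar:
  assumes A: "invertible A" and b: "bij \<sigma>" "bij \<tau>"
    and eq: "A ** matrix (perm_rep \<sigma>) = mat c ** matrix (perm_rep \<tau>) ** A"
  shows "\<sigma> ^^ n = id \<Longrightarrow> c ^ n = 1"
    and "trace (matrix (perm_rep \<sigma>)) = c * trace (matrix (perm_rep \<tau>))"
proof -
  obtain B where B: "A ** B = mat 1" "B ** A = mat 1" "\<And>x. A *v (B *v x) = x"
    by (rule invertible_obtain_inverse[OF A]) metis
  have "A *v perm_rep \<sigma> x = c *s perm_rep \<tau> (A *v x)" for x
    using arg_cong[OF eq, of "\<lambda>M. M *v x"] b
    by (simp add: matrix_vector_mul_assoc[symmetric] matrix_perm_rep mat_scalar)
  then have pow: "A *v (perm_rep \<sigma> ^^ n) x = c ^ n *s (perm_rep \<tau> ^^ n) (A *v x)" for n x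
    by (induction n) (simp_all add: perm_rep_scale b)
  show "c ^ n = 1" if "\<sigma> ^^ n = id"
  proof -
    \<comment> \<open>Distinct basis vectors are not proportional, so the n-th power of
      \<open>\<tau>\<close> must fix 7, and then the scalar is 1.\<close>
    have "basevec 7 = c ^ n *s perm_rep (\<tau> ^^ n) (basevec 7)"
      using pow[of n "B *v basevec 7"] that by (simp only: perm_rep_funpow b perm_rep_id B(3))
    also have "\<dots> = c ^ n *s basevec ((\<tau> ^^ n) 7)"
      using bij_betw_funpow[OF b(2), of n] by (simp only: perm_rep_basevec)
    finally have e: "basevec 7 = c ^ n *s basevec ((\<tau> ^^ n) 7)" .
    then have "c ^ n \<noteq> 0" using basevec_nonzero[of 7] by auto
    then have "proj_pt (basevec 7) = proj_pt (basevec ((\<tau> ^^ n) 7))"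
      using e proj_pt_eq_iff[OF basevec_nonzero] by blast
    then have "(\<tau> ^^ n) 7 = 7" using injD[OF proj_basevec_inj] by metis
    then have "to_hyperplane (basevec 7) $ 7 = c ^ n * to_hyperplane (basevec 7) $ 7"
      using e by (metis to_hyperplane_linear(2) vector_smult_component)
    then show ?thesis by (simp add: to_hyperplane_basevec)
  qed
  have "matrix (perm_rep \<sigma>) = B ** (A ** matrix (perm_rep \<sigma>))" by (simp add: matrix_mul_assoc B)
  then have "trace (matrix (perm_rep \<sigma>)) = trace (mat c ** matrix (perm_rep \<tau>) ** A ** B)"
    unfolding eq by (metis trace_mul_sym)
  also have "\<dots> = trace (mat c ** matrix (perm_rep \<tau>))" by (simp add: matrix_mul_assoc[symmetric] B)
  also have "\<dots> = c * trace (matrix (perm_rep \<tau>))"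
    by (simp add: trace_def matrix_matrix_mult_def mat_def if_distrib[of "\<lambda>c. c * _"] sum.delta sum_distrib_left cong: if_cong)
  finally show "trace (matrix (perm_rep \<sigma>)) = c * trace (matrix (perm_rep \<tau>))" .
qed

text \<open>\<open>swap12_36\<close> has three fixed points, hence trace 2: with c^2 = 1 the trace m
  of the conjugate is 2 or -2, and -2 is too small. \<open>shift7\<close> has none, hence trace -1:
  with c^7 = 1 it follows that m^7 = -1, so m = -1. Both times c = 1.\<close>

lemma conj_scalar_generators:
  assumes "invertible A" "bij \<tau>" "A ** matrix (perm_rep \<sigma>) = mat c ** matrix (perm_rep \<tau>) ** A"
    and "\<sigma> = swap12_36 \<or> \<sigma> = shift7"
  shows "c = 1"
proof -
  define m :: int where "m = int (card {i. \<tau> i = i}) - 1"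
  have b: "bij \<sigma>" using assms(4) bij_generators by auto
  note cs = conj_scalar[OF assms(1) b assms(2,3)]
  show ?thesis using assms(4)
  proof
    assume s: "\<sigma> = swap12_36"
    have "swap12_36 i = i \<longleftrightarrow> i \<in> {4, 5, 7}" for i using exhaust_7[of i] by (elim disjE) simp_all
    then have "{i. swap12_36 i = i} = {4, 5, 7}" by blast
    then have "c * of_int m = 2"
      using cs(2) trace_perm_rep[OF assms(2)] trace_perm_rep[OF b] s by (simp add: m_def)
    moreover have "c ^ 2 = 1" by (rule cs(1)) (simp add: s fun_eq_iff numeral_2_eq_2 swap12_36_invol)
    moreover have "(c * of_int m) ^ 2 = c ^ 2 * of_int (m ^ 2)" by (simp add: power_mult_distrib)
    ultimately have "of_int (m ^ 2) = (of_int 4 :: complex)" by simp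
    then have "m ^ 2 = 2 ^ 2" unfolding of_int_eq_iff by simp
    then have "m = 2 \<or> m = -2" by (simp only: power2_eq_iff)
    moreover have "m \<ge> -1" by (simp add: m_def)
    ultimately have "m = 2" by simp
    then show "c = 1" using \<open>c * of_int m = 2\<close> by simp
  next
    assume s: "\<sigma> = shift7"
    have "{i. shift7 i = i} = {}" by auto
    then have cm: "c * of_int m = - 1"
      using cs(2) trace_perm_rep[OF assms(2)] trace_perm_rep[OF b] s by (simp add: m_def)
    moreover have "(shift7 ^^ n) i = i + of_nat n" for n i by (induction n) (simp_all add: algebra_simps)
    then have "shift7 ^^ 7 = id" by (simp add: fun_eq_iff)
    then have "c ^ 7 = 1" using cs(1)[of 7] s by simp
    moreover have "(c * of_int m) ^ 7 = c ^ 7 * of_int (m ^ 7)" by (simp add: power_mult_distrib)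
    ultimately have "of_int (m ^ 7) = (of_int (- 1) :: complex)" by simp
    then have m7: "m ^ 7 = - 1" unfolding of_int_eq_iff .
    have "m < 0"
    proof (rule ccontr)
      assume "\<not> m < 0"
      then have "0 \<le> m ^ 7" by simp
      with m7 show False by simp
    qed
    moreover have "m \<ge> -1" by (simp add: m_def)
    ultimately have "m = -1" by simp
    then show "c = 1" using cm by simp
  qed
qed

lemma SL_normalizer_invertible: "A \<in> SL_normalizer \<Longrightarrow> invertible A"
  by (simp add: SL_normalizer_def invertible_det_nz)

text \<open>Being in the projective normalizer allows a scalar in the conjugation relation; on the
  generators that scalar has just been shown to be 1.\<close>

lemma SL_normalizer_perm_rep:
  assumes "A \<in> SL_normalizer" "\<sigma> = swap12_36 \<or> \<sigma> = shift7"
  shows "\<exists>\<tau>\<in>L2_7. \<forall>x. A *v perm_rep \<sigma> x = perm_rep \<tau> (A *v x)"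
proof -
  have A: "invertible A" using assms(1) by (rule SL_normalizer_invertible)
  obtain B where B: "invertible B" "B ** A = mat 1" by (rule invertible_obtain_inverse[OF A]) metis
  define H where "H = (\<lambda>\<sigma>. matrix (perm_rep \<sigma>)) ` L2_7"
  have H: "invertible M" if "M \<in> H" for M using that by (auto simp: H_def L2_7_bij invertible_perm_rep)
  have "to_PGL6 A \<in> normalizer PGL6 (to_PGL6 ` H)"
    using assms(1) by (simp add: SL_normalizer_def H_def image_image)
  then have img: "(\<lambda>M. to_PGL6 (A ** M ** B)) ` H = to_PGL6 ` H" using normalizer_iff[OF A B H] by simp
  have \<sigma>: "\<sigma> \<in> L2_7" using assms(2) L2_7_closed by auto
  then have "to_PGL6 (A ** matrix (perm_rep \<sigma>) ** B) \<in> to_PGL6 ` H" using img by (auto simp: H_def)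
  then obtain \<tau> where \<tau>: "\<tau> \<in> L2_7" "to_PGL6 (A ** matrix (perm_rep \<sigma>) ** B) = to_PGL6 (matrix (perm_rep \<tau>))"
    by (auto simp: H_def)
  then obtain c where "A ** matrix (perm_rep \<sigma>) ** B = mat c ** matrix (perm_rep \<tau>)" using to_PGL6_eqD by blast
  then have "A ** matrix (perm_rep \<sigma>) ** B ** A = mat c ** matrix (perm_rep \<tau>) ** A" by simp
  then have eq: "A ** matrix (perm_rep \<sigma>) = mat c ** matrix (perm_rep \<tau>) ** A"
    by (simp add: matrix_mul_assoc[symmetric] B)
  have "c = 1" by (rule conj_scalar_generators[OF A L2_7_bij[OF \<tau>(1)] eq assms(2)])
  then have "A *v perm_rep \<sigma> x = perm_rep \<tau> (A *v x)" for x
    using arg_cong[OF eq, of "\<lambda>M. M *v x"] L2_7_bij[OF \<sigma>] L2_7_bij[OF \<tau>(1)]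
    by (simp add: matrix_vector_mul_assoc[symmetric] matrix_perm_rep)
  then show ?thesis using \<tau>(1) by blast
qed

text \<open>Invariance is needed on generators only. For \<open>unshift7\<close> it follows from the
  case of \<open>shift7\<close>, applied at the point \<open>perm_rep unshift7 x\<close>.\<close>

lemma SL_normalizer_invariant_cubics:
  assumes A: "A \<in> SL_normalizer" and F: "F \<in> invariant_cubics"
  shows "(\<lambda>x. F (A *v x)) \<in> invariant_cubics"
proof -
  have gen: "F (A *v perm_rep \<sigma> x) = F (A *v x)" if "\<sigma> = swap12_36 \<or> \<sigma> = shift7" for \<sigma> x
    using SL_normalizer_perm_rep[OF A that] F by (auto simp: invariant_cubics_def)
  have "F (A *v perm_rep \<sigma> x) = F (A *v x)" if "\<sigma> \<in> L2_7" for \<sigma> x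
    using that
  proof (induction arbitrary: x rule: L2_7_induct)
    case unshift
    have "perm_rep shift7 (perm_rep unshift7 x) = perm_rep (shift7 \<circ> unshift7) x"
      by (rule perm_rep_comp[symmetric]) (rule bij_generators)+
    also have "shift7 \<circ> unshift7 = id" by (simp add: fun_eq_iff)
    finally show ?case using gen[of shift7 "perm_rep unshift7 x"] by (simp only: perm_rep_id simp_thms)
  next
    case (comp \<sigma> \<tau>)
    then show ?case by (simp only: perm_rep_comp L2_7_bij)
  qed (simp_all only: perm_rep_id gen simp_thms)
  then show ?thesis using F forms_compose_matrix by (auto simp: invariant_cubics_def)
qed

text \<open>Since the square of the duality matrix is 2, its determinant is 8 or -8. The sign is
  left open: \<kappa>^2 = 1/2 or -1/2 gives \<kappa>^6 = 1/8 or -1/8 accordingly, as determinant 1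
  demands.\<close>

lemma duality_in_SL_normalizer:
  obtains \<kappa> where "\<kappa>\<^sup>2 = 1 / 2 \<or> \<kappa>\<^sup>2 = - 1 / 2" "mat \<kappa> ** matrix duality \<in> SL_normalizer"
proof -
  define D where "D = matrix duality"
  have "det D * det D = 64"
    unfolding det_mul[symmetric] D_def duality_square det_mat by simp
  then have "(det D - 8) * (det D + 8) = 0" by (simp add: algebra_simps)
  then consider "det D = 8" | "det D = - 8" by (auto simp: eq_neg_iff_add_eq_0)
  then obtain \<kappa> :: complex where \<kappa>: "\<kappa>\<^sup>2 = 1 / 2 \<or> \<kappa>\<^sup>2 = - 1 / 2" "\<kappa> ^ 6 * det D = 1"
  proof cases
    case 1
    have p: "csqrt (1/2) ^ 2 = 1 / 2" by (rule power2_csqrt)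
    have "csqrt (1/2) ^ 6 = (csqrt (1/2) ^ 2) ^ 3" unfolding power_mult[symmetric] by simp
    also have "\<dots> = 1 / 8" unfolding p by (simp add: power3_eq_cube)
    finally show ?thesis by (intro that[of "csqrt (1/2)"]) (simp_all only: p 1, simp_all)
  next
    case 2
    have p: "csqrt (-1/2) ^ 2 = - 1 / 2" by (rule power2_csqrt)
    have "csqrt (-1/2) ^ 6 = (csqrt (-1/2) ^ 2) ^ 3" unfolding power_mult[symmetric] by simp
    also have "\<dots> = - 1 / 8" unfolding p by (simp add: power3_eq_cube)
    finally show ?thesis by (intro that[of "csqrt (-1/2)"]) (simp_all only: p 2, simp_all)
  qed
  define A where "A = mat \<kappa> ** D"
  have "det A = 1" using \<kappa>(2) by (simp add: A_def det_mul det_mat)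
  then have invA: "invertible A" by (simp add: invertible_det_nz)
  have \<kappa>0: "\<kappa> \<noteq> 0" using \<kappa>(2) by auto
  define B where "B = mat (1 / (2 * \<kappa>\<^sup>2)) ** A"
  have "A ** A = mat (\<kappa> * \<kappa>) ** (D ** D)"
  proof -
    have "A ** A = mat \<kappa> ** (D ** mat \<kappa>) ** D" by (simp add: A_def matrix_mul_assoc)
    then show ?thesis unfolding mat_central[of D] by (simp add: matrix_mul_assoc mat_mult_mat)
  qed
  also have "\<dots> = mat (2 * \<kappa>\<^sup>2)" unfolding D_def duality_square mat_mult_mat by (simp add: power2_eq_square mult_ac)
  finally have AA: "A ** A = mat (2 * \<kappa>\<^sup>2)" .
  have BA: "B ** A = mat 1" using \<kappa>0 by (simp add: B_def matrix_mul_assoc[symmetric] AA mat_mult_mat)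
  have invB: "invertible B" using BA by (metis invertible_def matrix_left_right_inverse)
  define H where "H = (\<lambda>\<sigma>. matrix (perm_rep \<sigma>)) ` L2_7"
  have H: "invertible M" if "M \<in> H" for M using that by (auto simp: H_def L2_7_bij invertible_perm_rep)
  have Av: "A *v x = \<kappa> *s duality x" for x
    by (simp add: A_def D_def matrix_vector_mul_assoc[symmetric] mat_scalar matrix_duality)
  have conj: "\<exists>\<tau>\<in>L2_7. A ** matrix (perm_rep \<sigma>) ** B = matrix (perm_rep \<tau>)" if \<sigma>: "\<sigma> \<in> L2_7" for \<sigma>
  proof -
    obtain \<tau> where \<tau>: "\<tau> \<in> L2_7" "\<And>x. duality (perm_rep \<sigma> x) = perm_rep \<tau> (duality x)"
      using duality_conj[OF \<sigma>] by blast
    have "A ** matrix (perm_rep \<sigma>) = matrix (perm_rep \<tau>) ** A"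
      using L2_7_bij[OF \<sigma>] L2_7_bij[OF \<tau>(1)]
      by (simp add: matrix_eq matrix_vector_mul_assoc[symmetric] matrix_perm_rep Av \<tau>(2) perm_rep_scale)
    then have "A ** matrix (perm_rep \<sigma>) ** B = matrix (perm_rep \<tau>) ** (A ** B)" by (simp add: matrix_mul_assoc)
    also have "A ** B = mat 1" using BA matrix_left_right_inverse by blast
    finally show ?thesis using \<tau>(1) by auto
  qed
  have sub: "(\<lambda>M. to_PGL6 (A ** M ** B)) ` H \<subseteq> to_PGL6 ` H" using conj by (auto simp: H_def)
  moreover have "to_PGL6 ` H \<subseteq> (\<lambda>M. to_PGL6 (A ** M ** B)) ` H"
  proof
    fix X assume "X \<in> to_PGL6 ` H"
    then obtain \<sigma> where \<sigma>: "\<sigma> \<in> L2_7" "X = to_PGL6 (matrix (perm_rep \<sigma>))" by (auto simp: H_def)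
    obtain \<tau> where \<tau>: "\<tau> \<in> L2_7" "A ** matrix (perm_rep \<sigma>) ** B = matrix (perm_rep \<tau>)" using conj[OF \<sigma>(1)] by blast
    \<comment> \<open>The square of \<open>A\<close> is scalar, so conjugation by \<open>A\<close>
      is an involution. Mapping the group into itself, it is onto.\<close>
    have "A ** matrix (perm_rep \<tau>) ** B = (A ** A) ** matrix (perm_rep \<sigma>) ** (B ** B)"
      unfolding \<tau>(2)[symmetric] by (simp add: matrix_mul_assoc)
    also have "B ** B = mat (1 / (2 * \<kappa>\<^sup>2)) ** (B ** A)" unfolding B_def by (metis mat_central matrix_mul_assoc)
    also have "A ** A ** matrix (perm_rep \<sigma>) ** (mat (1 / (2 * \<kappa>\<^sup>2)) ** (B ** A)) = matrix (perm_rep \<sigma>)"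
      using \<kappa>0 unfolding AA BA by (simp add: mat_central[of _ "1 / (2 * \<kappa>\<^sup>2)"] matrix_mul_assoc mat_mult_mat)
    finally show "X \<in> (\<lambda>M. to_PGL6 (A ** M ** B)) ` H" unfolding \<sigma>(2) using \<tau>(1)
      by (auto simp: H_def image_iff intro!: bexI[of _ \<tau>])
  qed
  ultimately have "to_PGL6 A \<in> normalizer PGL6 (to_PGL6 ` H)" using normalizer_iff[OF invA invB BA H] by blast
  then have "A \<in> SL_normalizer" using \<open>det A = 1\<close> by (simp add: SL_normalizer_def H_def image_image)
  then show thesis using that \<kappa>(1) by (simp add: A_def D_def)
qed

text \<open>The order of the full symmetric group on seven letters, an exponent for all permutations
  by Lagrange. The full group is used because the permutation of the nodes is not known to lie in
  \<open>L2_7\<close>.\<close>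

definition perm_exponent :: nat where "perm_exponent = order (BijGroup (UNIV :: 7 set))"

lemma perm_exponent_pos: "perm_exponent > 0"
proof -
  have "finite (carrier (BijGroup (UNIV :: 7 set)))"
    by (rule finite_subset[OF subset_UNIV]) (rule finite)
  moreover have "carrier (BijGroup (UNIV :: 7 set)) \<noteq> {}"
    using monoid.one_closed[OF group.is_monoid[OF group_BijGroup]] by blast
  ultimately show ?thesis unfolding perm_exponent_def Coset.order_def card_gt_0_iff by blast
qed

lemma funpow_perm_exponent:
  fixes \<sigma> :: "7 \<Rightarrow> 7"
  assumes "bij \<sigma>" shows "\<sigma> ^^ perm_exponent = id"
proof -
  have pow: "\<sigma> [^]\<^bsub>BijGroup UNIV\<^esub> n = \<sigma> ^^ n" for n :: nat
  proof (induction n)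
    case 0
    show ?case by (simp only: nat_pow_0 funpow.simps BijGroup_UNIV_one)
  next
    case (Suc n)
    have "\<sigma> [^]\<^bsub>BijGroup UNIV\<^esub> Suc n = (\<sigma> ^^ n) \<circ> \<sigma>"
      by (simp only: nat_pow_Suc Suc BijGroup_UNIV_mult[OF bij_betw_funpow[OF assms] assms])
    also have "\<dots> = \<sigma> ^^ Suc n" by (simp only: funpow_Suc_right)
    finally show ?case .
  qed
  have "\<sigma> \<in> carrier (BijGroup UNIV)" using assms by (simp add: BijGroup_def Bij_def extensional_def)
  from group.pow_order_eq_1[OF group_BijGroup this] show ?thesis
    unfolding pow perm_exponent_def BijGroup_UNIV_one .
qed

lemma det_perm_rep_power:
  assumes "bij \<sigma>" shows "det (matrix (perm_rep \<sigma>)) ^ perm_exponent = 1"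
proof -
  have "det (matrix (perm_rep (\<sigma> ^^ n))) = det (matrix (perm_rep \<sigma>)) ^ n" for n
  proof (induction n)
    case 0
    have "matrix (perm_rep id) = mat 1"
      unfolding matrix_eq using matrix_perm_rep[OF bij_id] by (simp only: perm_rep_id matrix_vector_mul_lid simp_thms)
    then show ?case by (simp only: funpow.simps det_I power_0)
  next
    case (Suc n)
    have b: "bij (\<sigma> ^^ n)" by (rule bij_betw_funpow[OF assms])
    have "matrix (perm_rep (\<sigma> \<circ> \<sigma> ^^ n)) = matrix (perm_rep \<sigma>) ** matrix (perm_rep (\<sigma> ^^ n))"
      unfolding matrix_eq matrix_vector_mul_assoc[symmetric] matrix_perm_rep[OF bij_comp[OF b assms]]
        matrix_perm_rep[OF b] matrix_perm_rep[OF assms]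
      using perm_rep_comp[OF assms b] by blast
    then show ?case by (simp only: funpow.simps(2)[of n \<sigma>] det_mul Suc power_Suc)
  qed
  from this[of perm_exponent] have "det (matrix (perm_rep \<sigma>)) ^ perm_exponent = det (matrix (perm_rep id))"
    by (simp only: funpow_perm_exponent[OF assms])
  also have "matrix (perm_rep id) = mat 1"
    unfolding matrix_eq using matrix_perm_rep[OF bij_id] by (simp only: perm_rep_id matrix_vector_mul_lid simp_thms)
  finally show ?thesis by simp
qed

text \<open>The only linear relation between the seven points is that they sum to 0, so permuting them up to
  scalars forces equal scalars.\<close>

lemma permutes_basevecs:
  assumes "invertible B" "\<And>i. proj_pt (B *v basevec i) \<in> range (\<lambda>i. proj_pt (basevec i))"
  shows "\<exists>c \<sigma>. bij \<sigma> \<and> (\<forall>x. B *v x = c *s perm_rep \<sigma> x)"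
proof -
  have "\<exists>j c. c \<noteq> 0 \<and> B *v basevec i = c *s basevec j" for i
    using assms(2)[of i] proj_pt_eq_iff[OF basevec_nonzero] by blast
  then obtain \<sigma> c where c: "\<And>i. c i \<noteq> 0" "\<And>i. B *v basevec i = c i *s basevec (\<sigma> i)" by metis
  have "inj \<sigma>"
  proof (rule injI)
    fix i j assume "\<sigma> i = \<sigma> j"
    then have "proj_pt (B *v basevec i) = proj_pt (B *v basevec j)"
      unfolding c(2) using proj_pt_eq_iff[OF basevec_nonzero] c(1) by metis
    then have "(*v) B ` proj_pt (basevec i) = (*v) B ` proj_pt (basevec j)" by (simp only: image_proj_pt)
    then show "i = j" using injD[OF inj_image_invertible[OF assms(1)]] injD[OF proj_basevec_inj] by metis
  qed
  then have bij: "bij \<sigma>" by (simp add: bij_def finite_UNIV_inj_surj)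
  have lin: "B *v (\<Sum>i\<in>I. f i) = (\<Sum>i\<in>I. B *v f i)" for f :: "7 \<Rightarrow> complex^6" and I
    by (induction I rule: infinite_finite_induct) (simp_all add: matrix_vector_right_distrib)
  have "(\<Sum>i\<in>UNIV. basevec i) = 0" by (simp add: sum_7 vec6_eq_iff basevec_def first_coords_nth)
  then have rel: "(\<Sum>i\<in>UNIV. c i *s basevec (\<sigma> i)) = 0" using lin[of basevec UNIV] by (simp add: c(2))
  have th_sum: "to_hyperplane (\<Sum>i\<in>I. f i) = (\<Sum>i\<in>I. to_hyperplane (f i))" for f :: "7 \<Rightarrow> complex^6" and I
    by (induction I rule: infinite_finite_induct) (simp_all add: to_hyperplane_linear)
  \<comment> \<open>The coordinate with index \<sigma> k of the relation: its term for i = k carries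
    6 = 7 - 1 and all others carry -1, so 7 c_k equals a sum that does not depend on k.\<close>
  have eqc: "7 * c k = (\<Sum>i\<in>UNIV. c i)" for k
  proof -
    have "0 = (\<Sum>i\<in>UNIV. c i * (if \<sigma> k = \<sigma> i then 6 else -1))"
      using arg_cong[OF rel, of "\<lambda>v. to_hyperplane v $ \<sigma> k"]
      by (simp add: th_sum to_hyperplane_linear to_hyperplane_basevec)
    also have "\<dots> = (\<Sum>i\<in>UNIV. (if i = k then 7 * c k else 0) - c i)"
      using injD[OF \<open>inj \<sigma>\<close>] by (intro sum.cong) auto
    also have "\<dots> = 7 * c k - (\<Sum>i\<in>UNIV. c i)" by (simp add: sum_subtractf)
    finally show ?thesis by simp
  qed
  have c7: "c i = c 7" for i
  proof -
    have "7 * c i = 7 * c 7" unfolding eqc ..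
    then show ?thesis by simp
  qed
  have c2: "B *v basevec i = c 7 *s basevec (\<sigma> i)" for i using c(2)[of i] unfolding c7[of i] .
  have "B *v x = c 7 *s perm_rep \<sigma> x" for x
  proof -
    have pl: "perm_rep \<sigma> (\<Sum>i\<in>I. f i) = (\<Sum>i\<in>I. perm_rep \<sigma> (f i))" for f :: "7 \<Rightarrow> complex^6" and I
    proof -
      define M where "M = matrix (perm_rep \<sigma>)"
      have M: "perm_rep \<sigma> y = M *v y" for y unfolding M_def by (rule matrix_perm_rep[OF bij, symmetric])
      show ?thesis unfolding M
        by (induction I rule: infinite_finite_induct) (simp_all add: matrix_vector_right_distrib)
    qed
    have "7 *s (B *v x) = B *v (7 *s x)" by (simp add: vector_scalar_commute)
    also have "\<dots> = (\<Sum>i\<in>UNIV. (to_hyperplane x $ i * c 7) *s basevec (\<sigma> i))"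
      unfolding basevec_expansion lin by (rule sum.cong[OF refl]) (simp add: vector_scalar_commute c2)
    also have "\<dots> = c 7 *s perm_rep \<sigma> (7 *s x)"
      unfolding basevec_expansion pl by (simp add: perm_rep_scale bij perm_rep_basevec vec.scale_sum_right mult.commute)
    finally have "7 *s (B *v x) = 7 *s (c 7 *s perm_rep \<sigma> x)" by (simp add: perm_rep_scale bij mult.commute)
    then show ?thesis by (simp add: vec_eq_iff)
  qed
  with bij show ?thesis by blast
qed

text \<open>An invertible substitution maps singular loci bijectively, so the new parameters fall
  under \<open>nodes_7_converse\<close>.\<close>

lemma sing_locus_7_transport:
  assumes "invertible B" "\<And>x. pencil a (B *v x) = pencil b x" "singular_exactly_in_nodes 7 (pencil a)" "a \<noteq> 0"
  shows "b$2 = - 15 * b$1 \<or> 10 * b$2 = - 3 * b$1" "b \<noteq> 0"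
proof -
  show "b \<noteq> 0"
  proof
    assume "b = 0"
    obtain C where "\<And>x. B *v (C *v x) = x" by (rule invertible_obtain_inverse[OF assms(1)]) metis
    then have "pencil a x = pencil 0 x" for x using assms(2)[of "C *v x"] \<open>b = 0\<close> by (simp add: pencil_def)
    then show False using pencil_inj[of a 0] assms(4) by blast
  qed
  have sl: "sing_locus (pencil a) = (\<lambda>L. (*v) B ` L) ` sing_locus (pencil b)"
    by (rule sing_locus_transport[OF assms(1), of 1]) (simp_all add: assms(2) holo_pencil)
  have inj: "inj_on (\<lambda>L. (*v) B ` L) (sing_locus (pencil b))"
    by (rule inj_on_subset[OF inj_image_invertible[OF assms(1)] subset_UNIV])
  have "finite (sing_locus (pencil a))" "card (sing_locus (pencil a)) = 7"
    using assms(3) by (simp_all add: singular_exactly_in_nodes_def)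
  then have "finite (sing_locus (pencil b))" and "card (sing_locus (pencil b)) = 7"
    unfolding sl by (simp_all only: card_image[OF inj] finite_image_iff[OF inj])
  then show "b$2 = - 15 * b$1 \<or> 10 * b$2 = - 3 * b$1" by (rule nodes_7_converse[OF \<open>b \<noteq> 0\<close>])
qed

lemma pencil_lin: "pencil (a + b) x = pencil a x + pencil b x" "pencil (c *s a) x = c * pencil a x"
  by (simp_all add: pencil_def algebra_simps)

text \<open>The matrix permutes the nodes of the member -15, so it is c times a permutation and
  multiplies the fully symmetric \<open>f1\<close> by c^3. The other member with seven nodes goes to
  a member of the same kind, and comparing coefficients forces l = c^3, hence the same factor on the
  whole pencil. Determinant 1 makes c^6 the inverse of the determinant of a permutation, which has
  finite order.\<close>

lemma action_fixing_7:
  assumes det: "det B = 1" and inv: "\<And>F. F \<in> invariant_cubics \<Longrightarrow> (\<lambda>x. F (B *v x)) \<in> invariant_cubics"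
    and stab: "\<And>x. pencil (vector [1, -15]) (B *v x) = l * pencil (vector [1, -15]) x"
  shows "\<exists>s. s ^ (2 * perm_exponent) = 1 \<and> (\<forall>a x. pencil a (B *v x) = s * pencil a x)"
proof -
  have B: "invertible B" using det by (simp add: invertible_det_nz)
  let ?v = "vector [1, -15] :: complex^2"
  let ?w = "vector [10, -3] :: complex^2"
  have v: "singular_exactly_in_nodes 7 (pencil ?v)" "?v \<noteq> 0" by (rule nodes_7) (auto simp: vec_eq_iff forall_2)
  have w: "singular_exactly_in_nodes 7 (pencil ?w)" "?w \<noteq> 0" by (rule nodes_7') (auto simp: vec_eq_iff forall_2)
  have stab': "pencil ?v (B *v x) = pencil (l *s ?v) x" for x unfolding stab pencil_lin ..
  have "l \<noteq> 0" using sing_locus_7_transport(2)[OF B stab' v] by auto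
  have sl: "sing_locus (pencil ?v) = range (\<lambda>i. proj_pt (basevec i))" by (rule sing_locus_7) simp_all
  have tr: "sing_locus (pencil ?v) = (\<lambda>L. (*v) B ` L) ` sing_locus (pencil ?v)"
    by (rule sing_locus_transport[OF B \<open>l \<noteq> 0\<close> stab holo_pencil holo_pencil])
  have "proj_pt (B *v basevec i) \<in> range (\<lambda>i. proj_pt (basevec i))" for i
  proof -
    have "(*v) B ` proj_pt (basevec i) \<in> sing_locus (pencil ?v)" by (subst tr) (use sl in blast)
    then show ?thesis unfolding image_proj_pt sl .
  qed
  then obtain c \<sigma> where c: "bij \<sigma>" "\<And>x. B *v x = c *s perm_rep \<sigma> x" using permutes_basevecs[OF B] by blast
  have "B = mat c ** matrix (perm_rep \<sigma>)"
    by (simp add: matrix_eq matrix_vector_mul_assoc[symmetric] mat_scalar matrix_perm_rep c)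
  then have "1 = c ^ 6 * det (matrix (perm_rep \<sigma>))" using det by (simp add: det_mul det_mat)
  then have "1 = (c ^ 6) ^ perm_exponent"
    using det_perm_rep_power[OF c(1)] by (metis mult.right_neutral power_mult_distrib power_one)
  then have c6: "(c ^ 3) ^ (2 * perm_exponent) = 1" by (simp add: power_mult[symmetric])
  then have "c \<noteq> 0" using perm_exponent_pos by (auto simp: power_0_left)
  have f1: "f1 (B *v x) = c ^ 3 * f1 x" for x by (simp add: c f1_scale f1_perm_rep)
  obtain b where b: "\<And>x. pencil ?w (B *v x) = pencil b x"
    using invariant_cubic_in_pencil[OF inv[OF pencil_invariant[of ?w]]] by metis
  \<comment> \<open>With v = f1 - 15 f2 and w = 10 f1 - 3 f2 one has 49 f1 = 5 w - v; all three
    forms have known images.\<close>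
  have "pencil (49 *s vector [c ^ 3, 0]) x = pencil (5 *s b + (- l) *s ?v) x" for x
  proof -
    have "49 * f1 y = 5 * pencil ?w y - pencil ?v y" for y by (simp add: pencil_def)
    from this[of "B *v x"] show ?thesis unfolding f1 b stab pencil_lin by (simp add: pencil_def)
  qed
  then have eq: "49 *s vector [c ^ 3, 0] = 5 *s b + (- l) *s ?v" by (intro pencil_inj ext)
  have e: "49 * c ^ 3 = 5 * b$1 - l" "5 * b$2 + 15 * l = 0"
    using arg_cong[OF eq, of "\<lambda>v. v$1"] arg_cong[OF eq, of "\<lambda>v. v$2"] by (simp_all add: mult.commute)
  have "l = c ^ 3"
    using sing_locus_7_transport(1)[OF B b w]
  proof
    assume "b$2 = - 15 * b$1"
    then have "5 * b$1 - l = 0" using e(2) by simp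
    then show ?thesis using e(1) \<open>c \<noteq> 0\<close> by simp
  next
    assume "10 * b$2 = - 3 * b$1"
    then have "10 * b$2 + 3 * b$1 = 0" by simp
    moreover have "15 * b$1 - 150 * l = 5 * (10 * b$2 + 3 * b$1) - 10 * (5 * b$2 + 15 * l)"
      by (simp add: algebra_simps)
    ultimately have "15 * b$1 - 150 * l = 0" using e(2) by (simp only: mult_zero_right diff_zero)
    then have "5 * b$1 = 50 * l" by simp
    then have "49 * c ^ 3 = 49 * l" using e(1) by simp
    then show ?thesis by simp
  qed
  have "f2 (B *v x) = c ^ 3 * f2 x" for x
  proof -
    have "15 * f2 y = f1 y - pencil ?v y" for y by (simp add: pencil_def)
    note f2 = this
    have "15 * f2 (B *v x) = c ^ 3 * (f1 x - pencil ?v x)"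
      unfolding f2 f1 stab \<open>l = c ^ 3\<close> by (rule right_diff_distrib[symmetric])
    also have "\<dots> = 15 * (c ^ 3 * f2 x)" unfolding f2[symmetric] by (rule mult.left_commute)
    finally show ?thesis by simp
  qed
  then have "pencil a (B *v x) = c ^ 3 * pencil a x" for a x by (simp add: pencil_def f1 algebra_simps)
  then show ?thesis using c6 by blast
qed

text \<open>The member -15 goes to a multiple of itself or of its dual. In the second case composing
  with the normalized duality leads back to the first. So on the pencil the normalizer acts, up to
  roots of unity, through a group of order two.\<close>

lemma action_SL_normalizer:
  assumes \<kappa>: "\<kappa>\<^sup>2 = 1 / 2 \<or> \<kappa>\<^sup>2 = - 1 / 2" "mat \<kappa> ** matrix duality \<in> SL_normalizer" and A: "A \<in> SL_normalizer"
  shows "\<exists>s. s ^ (2 * perm_exponent) = 1 \<and> ((\<forall>a x. pencil a (A *v x) = s * pencil a x)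
    \<or> (\<forall>a x. pencil a (A *v x) = s * pencil a ((mat \<kappa> ** matrix duality) *v x)))"
proof -
  define D where "D = mat \<kappa> ** matrix duality"
  have D: "D *v x = \<kappa> *s duality x" for x
    by (simp add: D_def matrix_vector_mul_assoc[symmetric] mat_scalar matrix_duality)
  have invA: "invertible A" using A by (rule SL_normalizer_invertible)
  have detA: "det A = 1" "det D = 1" using A \<kappa>(2) by (simp_all add: SL_normalizer_def D_def)
  let ?v = "vector [1, -15] :: complex^2"
  have v: "singular_exactly_in_nodes 7 (pencil ?v)" "?v \<noteq> 0" by (rule nodes_7) (auto simp: vec_eq_iff forall_2)
  obtain b where b: "\<And>x. pencil ?v (A *v x) = pencil b x"
    using invariant_cubic_in_pencil[OF SL_normalizer_invariant_cubics[OF A pencil_invariant[of ?v]]] by metis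
  from sing_locus_7_transport(1)[OF invA b v] show ?thesis
  proof
    assume "b$2 = - 15 * b$1"
    then have "b = b$1 *s ?v" by (simp add: vec_eq_iff forall_2)
    then have "pencil ?v (A *v x) = b$1 * pencil ?v x" for x using b pencil_lin(2) by metis
    from action_fixing_7[OF detA(1) SL_normalizer_invariant_cubics[OF A] this] show ?thesis by blast
  next
    assume "10 * b$2 = - 3 * b$1"
    then have "b$2 = (- 3 / 10) * b$1" by (simp add: field_simps)
    then have w: "vector [4 / 3 * b$2, 6 * b$1] = (- 2 / 5 * b$1) *s ?v" by (simp add: vec_eq_iff forall_2)
    have "pencil ?v ((A ** D) *v x) = \<kappa> ^ 3 * (- 2 / 5 * b$1) * pencil ?v x" for x
      unfolding matrix_vector_mul_assoc[symmetric] b D forms_homogeneous[OF pencil_in_forms] pencil_duality w pencil_lin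
      by (rule mult.assoc[symmetric])
    moreover have "det (A ** D) = 1" by (simp add: det_mul detA)
    moreover have "(\<lambda>x. F ((A ** D) *v x)) \<in> invariant_cubics" if "F \<in> invariant_cubics" for F
      using SL_normalizer_invariant_cubics[OF \<kappa>(2) SL_normalizer_invariant_cubics[OF A that]]
      by (simp add: matrix_vector_mul_assoc D_def)
    ultimately obtain s where s: "s ^ (2 * perm_exponent) = 1" "\<And>a x. pencil a ((A ** D) *v x) = s * pencil a x"
      using action_fixing_7 by blast
    \<comment> \<open>The scalar by which the square of the normalized duality acts; it is 1 or -1,
      depending on the sign left open in the determinant.\<close>
    define \<nu> where "\<nu> = 2 * \<kappa>\<^sup>2"
    have \<nu>: "\<nu> = 1 \<or> \<nu> = - 1" using \<kappa>(1) unfolding \<nu>_def by (elim disjE; simp only:) simp_all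
    have "pencil a (A *v x) = \<nu> * s * pencil a (D *v x)" for a x
    proof -
      have "(A ** D) *v (D *v x) = \<nu> *s (A *v x)"
        by (simp add: matrix_vector_mul_assoc[symmetric] D duality_scale duality_duality \<nu>_def vector_scalar_commute
            power2_eq_square mult_ac)
      then have "\<nu> ^ 3 * pencil a (A *v x) = s * pencil a (D *v x)"
        using s(2)[of a "D *v x"] by (simp add: forms_homogeneous[OF pencil_in_forms])
      then have "\<nu> * (\<nu> ^ 3 * pencil a (A *v x)) = \<nu> * (s * pencil a (D *v x))" by simp
      moreover have "\<nu> * \<nu> ^ 3 = 1" using \<nu> by auto
      ultimately show ?thesis by (simp only: mult.assoc[symmetric] mult_1)
    qed
    moreover have "(\<nu> * s) ^ (2 * perm_exponent) = 1" using \<nu> s(1) by (auto simp: power_mult_distrib power_mult)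
    ultimately show ?thesis unfolding D_def by blast
  qed
qed

section \<open>Invariants and the quotient\<close>

text \<open>For each \<open>k\<close> the roots of the quadratic form are exchanged by the outer automorphism.\<close>

definition quad :: "complex \<Rightarrow> complex^2 \<Rightarrow> complex" where
  "quad k a = 2 * (a$2)\<^sup>2 + 9 * (a$1)\<^sup>2 + k * (a$1 * a$2)"

text \<open>The quadratic form is only invariant up to the square of the root of unity s and up to a
  sign; the power removes both. The restriction makes the function extensional, as
  \<open>git_invariants\<close> requires.\<close>

definition quad_invariant :: "complex \<Rightarrow> (complex^6 \<Rightarrow> complex) \<Rightarrow> complex" where
  "quad_invariant k = restrict (\<lambda>F. quad k (inv_into UNIV pencil F) ^ (2 * perm_exponent)) invariant_cubics"

lemma quad_invariant_pencil: "quad_invariant k (pencil a) = quad k a ^ (2 * perm_exponent)"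
proof -
  have "inv_into UNIV pencil (pencil a) = a" by (rule inv_into_f_f) (auto intro: injI pencil_inj)
  then show ?thesis by (simp add: quad_invariant_def pencil_invariant)
qed

lemma quad_in_forms: "quad k \<in> forms 2"
proof -
  have "quad k = (\<lambda>a. 2 * (a$2 * a$2) + 9 * (a$1 * a$1) + k * (a$1 * a$2))"
    by (simp add: quad_def fun_eq_iff power2_eq_square)
  moreover have "\<dots> \<in> forms (1 + 1)" by (intro forms_add forms_scale forms_mult forms_nth)
  ultimately show ?thesis by (simp add: numeral_2_eq_2)
qed

text \<open>Scaling by s multiplies the form by s^2, and normalized duality multiplies it by 8
  \<kappa>^6, which is 1 or -1. The exponent turns all these factors into 1.\<close>

lemma quad_invariant_in_git_invariants: "quad_invariant k \<in> git_invariants (2 * perm_exponent * 2)"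
  unfolding git_invariants_def
proof (intro CollectI conjI ballI)
  show "quad_invariant k \<in> extensional invariant_cubics" by (simp add: quad_invariant_def)
  show "\<exists>p\<in>forms (2 * perm_exponent * 2). \<forall>a. quad_invariant k (pencil a) = p a"
    by (intro bexI[of _ "\<lambda>a. quad k a ^ (2 * perm_exponent)"] allI quad_invariant_pencil forms_power[OF quad_in_forms])
  fix A F assume A: "A \<in> SL_normalizer" and "F \<in> invariant_cubics"
  then obtain a where a: "F = pencil a" using invariant_cubic_in_pencil by blast
  obtain \<kappa> where \<kappa>: "\<kappa>\<^sup>2 = 1 / 2 \<or> \<kappa>\<^sup>2 = - 1 / 2" "mat \<kappa> ** matrix duality \<in> SL_normalizer"
    by (rule duality_in_SL_normalizer)
  obtain s where s: "s ^ (2 * perm_exponent) = 1" "(\<forall>a x. pencil a (A *v x) = s * pencil a x)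
    \<or> (\<forall>a x. pencil a (A *v x) = s * pencil a ((mat \<kappa> ** matrix duality) *v x))"
    using action_SL_normalizer[OF \<kappa> A] by blast
  have s2: "(s\<^sup>2) ^ (2 * perm_exponent) = 1" using s(1) by (metis power_commutes power_mult mult.commute power_one)
  from s(2) show "quad_invariant k (\<lambda>x. F (A *v x)) = quad_invariant k F"
  proof
    assume "\<forall>a x. pencil a (A *v x) = s * pencil a x"
    then have "(\<lambda>x. F (A *v x)) = pencil (s *s a)" by (simp add: a fun_eq_iff pencil_lin)
    moreover have "quad k (s *s a) = s\<^sup>2 * quad k a" by (simp add: quad_def power2_eq_square algebra_simps)
    ultimately show ?thesis unfolding a by (simp only: quad_invariant_pencil power_mult_distrib s2 mult_1)
  next
    assume h: "\<forall>a x. pencil a (A *v x) = s * pencil a ((mat \<kappa> ** matrix duality) *v x)"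
    define \<mu> where "\<mu> = s * \<kappa> ^ 3"
    have "pencil a ((mat \<kappa> ** matrix duality) *v x) = \<kappa> ^ 3 * pencil (vector [4 / 3 * a$2, 6 * a$1]) x" for x
      by (simp add: matrix_vector_mul_assoc[symmetric] mat_scalar matrix_duality forms_homogeneous[OF pencil_in_forms] pencil_duality)
    then have "(\<lambda>x. F (A *v x)) = pencil (\<mu> *s vector [4 / 3 * a$2, 6 * a$1])"
      using h by (simp add: a fun_eq_iff pencil_lin \<mu>_def)
    moreover have "quad k (\<mu> *s vector [4 / 3 * a$2, 6 * a$1]) = 8 * \<mu>\<^sup>2 * quad k a"
      by (simp add: quad_def power2_eq_square algebra_simps)
    moreover have "8 * \<mu>\<^sup>2 = s\<^sup>2 * (8 * (\<kappa>\<^sup>2) ^ 3)"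
      by (simp add: \<mu>_def power_mult_distrib power_mult[symmetric])
    moreover have "(8 * (\<kappa>\<^sup>2) ^ 3) ^ (2 * perm_exponent) = 1"
    proof -
      have "8 * (\<kappa>\<^sup>2) ^ 3 = 1 \<or> 8 * (\<kappa>\<^sup>2) ^ 3 = - 1"
        using \<kappa>(1) by (elim disjE; simp only:) (simp_all add: power3_eq_cube)
      moreover have "x ^ (2 * n) = 1" if "x = 1 \<or> x = - 1" for x :: complex and n
        using that by (auto simp: power_mult)
      ultimately show ?thesis by blast
    qed
    ultimately show ?thesis unfolding a by (simp only: quad_invariant_pencil power_mult_distrib s2 mult_1)
  qed
qed

lemma cubic_eq_pencil: "cubic t = pencil (vector [1, t])"
  by (simp add: pencil_def fun_eq_iff)

lemma quad_invariant_cubic: "quad_invariant k (cubic t) = 0 \<longleftrightarrow> 2 * t\<^sup>2 + 9 + k * t = 0"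
  unfolding cubic_eq_pencil quad_invariant_pencil using perm_exponent_pos by (simp add: quad_def)

lemma quad_invariant_in_git_point: "quad_invariant k \<in> git_point (cubic t) \<longleftrightarrow> 2 * t\<^sup>2 + 9 + k * t = 0"
proof -
  have "0 < 2 * perm_exponent * 2" using perm_exponent_pos by simp
  then show ?thesis unfolding git_point_def quad_invariant_cubic[symmetric]
    using quad_invariant_in_git_invariants by blast
qed

text \<open>The forms for k = 0 and k = 1 differ by t and both have the value 9 at t = 0, so they
  have no common zero.\<close>

lemma semistable_cubic: "semistable (cubic t)"
proof -
  have "2 * t\<^sup>2 + 9 + 0 * t \<noteq> 0 \<or> 2 * t\<^sup>2 + 9 + 1 * t \<noteq> 0" by auto
  then obtain k where "2 * t\<^sup>2 + 9 + k * t \<noteq> 0" by blast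
  then have "quad_invariant k (cubic t) \<noteq> 0" by (simp only: quad_invariant_cubic not_False_eq_True)
  moreover have "0 < 2 * perm_exponent * 2" using perm_exponent_pos by simp
  moreover have "cubic t \<in> invariant_cubics" unfolding cubic_eq_pencil by (rule pencil_invariant)
  ultimately show ?thesis unfolding semistable_def using quad_invariant_in_git_invariants by blast
qed

text \<open>The normalized duality pulls the cubic with parameter t back to a nonzero multiple of
  the one with t'. Homogeneous invariants therefore vanish at both or at neither.\<close>

lemma git_point_duality:
  assumes "2 * (t * t') = 9" shows "git_point (cubic t) = git_point (cubic t')"
proof -
  obtain \<kappa> where \<kappa>: "\<kappa>\<^sup>2 = 1 / 2 \<or> \<kappa>\<^sup>2 = - 1 / 2" "mat \<kappa> ** matrix duality \<in> SL_normalizer"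
    by (rule duality_in_SL_normalizer)
  have t: "t \<noteq> 0" using assms by auto
  have "\<kappa> \<noteq> 0" using \<kappa>(1) by auto
  have "P (cubic t) = 0 \<longleftrightarrow> P (cubic t') = 0" if P: "P \<in> git_invariants d" for P d
  proof -
    define m where "m = \<kappa> ^ 3 * (4 / 3 * t)"
    have "m \<noteq> 0" using t \<open>\<kappa> \<noteq> 0\<close> by (simp add: m_def)
    obtain p where p: "p \<in> forms d" "\<And>a. P (pencil a) = p a"
      using P unfolding git_invariants_def by blast
    have eq: "(\<lambda>x. cubic t ((mat \<kappa> ** matrix duality) *v x)) = pencil (m *s vector [1, t'])"
    proof
      fix x
      have "9 = 2 * t * t'" using assms by (simp only: mult.assoc)
      have "cubic t ((mat \<kappa> ** matrix duality) *v x) = \<kappa> ^ 3 * (6 * f2 x + t * (4 / 3 * f1 x))"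
        by (simp add: matrix_vector_mul_assoc[symmetric] mat_scalar matrix_duality f1_scale f2_scale f1_duality f2_duality
            ring_distribs)
      also have "\<dots> = \<kappa> ^ 3 * (2 / 3 * (9 * f2 x + 2 * t * f1 x))" by simp
      also have "\<dots> = pencil (m *s vector [1, t']) x"
        unfolding \<open>9 = 2 * t * t'\<close> by (simp add: m_def pencil_def algebra_simps)
      finally show "cubic t ((mat \<kappa> ** matrix duality) *v x) = pencil (m *s vector [1, t']) x" .
    qed
    have "P (\<lambda>x. pencil (vector [1, t]) ((mat \<kappa> ** matrix duality) *v x)) = P (pencil (vector [1, t]))"
      using P \<kappa>(2) pencil_invariant[of "vector [1, t]"] unfolding git_invariants_def by blast
    then have "P (\<lambda>x. cubic t ((mat \<kappa> ** matrix duality) *v x)) = P (cubic t)" by (simp add: pencil_def)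
    then have "P (cubic t) = m ^ d * p (vector [1, t'])"
      unfolding eq p(2) forms_homogeneous[OF p(1)] ..
    then show ?thesis using \<open>m \<noteq> 0\<close> by (simp add: cubic_eq_pencil[of t'] p(2))
  qed
  then show ?thesis unfolding git_point_def by blast
qed

section \<open>The projective line of invariant cubics and its singular members\<close>

lemma pencil_image_proj_pt: "pencil ` proj_pt v = form_pt (pencil v)"
  unfolding proj_pt_alt form_pt_def image_image pencil_add_scale by auto

lemma bij_proj_pencil: "bij_betw (\<lambda>L. pencil ` L) proj_space proj_invariant_cubics"
proof -
  have inj: "inj pencil" by (auto intro: injI pencil_inj)
  have zero: "pencil v = (\<lambda>x. 0) \<longleftrightarrow> v = 0" for v
  proof -
    have "pencil 0 = (\<lambda>x. 0)" by (simp add: pencil_def)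
    then show ?thesis using pencil_inj by metis
  qed
  have "(\<lambda>L. pencil ` L) ` proj_space = form_pt ` pencil ` {v. v \<noteq> 0}"
    unfolding proj_space_def image_image pencil_image_proj_pt ..
  also have "pencil ` {v. v \<noteq> 0} = {F \<in> invariant_cubics. F \<noteq> (\<lambda>x. 0)}"
    using zero pencil_invariant invariant_cubic_in_pencil by (auto simp: image_iff) metis
  finally show ?thesis unfolding bij_betw_def proj_invariant_cubics_def
    using inj by (auto simp: inj_on_def inj_image_eq_iff)
qed

lemma form_pt_pencil_scale: "c \<noteq> 0 \<Longrightarrow> form_pt (pencil (c *s a)) = form_pt (pencil a)"
  unfolding pencil_image_proj_pt[symmetric]
proof (rule arg_cong[of _ _ "image pencil"])
  assume "c \<noteq> 0"
  show "proj_pt (c *s a) = proj_pt a"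
  proof (cases "a = 0")
    case False
    then show ?thesis using proj_pt_eq_iff[OF False] \<open>c \<noteq> 0\<close> by blast
  qed simp
qed

lemma form_pt_cubic_inj: "inj (\<lambda>t. form_pt (cubic t))"
proof (rule injI)
  fix t t' assume "form_pt (cubic t) = form_pt (cubic t')"
  moreover have "cubic t \<in> form_pt (cubic t)" unfolding form_pt_def by (auto intro!: exI[of _ 1])
  ultimately obtain c where "cubic t = (\<lambda>x. c * cubic t' x)" unfolding form_pt_def by blast
  then have "pencil (vector [1, t]) = pencil (c *s vector [1, t'])"
    by (simp add: cubic_eq_pencil[symmetric] pencil_add_scale)
  from pencil_inj[OF this] show "t = t'" by (simp add: vec_eq_iff forall_2)
qed

text \<open>Both descriptions pass through the quadratic polynomial 2 t^2 - 3 t + 9, so it never has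
  to be decided which square root of -7 is 2 eta + 1.\<close>

lemma determinantal_parameters:
  fixes d t :: complex
  assumes "d = csqrt (-7)"
  shows "t \<in> {3 * ((1 + d) / 4), 3 * ((1 - d) / 4)} \<longleftrightarrow> 3 - (1 + eta) * t = 0 \<or> 3 + eta * t = 0"
    and "t \<in> {3 * ((1 + d) / 4), 3 * ((1 - d) / 4)} \<longleftrightarrow> 2 * t\<^sup>2 + 9 - 3 * t = 0"
proof -
  have d2: "d\<^sup>2 = -7" unfolding assms by (rule power2_csqrt)
  have *: "t \<in> {3 * ((1 + d) / 4), 3 * ((1 - d) / 4)} \<longleftrightarrow> (4 * t - 3 - 3 * d) * (4 * t - 3 + 3 * d) = 0"
  proof -
    have "t = 3 * ((1 + d) / 4) \<longleftrightarrow> 4 * t - 3 - 3 * d = 0" "t = 3 * ((1 - d) / 4) \<longleftrightarrow> 4 * t - 3 + 3 * d = 0"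
      by (auto simp: field_simps)
    then show ?thesis by simp
  qed
  have "(4 * t - 3 - 3 * d) * (4 * t - 3 + 3 * d) = 16 * t\<^sup>2 - 24 * t + 9 - 9 * d\<^sup>2"
    by (simp add: power2_eq_square algebra_simps)
  also have "\<dots> = 8 * (2 * t\<^sup>2 + 9 - 3 * t)" by (simp add: d2)
  finally have h: "(4 * t - 3 - 3 * d) * (4 * t - 3 + 3 * d) = 8 * (2 * t\<^sup>2 + 9 - 3 * t)" .
  then show 1: "t \<in> {3 * ((1 + d) / 4), 3 * ((1 - d) / 4)} \<longleftrightarrow> 2 * t\<^sup>2 + 9 - 3 * t = 0"
    unfolding * h by (metis mult_eq_0_iff zero_neq_numeral)
  have "(3 - (1 + eta) * t) * (3 + eta * t) = 2 * t\<^sup>2 + 9 - 3 * t" using klein_parameters_product[of 1 t] by simp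
  then show "t \<in> {3 * ((1 + d) / 4), 3 * ((1 - d) / 4)} \<longleftrightarrow> 3 - (1 + eta) * t = 0 \<or> 3 + eta * t = 0"
    unfolding 1 by (metis mult_eq_0_iff)
qed

lemma cubic_determinantal:
  assumes "2 * t\<^sup>2 + 9 - 3 * t = 0"
  shows "determinantal (cubic t)" "veronese_surface (sing_locus (cubic t))" "smooth_surface (sing_locus (cubic t))"
proof -
  have "(3 - (1 + eta) * t) * (3 + eta * t) = 2 * t\<^sup>2 + 9 - 3 * t" using klein_parameters_product[of 1 t] by simp
  then have *: "3 * (vector [1, t] :: complex^2)$1 - (1 + eta) * (vector [1, t] :: complex^2)$2 = 0
      \<or> 3 * (vector [1, t] :: complex^2)$1 + eta * (vector [1, t] :: complex^2)$2 = 0"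
    using assms by simp
  have nz: "vector [1, t] \<noteq> (0 :: complex^2)" by (simp add: vec_eq_iff forall_2)
  show "determinantal (cubic t)" "veronese_surface (sing_locus (cubic t))" "smooth_surface (sing_locus (cubic t))"
    unfolding cubic_eq_pencil using pencil_determinantal[OF nz *] by blast+
qed

lemma cubic_nodes:
  "t = - 15 \<or> t = - 3 / 10 \<Longrightarrow> singular_exactly_in_nodes 7 (cubic t)"
  "t = - 3 \<or> t = - 3 / 2 \<Longrightarrow> singular_exactly_in_nodes 14 (cubic t)"
  unfolding cubic_eq_pencil
  using nodes_7[of "vector [1, t]"] nodes_7'[of "vector [1, t]"] nodes_14[of "vector [1, t]"] nodes_14'[of "vector [1, t]"]
  by auto

lemma cubic_singular_iff:
  "sing_locus (cubic t) \<noteq> {} \<longleftrightarrow> 2 * t\<^sup>2 + 9 - 3 * t = 0 \<or> t = - 3 / 10 \<or> t = - 15 \<or> t = - 3 / 2 \<or> t = - 3"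
proof
  assume "sing_locus (cubic t) \<noteq> {}"
  then have "3 - (1 + eta) * t = 0 \<or> 3 + eta * t = 0 \<or> t = - 15 \<or> 10 * t = - 3 \<or> t = - 3 \<or> 2 * t = - 3"
    using pencil_singular_cases[of "vector [1, t]"] unfolding cubic_eq_pencil by simp
  then show "2 * t\<^sup>2 + 9 - 3 * t = 0 \<or> t = - 3 / 10 \<or> t = - 15 \<or> t = - 3 / 2 \<or> t = - 3"
    using determinantal_parameters[OF refl, of t] by (auto simp: field_simps)
next
  assume "2 * t\<^sup>2 + 9 - 3 * t = 0 \<or> t = - 3 / 10 \<or> t = - 15 \<or> t = - 3 / 2 \<or> t = - 3"
  then consider "2 * t\<^sup>2 + 9 - 3 * t = 0" | "t = - 15 \<or> t = - 3 / 10" | "t = - 3 \<or> t = - 3 / 2" by blast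
  then show "sing_locus (cubic t) \<noteq> {}"
  proof cases
    case 1
    then show ?thesis using veronese_surface_infinite[OF cubic_determinantal(2)[OF 1]] by auto
  next
    case 2
    then show ?thesis using cubic_nodes(1) unfolding singular_exactly_in_nodes_def
      by (metis card.empty zero_neq_numeral)
  next
    case 3
    then show ?thesis using cubic_nodes(2) unfolding singular_exactly_in_nodes_def
      by (metis card.empty zero_neq_numeral)
  qed
qed

text \<open>Passing to the affine parameter loses the member \<open>f2\<close>, so that member has
  to be shown to be smooth.\<close>

lemma singular_points_eq: "singular_points = (\<lambda>t. form_pt (cubic t)) ` {t. sing_locus (cubic t) \<noteq> {}}"
proof
  show "singular_points \<subseteq> (\<lambda>t. form_pt (cubic t)) ` {t. sing_locus (cubic t) \<noteq> {}}"
  proof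
    fix X assume "X \<in> singular_points"
    then obtain F where F: "F \<in> invariant_cubics" "F \<noteq> (\<lambda>x. 0)" "sing_locus F \<noteq> {}" "X = form_pt F"
      unfolding singular_points_def by blast
    obtain a where a: "F = pencil a" using invariant_cubic_in_pencil[OF F(1)] by blast
    have "a \<noteq> 0" using F(2) unfolding a by (auto simp: pencil_def)
    \<comment> \<open>With a1 = 0, each of the six linear conditions for a singular member forces a2
      = 0, because \<open>eta\<close> and \<open>eta + 1\<close> are nonzero.\<close>
    have "a$1 \<noteq> 0"
    proof
      assume "a$1 = 0"
      then have "a$2 = 0" using pencil_singular_cases[of a] F(3) eta_nz unfolding a by (auto simp: add.commute)
      with \<open>a$1 = 0\<close> \<open>a \<noteq> 0\<close> show False by (simp add: vec_eq_iff forall_2)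
    qed
    then have a': "a = a$1 *s vector [1, a$2 / a$1]" by (simp add: vec_eq_iff forall_2)
    have "X = form_pt (cubic (a$2 / a$1))"
      unfolding F(4) a cubic_eq_pencil by (subst a', rule form_pt_pencil_scale) fact
    moreover have "sing_locus (cubic (a$2 / a$1)) = sing_locus F"
    proof -
      have "F = (\<lambda>x. a$1 * cubic (a$2 / a$1) x)"
        using \<open>a$1 \<noteq> 0\<close> by (simp add: a pencil_def fun_eq_iff field_simps)
      then show ?thesis using sing_locus_scale[OF _ \<open>a$1 \<noteq> 0\<close>, of "cubic (a$2 / a$1)"] holo_pencil
        unfolding cubic_eq_pencil by simp
    qed
    ultimately show "X \<in> (\<lambda>t. form_pt (cubic t)) ` {t. sing_locus (cubic t) \<noteq> {}}"
      using F(3) by (intro image_eqI[of X _ "a$2 / a$1"]) simp_all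
  qed
  show "(\<lambda>t. form_pt (cubic t)) ` {t. sing_locus (cubic t) \<noteq> {}} \<subseteq> singular_points"
  proof
    fix X assume "X \<in> (\<lambda>t. form_pt (cubic t)) ` {t. sing_locus (cubic t) \<noteq> {}}"
    then obtain t where t: "sing_locus (cubic t) \<noteq> {}" "X = form_pt (cubic t)" by blast
    have "cubic t \<in> invariant_cubics" unfolding cubic_eq_pencil by (rule pencil_invariant)
    moreover have "cubic t \<noteq> (\<lambda>x. 0)"
    proof
      assume "cubic t = (\<lambda>x. 0)"
      then have "pencil (vector [1, t]) = pencil 0" unfolding cubic_eq_pencil by (simp add: pencil_def)
      from pencil_inj[OF this] show False by (simp add: vec_eq_iff forall_2)
    qed
    ultimately show "X \<in> singular_points" unfolding singular_points_def using t by blast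
  qed
qed

theorem proposition3p18:
  shows "bij_betw pencil UNIV invariant_cubics
    \<and> bij_betw (\<lambda>L. pencil ` L) proj_space proj_invariant_cubics
    \<and> card singular_points = 6
    \<and> singular_points = (\<lambda>t. form_pt (cubic t)) `
        {3 * ((1 + csqrt (-7)) / 4), 3 * ((1 - csqrt (-7)) / 4), -3/10, -15, -3/2, -3}
    \<and> (\<forall>t\<in>{3 * ((1 + csqrt (-7)) / 4), 3 * ((1 - csqrt (-7)) / 4)}.
        smooth_surface (sing_locus (cubic t)) \<and> veronese_surface (sing_locus (cubic t))
        \<and> determinantal (cubic t))
    \<and> (\<forall>t\<in>{-3/10, -15}. singular_exactly_in_nodes 7 (cubic t))
    \<and> (\<forall>t\<in>{-3/2, -3}. singular_exactly_in_nodes 14 (cubic t))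
    \<and> (\<exists>p q r. p \<in> git_quotient \<and> q \<in> git_quotient \<and> r \<in> git_quotient \<and> distinct [p, q, r]
        \<and> (\<forall>t\<in>{3 * ((1 + csqrt (-7)) / 4), 3 * ((1 - csqrt (-7)) / 4)}. git_point (cubic t) = p)
        \<and> (\<forall>t\<in>{-3/10, -15}. git_point (cubic t) = q)
        \<and> (\<forall>t\<in>{-3/2, -3}. git_point (cubic t) = r))"
proof -
  define d where "d = csqrt (-7)"
  have d2: "d\<^sup>2 = -7" unfolding d_def by (rule power2_csqrt)
  define S where "S = {3 * ((1 + d) / 4), 3 * ((1 - d) / 4)}"
  have S: "t \<in> S \<longleftrightarrow> 2 * t\<^sup>2 + 9 - 3 * t = 0" for t
    unfolding S_def by (rule determinantal_parameters(2)[OF d_def])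
  have sing: "{t. sing_locus (cubic t) \<noteq> {}} = S \<union> {-3/10, -15, -3/2, -3}"
    unfolding cubic_singular_iff using S by auto
  have "card (S \<union> {-3/10, -15, -3/2, -3}) = 6"
  proof -
    have "d \<noteq> 0" using d2 by auto
    then have "card S = 2" by (auto simp: S_def)
    moreover have "S \<inter> {-3/10, -15, -3/2, -3} = {}" using S by (auto simp: power2_eq_square)
    moreover have "card {-3/10, -15, -3/2, -3 :: complex} = 4" by simp
    ultimately show ?thesis by (subst card_Un_disjoint) (auto simp: S_def)
  qed
  then have c: "card singular_points = 6"
    unfolding singular_points_eq sing by (subst card_image[OF inj_on_subset[OF form_pt_cubic_inj subset_UNIV]])
  have sp: "singular_points = (\<lambda>t. form_pt (cubic t)) `
        {3 * ((1 + d) / 4), 3 * ((1 - d) / 4), -3/10, -15, -3/2, -3}"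
    unfolding singular_points_eq sing S_def by (simp only: Un_insert_left Un_empty_left)
  have dets: "\<forall>t\<in>S. smooth_surface (sing_locus (cubic t)) \<and> veronese_surface (sing_locus (cubic t))
        \<and> determinantal (cubic t)"
    using S cubic_determinantal by blast
  have n7: "\<forall>t\<in>{-3/10, -15}. singular_exactly_in_nodes 7 (cubic t)"
    and n14: "\<forall>t\<in>{-3/2, -3}. singular_exactly_in_nodes 14 (cubic t)"
    using cubic_nodes by blast+
  let ?p = "git_point (cubic (3 * ((1 + d) / 4)))"
  let ?q = "git_point (cubic (-15))"
  let ?r = "git_point (cubic (-3))"
  have p: "\<forall>t\<in>S. git_point (cubic t) = ?p"
  proof -
    have "git_point (cubic (3 * ((1 + d) / 4))) = git_point (cubic (3 * ((1 - d) / 4)))"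
    proof (rule git_point_duality)
      have "2 * (3 * ((1 + d) / 4) * (3 * ((1 - d) / 4))) = 9 / 8 * (1 - d\<^sup>2)"
        by (simp add: field_simps power2_eq_square)
      then show "2 * (3 * ((1 + d) / 4) * (3 * ((1 - d) / 4))) = 9" by (simp add: d2)
    qed
    then show ?thesis by (auto simp: S_def)
  qed
  have q: "\<forall>t\<in>{-3/10, -15}. git_point (cubic t) = ?q"
    using git_point_duality[of "-3/10" "-15"] by simp
  have r: "\<forall>t\<in>{-3/2, -3}. git_point (cubic t) = ?r"
    using git_point_duality[of "-3/2" "-3"] by simp
  \<comment> \<open>Each k is chosen so that the quadratic in t vanishes on one pair: 2 t^2 + 9 - 3
    t has the two determinantal parameters as roots, and 2 t^2 + 9 + 9 t has -3 and -3/2. Membership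
    of these two invariants tells the three ideals apart.\<close>
  have "3 * ((1 + d) / 4) \<in> S" by (simp add: S_def)
  then have "quad_invariant (-3) \<in> ?p"
    unfolding quad_invariant_in_git_point S by (simp only: diff_conv_add_uminus minus_mult_left)
  moreover have "quad_invariant (-3) \<notin> ?q" "quad_invariant (-3) \<notin> ?r" "quad_invariant 9 \<in> ?r" "quad_invariant 9 \<notin> ?q"
    unfolding quad_invariant_in_git_point by simp_all
  ultimately have dist: "distinct [?p, ?q, ?r]" by auto
  have quot: "?p \<in> git_quotient" "?q \<in> git_quotient" "?r \<in> git_quotient"
    unfolding git_quotient_def using semistable_cubic by blast+
  show ?thesis
    unfolding d_def[symmetric] S_def[symmetric]
    using bij_pencil bij_proj_pencil c sp dets n7 n14 p q r dist quot
    by (intro conjI exI[of _ ?p] exI[of _ ?q] exI[of _ ?r])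
qed

end
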